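(* With high probability, the twin-width of $G(n,1/2)$ is \[ \frac{n}{2}-\frac{\sqrt{3n\ln n}}{2}+o(\sqrt{n\ln n}). \]
   Context: $G(n,1/2)$ is the random graph on vertex set $\{1,\ldots,n\}$ in which each unordered pair of distinct vertices is adjacent with probability $1/2$, independently. "With high probability" means with probability tending to $1$ as $n\to\infty$. A statement "with high probability $X_n=f(n)+o(g(n))$" means that there is a function $h$ with $h(n)/g(n)\to0$ such that $|X_n-f(n)|\le h(n)$ with probability tending to $1$. $\ln$ is the natural logarithm. All graphs are finite and simple. Twin-width. A trigraph is a triple $G=(V,B,R)$ where $B,R$ are disjoint sets of $2$-element subsets of the finite set $V$; elements of $B$ are black edges and elements of $R$ are red edges. A graph $(V,E)$ is identified with the trigraph $(V,E,\emptyset)$. The red-degree of a vertex is the number of red edges incident with it. For distinct vertices $u,v$ (not necessarily adjacent), contracting $u$ and $v$ yields the trigraph obtained by deleting $u,v$, adding a new vertex $w$, keeping all edges (with colors) among the other vertices, and for each other vertex $x$: $wx$ is a black edge if both $ux$ and $vx$ are black edges; $wx$ is a non-edge if both $ux$ and $vx$ are non-edges; and $wx$ is a red edge otherwise. A $d$-contraction sequence of $G$ is a sequence of trigraphs starting with $G$, ending with a $1$-vertex graph, each obtained from the previous one by contracting two vertices, in which all trigraphs have maximum red-degree at most $d$. The twin-width of $G$ is the minimum $d$ such that $G$ has a $d$-contraction sequence. *)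

theory Defs
  imports "HOL-Probability.Probability" "HOL-Library.Infinite_Typeclass"
begin

definition pairs :: "'a set \<Rightarrow> 'a set set" where
  "pairs V = {e. e \<subseteq> V \<and> card e = 2}"

datatype 'a trigraph =
  Trigraph (verts: "'a set") (black: "'a set set") (red: "'a set set")

definition is_trigraph :: "'a trigraph \<Rightarrow> bool" where
  "is_trigraph T \<longleftrightarrow>
     finite (verts T) \<and> black T \<subseteq> pairs (verts T) \<and> red T \<subseteq> pairs (verts T) \<and>
     black T \<inter> red T = {}"

definition trigraph_of_graph :: "'a set \<Rightarrow> 'a set set \<Rightarrow> 'a trigraph" where
  "trigraph_of_graph V E = Trigraph V E {}"

definition red_degree :: "'a trigraph \<Rightarrow> 'a \<Rightarrow> nat" where
  "red_degree T v = card {e \<in> red T. v \<in> e}"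

definition non_edge :: "'a trigraph \<Rightarrow> 'a \<Rightarrow> 'a \<Rightarrow> bool" where
  "non_edge T x y \<longleftrightarrow> {x, y} \<notin> black T \<and> {x, y} \<notin> red T"

definition contract :: "'a trigraph \<Rightarrow> 'a \<Rightarrow> 'a \<Rightarrow> 'a \<Rightarrow> 'a trigraph" where
  "contract T u v w =
     (let V' = verts T - {u, v};
          Bw = {x \<in> V'. {u, x} \<in> black T \<and> {v, x} \<in> black T};
          Nw = {x \<in> V'. non_edge T u x \<and> non_edge T v x}
      in Trigraph (insert w V')
           ({e \<in> black T. u \<notin> e \<and> v \<notin> e} \<union> {{w, x} | x. x \<in> Bw})
           ({e \<in> red T. u \<notin> e \<and> v \<notin> e} \<union> {{w, x} | x. x \<in> V' - Bw - Nw}))"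

text \<open>The name of the new vertex is left open, since trigraphs matter only up to isomorphism
  here. The sort \<open>infinite\<close> in the next definition guarantees that a fresh name exists
  for every finite vertex set.\<close>

definition contracts_to :: "'a::infinite trigraph \<Rightarrow> 'a trigraph \<Rightarrow> bool" where
  "contracts_to T T' \<longleftrightarrow>
     (\<exists>u \<in> verts T. \<exists>v \<in> verts T. \<exists>w. u \<noteq> v \<and> w \<notin> verts T \<and> T' = contract T u v w)"

definition contraction_sequence ::
    "nat \<Rightarrow> 'a::infinite trigraph \<Rightarrow> 'a trigraph list \<Rightarrow> bool" where
  "contraction_sequence d T Ts \<longleftrightarrow>
     Ts \<noteq> [] \<and> hd Ts = T \<and> card (verts (last Ts)) = 1 \<and>
     successively contracts_to Ts \<and>
     (\<forall>S \<in> set Ts. is_trigraph S \<and> (\<forall>x \<in> verts S. red_degree S x \<le> d))"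

text \<open>For a trigraph without vertices there is no contraction sequence, and the value is
  unspecified.\<close>

definition twin_width :: "'a::infinite trigraph \<Rightarrow> nat" where
  "twin_width T = (LEAST d. \<exists>Ts. contraction_sequence d T Ts)"

text \<open>The edge set of the binomial random graph on the vertex set \<open>{1..n}\<close>. In the product
  distribution, \<open>False\<close> is only the value of the random function outside the set of pairs.\<close>

definition random_graph :: "nat \<Rightarrow> real \<Rightarrow> nat set set pmf" where
  "random_graph n p =
     map_pmf (\<lambda>f. {e \<in> pairs {1..n}. f e})
       (Pi_pmf (pairs {1..n}) False (\<lambda>_. bernoulli_pmf p))"

end

theory Submission
  imports Defs "HOL-Real_Asymp.Real_Asymp"
begin

text \<open>Write \<open>L = sqrt (n ln n)\<close>. The trigraphs of a contraction sequence are the partitions of the vertex set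
obtained by merging blocks, two blocks being joined by a red edge iff they are mixed, that is, iff
both an edge and a non-edge run between them. A block \<open>{u, v}\<close> sees almost only singletons at the
beginning, so its red degree is close to the number of splitters of \<open>u\<close> and \<open>v\<close>, the vertices
adjacent to exactly one of them. This number is binomial, and it is below \<open>n/2 - c L\<close> with probability
\<open>n powr (- 2 c^2)\<close> up to lower order terms.

Lower bound. While only \<open>k = o(n)\<close> contractions have been made and red degrees stay below \<open>n/2\<close>, no block
has three vertices, since these would be split by about \<open>3n/4\<close> singletons. After \<open>k\<close> contractions there are thus
exactly \<open>k\<close> blocks of size two, and the red degrees force each of them to have few splitters. With
\<open>c > sqrt 3 / 2\<close> there are in expectation at most \<open>n powr (2 - 2 c^2)\<close>, less than \<open>sqrt n\<close>, pairs
with at most \<open>n/2 - c L\<close> splitters. So no contraction sequence can survive \<open>k\<close> steps when \<open>k\<close> is a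
small multiple of \<open>L\<close> (lemma \<open>pr_contraction_sequence_small\<close>).

Upper bound. For \<open>c < sqrt 3 / 2\<close> the second moment method yields many more than \<open>L\<close> disjoint pairs
with at most \<open>n/2 - c L\<close> splitters (lemma \<open>pr_no_matching\<close>). Contracting a large constant times \<open>L\<close>
of them pays for everything that follows. Replacing the two vertices of a pair \<open>Y\<close> by one block
changes the red degree of a block \<open>X\<close> of size two by the excess of \<open>X\<close> and \<open>Y\<close>, which lies in
\<open>{-1, 0, 1}\<close> and has mean \<open>-1/8\<close>. A pair has at most \<open>n/2 + 2 L\<close> splitters, so after \<open>400 L\<close> pairs have been
contracted, a typical new block of size two has red degree well below \<open>n/2 - L\<close>. From then on a fixed perfect matching
\<open>fs\<close> of the other vertices can be contracted, and the partition with about \<open>n/2\<close> blocks reached in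
this way is finished by arbitrary merges (lemma \<open>reducible_of_matchings\<close>).

The pairs contracted first depend on the graph, which would spoil the concentration of their excesses.
The vertices are therefore divided into \<open>U\<close> and \<open>S\<close>, of small linear size, and \<open>W\<close>. The pairs are chosen
inside \<open>U\<close> by looking only at the edges between \<open>U\<close> and \<open>W\<close>, and are thus independent of the edges inside
\<open>U\<close> and between \<open>U\<close> and \<open>S\<close>. The matching \<open>fs\<close> treats \<open>S\<close> first, where the gain from the chosen pairs
is under control, and \<open>W\<close> afterwards, where the gain from the pairs of \<open>S\<close>, linear in \<open>n\<close>, outweighs the
worst possible contribution of the chosen pairs (lemmas \<open>pr_bad_matching\<close> and
\<open>pr_no_contraction_sequence\<close>).\<close>

section \<open>Trigraphs of a contraction sequence as partitions\<close>

definition complete_between :: "'a set set \<Rightarrow> 'a set \<Rightarrow> 'a set \<Rightarrow> bool" where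
  "complete_between E X Y \<longleftrightarrow> (\<forall>x\<in>X. \<forall>y\<in>Y. {x, y} \<in> E)"

definition mixed :: "'a set set \<Rightarrow> 'a set \<Rightarrow> 'a set \<Rightarrow> bool" where
  "mixed E X Y \<longleftrightarrow> (\<exists>x\<in>X. \<exists>y\<in>Y. {x, y} \<in> E) \<and> (\<exists>x\<in>X. \<exists>y\<in>Y. {x, y} \<notin> E)"

definition rdeg :: "'a set set \<Rightarrow> 'a set set \<Rightarrow> 'a set \<Rightarrow> nat" where
  "rdeg E P X = card {Y \<in> P - {X}. mixed E X Y}"

definition merge_blocks :: "'a set set \<Rightarrow> 'a set \<Rightarrow> 'a set \<Rightarrow> 'a set set" where
  "merge_blocks P X Y = insert (X \<union> Y) (P - {X, Y})"

text \<open>The block \<open>\<beta> x\<close> consists of the original vertices that have been contracted to \<open>x\<close>. New vertices of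
a contraction sequence have arbitrary names, so the map \<open>\<beta>\<close> has to be carried along.\<close>

definition represents ::
    "'b set set \<Rightarrow> 'a trigraph \<Rightarrow> ('a \<Rightarrow> 'b set) \<Rightarrow> 'b set set \<Rightarrow> bool" where
  "represents E T \<beta> P \<longleftrightarrow> is_trigraph T \<and> bij_betw \<beta> (verts T) P \<and>
     (\<forall>x\<in>verts T. \<forall>y\<in>verts T. x \<noteq> y \<longrightarrow>
        ({x, y} \<in> black T \<longleftrightarrow> complete_between E (\<beta> x) (\<beta> y)) \<and>
        ({x, y} \<in> red T \<longleftrightarrow> mixed E (\<beta> x) (\<beta> y)))"

lemma bex_doubleton_swap: "(\<exists>x\<in>X. \<exists>y\<in>Y. Q {x, y}) \<longleftrightarrow> (\<exists>y\<in>Y. \<exists>x\<in>X. Q {y, x})"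
proof -
  have "(\<exists>x\<in>X. \<exists>y\<in>Y. Q {x, y}) \<longleftrightarrow> (\<exists>y\<in>Y. \<exists>x\<in>X. Q {x, y})" by blast
  also have "\<dots> \<longleftrightarrow> (\<exists>y\<in>Y. \<exists>x\<in>X. Q {y, x})" by (simp only: insert_commute)
  finally show ?thesis .
qed

lemma mixed_sym: "mixed E X Y \<longleftrightarrow> mixed E Y X"
  unfolding mixed_def using bex_doubleton_swap[of X Y "\<lambda>e. e \<in> E"] bex_doubleton_swap[of X Y "\<lambda>e. e \<notin> E"]
  by blast

lemma complete_between_sym: "complete_between E X Y \<longleftrightarrow> complete_between E Y X"
  using bex_doubleton_swap[of X Y "\<lambda>e. e \<notin> E"] unfolding complete_between_def by blast

lemma complete_between_Un:
  "complete_between E (X \<union> Y) Z \<longleftrightarrow> complete_between E X Z \<and> complete_between E Y Z"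
  unfolding complete_between_def by auto

text \<open>This is the colouring rule of a contraction: the union is neither completely joined to \<open>Z\<close> nor
without edges to \<open>Z\<close>.\<close>

lemma mixed_Un:
  assumes "X \<noteq> {}" "Y \<noteq> {}" "Z \<noteq> {}"
  shows "mixed E (X \<union> Y) Z \<longleftrightarrow>
    \<not> (complete_between E X Z \<and> complete_between E Y Z) \<and>
    \<not> ((\<not> complete_between E X Z \<and> \<not> mixed E X Z) \<and> (\<not> complete_between E Y Z \<and> \<not> mixed E Y Z))"
  using assms unfolding mixed_def complete_between_def by blast

lemma partition_on_merge:
  assumes "partition_on V P" "X \<in> P" "Y \<in> P" "X \<noteq> Y"
  shows "partition_on V (merge_blocks P X Y)"
proof -
  have d: "\<And>A B. A \<in> P \<Longrightarrow> B \<in> P \<Longrightarrow> A \<noteq> B \<Longrightarrow> A \<inter> B = {}"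
    using assms(1) by (auto simp: partition_on_def disjoint_def)
  show ?thesis
    unfolding partition_on_def
  proof (intro conjI)
    show "\<Union>(merge_blocks P X Y) = V"
      using assms unfolding merge_blocks_def partition_on_def by blast
    show "disjoint (merge_blocks P X Y)"
      unfolding disjoint_def merge_blocks_def using d assms(2-4) by blast
    show "{} \<notin> merge_blocks P X Y"
      using assms unfolding merge_blocks_def partition_on_def by auto
  qed
qed

lemma merge_notin:
  assumes "partition_on V P" "X \<in> P" "Y \<in> P" "X \<noteq> Y"
  shows "X \<union> Y \<notin> P - {X, Y}"
proof
  assume a: "X \<union> Y \<in> P - {X, Y}"
  then have m: "X \<union> Y \<in> P" "X \<union> Y \<noteq> X" by auto
  have "disjoint P" using assms(1) by (simp add: partition_on_def)
  then have "(X \<union> Y) \<inter> X = {}" using disjointD[OF _ m(1) assms(2) m(2)] by simp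
  then show False using assms(1,2) by (auto simp: partition_on_def)
qed

lemma card_merge:
  assumes "partition_on V P" "X \<in> P" "Y \<in> P" "X \<noteq> Y" "finite P"
  shows "card (merge_blocks P X Y) = card P - 1" "card P \<ge> 2"
proof -
  have "card (P - {X,Y}) = card P - 2"
    using assms by (simp add: card_Diff_subset)
  moreover show *: "card P \<ge> 2"
    using card_mono[of P "{X,Y}"] assms by auto
  ultimately show "card (merge_blocks P X Y) = card P - 1"
    unfolding merge_blocks_def using merge_notin[OF assms(1-4)] assms(5) by simp
qed

lemma red_degree_eq_rdeg:
  assumes "represents E T \<beta> P" "x \<in> verts T"
  shows "red_degree T x = rdeg E P (\<beta> x)"
proof -
  have tri: "is_trigraph T" and bij: "bij_betw \<beta> (verts T) P"
    and R: "\<And>y. y \<in> verts T \<Longrightarrow> x \<noteq> y \<Longrightarrow> {x, y} \<in> red T \<longleftrightarrow> mixed E (\<beta> x) (\<beta> y)"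
    using assms unfolding represents_def by auto
  define N where "N = {y \<in> verts T. y \<noteq> x \<and> {x,y} \<in> red T}"
  have "{e \<in> red T. x \<in> e} = (\<lambda>y. {x,y}) ` N"
  proof (intro equalityI subsetI)
    fix e assume e: "e \<in> {e \<in> red T. x \<in> e}"
    then have "e \<in> pairs (verts T)" using tri unfolding is_trigraph_def by auto
    then obtain a b where "e = {a,b}" "a \<noteq> b" "e \<subseteq> verts T"
      by (auto simp: pairs_def card_2_iff)
    then show "e \<in> (\<lambda>y. {x,y}) ` N" using e unfolding N_def by (auto simp: insert_commute)
  qed (auto simp: N_def)
  moreover have "inj_on (\<lambda>y. {x,y}) N"
    by (auto simp: inj_on_def doubleton_eq_iff)
  ultimately have "red_degree T x = card N"
    unfolding red_degree_def by (simp add: card_image)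
  also have "bij_betw \<beta> N {Y \<in> P - {\<beta> x}. mixed E (\<beta> x) Y}"
    using bij assms(2) R unfolding bij_betw_def N_def inj_on_def by (auto simp: image_iff)
  then have "card N = rdeg E P (\<beta> x)" unfolding rdeg_def by (rule bij_betw_same_card)
  finally show ?thesis .
qed

text \<open>Contraction is union of blocks, because black, red and non-edges between blocks record exactly whether
all, some or no pairs between them are edges, and this information about a union follows from that
about its two parts.\<close>

lemma represents_contract:
  assumes rep: "represents E T \<beta> P" and part: "partition_on V P"
    and uv: "u \<in> verts T" "v \<in> verts T" "u \<noteq> v" "w \<notin> verts T"
  shows "represents E (contract T u v w) (\<beta>(w := \<beta> u \<union> \<beta> v)) (merge_blocks P (\<beta> u) (\<beta> v))"
proof -
  have tri: "is_trigraph T" and bij: "bij_betw \<beta> (verts T) P"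
    and B: "\<And>x y. x \<in> verts T \<Longrightarrow> y \<in> verts T \<Longrightarrow> x \<noteq> y \<Longrightarrow>
       {x, y} \<in> black T \<longleftrightarrow> complete_between E (\<beta> x) (\<beta> y)"
    and R: "\<And>x y. x \<in> verts T \<Longrightarrow> y \<in> verts T \<Longrightarrow> x \<noteq> y \<Longrightarrow>
       {x, y} \<in> red T \<longleftrightarrow> mixed E (\<beta> x) (\<beta> y)"
    using rep unfolding represents_def by auto
  have bp: "\<And>e. e \<in> black T \<Longrightarrow> e \<subseteq> verts T \<and> card e = 2"
    and rp: "\<And>e. e \<in> red T \<Longrightarrow> e \<subseteq> verts T \<and> card e = 2"
    using tri unfolding is_trigraph_def pairs_def by auto
  have ne: "\<And>x. x \<in> verts T \<Longrightarrow> \<beta> x \<noteq> {}"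
    using bij part unfolding bij_betw_def partition_on_def by force
  define V' where "V' = verts T - {u,v}"
  define Bw where "Bw = {x \<in> V'. {u, x} \<in> black T \<and> {v, x} \<in> black T}"
  define Nw where "Nw = {x \<in> V'. non_edge T u x \<and> non_edge T v x}"
  have c: "contract T u v w = Trigraph (insert w V')
           ({e \<in> black T. u \<notin> e \<and> v \<notin> e} \<union> {{w, x} | x. x \<in> Bw})
           ({e \<in> red T. u \<notin> e \<and> v \<notin> e} \<union> {{w, x} | x. x \<in> V' - Bw - Nw})"
    unfolding contract_def V'_def Bw_def Nw_def Let_def by simp
  have wV: "w \<notin> V'" using uv(4) unfolding V'_def by auto
  have sub: "\<And>e. e \<subseteq> verts T \<Longrightarrow> u \<notin> e \<Longrightarrow> v \<notin> e \<Longrightarrow> e \<subseteq> insert w V'"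
    unfolding V'_def by auto
  have card2: "\<And>x. x \<in> V' \<Longrightarrow> card {w,x} = 2" using wV by (metis card_2_iff)
  have wne: "\<And>e. e \<subseteq> verts T \<Longrightarrow> w \<notin> e" using uv(4) by auto
  let ?T = "contract T u v w" and ?\<beta> = "\<beta>(w := \<beta> u \<union> \<beta> v)"
  have blackw: "{w,x} \<in> black ?T \<longleftrightarrow> x \<in> Bw" if "x \<in> V'" for x
    using that wV bp uv(4) unfolding c by (auto simp: doubleton_eq_iff Bw_def dest: bp)
  have redw: "{w,x} \<in> red ?T \<longleftrightarrow> x \<in> V' - Bw - Nw" if "x \<in> V'" for x
    using that wV rp uv(4) unfolding c by (auto simp: doubleton_eq_iff dest: rp)
  have blacko: "{x,y} \<in> black ?T \<longleftrightarrow> {x,y} \<in> black T" if "x \<in> V'" "y \<in> V'" for x y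
    using that wV unfolding c V'_def by (auto simp: doubleton_eq_iff)
  have redo: "{x,y} \<in> red ?T \<longleftrightarrow> {x,y} \<in> red T" if "x \<in> V'" "y \<in> V'" for x y
    using that wV unfolding c V'_def by (auto simp: doubleton_eq_iff)
  have tri': "is_trigraph ?T"
    unfolding is_trigraph_def
  proof (intro conjI)
    show "finite (verts ?T)" using tri unfolding c is_trigraph_def V'_def by auto
    have o: "e \<in> pairs (insert w V')" if "e \<subseteq> verts T \<and> card e = 2" "u \<notin> e" "v \<notin> e" for e
      using that sub unfolding pairs_def by blast
    have n: "{w, x} \<in> pairs (insert w V')" if "x \<in> V'" for x
      using that card2 unfolding pairs_def by simp
    show "black ?T \<subseteq> pairs (verts ?T)"
    proof
      fix e assume "e \<in> black ?T"
      then consider "e \<in> black T" "u \<notin> e" "v \<notin> e" | x where "e = {w,x}" "x \<in> V'"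
        unfolding c Bw_def by auto
      then have "e \<in> pairs (insert w V')"
        by cases (use o bp in blast, use n in blast)
      then show "e \<in> pairs (verts ?T)" unfolding c by simp
    qed
    show "red ?T \<subseteq> pairs (verts ?T)"
    proof
      fix e assume "e \<in> red ?T"
      then consider "e \<in> red T" "u \<notin> e" "v \<notin> e" | x where "e = {w,x}" "x \<in> V'"
        unfolding c by auto
      then have "e \<in> pairs (insert w V')"
        by cases (use o rp in blast, use n in blast)
      then show "e \<in> pairs (verts ?T)" unfolding c by simp
    qed
    have br: "black T \<inter> red T = {}" using tri unfolding is_trigraph_def by auto
    have False if e: "e \<in> black ?T" "e \<in> red ?T" for e
    proof (cases "w \<in> e")
      case True
      then have "e \<notin> black T" "e \<notin> red T" using wne bp rp by blast+
      then obtain x y where "e = {w,x}" "x \<in> Bw" "e = {w,y}" "y \<in> V' - Bw - Nw"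
        using e unfolding c by auto
      then show False by (auto simp: doubleton_eq_iff)
    next
      case False
      then have "e \<in> black T" "e \<in> red T" using e unfolding c by auto
      then show False using br by blast
    qed
    then show "black ?T \<inter> red ?T = {}" by blast
  qed
  have inj: "inj_on \<beta> (verts T)" and im: "\<beta> ` verts T = P" using bij unfolding bij_betw_def by auto
  have buv: "\<beta> u \<in> P" "\<beta> v \<in> P" "\<beta> u \<noteq> \<beta> v" using uv inj im by (auto simp: inj_on_def)
  have imV: "\<beta> ` V' = P - {\<beta> u, \<beta> v}"
    unfolding V'_def using inj im uv by (auto simp: inj_on_def)
  have bij': "bij_betw ?\<beta> (verts ?T) (merge_blocks P (\<beta> u) (\<beta> v))"
  proof -
    have "inj_on \<beta> V'" by (rule inj_on_subset[OF inj]) (auto simp: V'_def)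
    then have "bij_betw \<beta> V' (P - {\<beta> u, \<beta> v})" using imV unfolding bij_betw_def by simp
    then have "bij_betw ?\<beta> V' (P - {\<beta> u, \<beta> v})"
      using wV by (subst bij_betw_cong[where g = \<beta>]) auto
    moreover have "?\<beta> w \<notin> P - {\<beta> u, \<beta> v}" using merge_notin[OF part buv] by simp
    ultimately have "bij_betw ?\<beta> (V' \<union> {w}) ((P - {\<beta> u, \<beta> v}) \<union> {?\<beta> w})"
      using wV by (metis notIn_Un_bij_betw)
    then show ?thesis unfolding c merge_blocks_def by simp
  qed
  have new: "({w, x} \<in> black ?T \<longleftrightarrow> complete_between E (?\<beta> w) (?\<beta> x)) \<and>
        ({w, x} \<in> red ?T \<longleftrightarrow> mixed E (?\<beta> w) (?\<beta> x))" if x: "x \<in> V'" for x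
  proof -
    have xx: "x \<in> verts T" "x \<noteq> u" "x \<noteq> v" "x \<noteq> w" using x wV unfolding V'_def by auto
    have 1: "x \<in> Bw \<longleftrightarrow> complete_between E (\<beta> u) (\<beta> x) \<and> complete_between E (\<beta> v) (\<beta> x)"
      unfolding Bw_def using x xx uv B by auto
    have 2: "x \<in> Nw \<longleftrightarrow> (\<not> complete_between E (\<beta> u) (\<beta> x) \<and> \<not> mixed E (\<beta> u) (\<beta> x)) \<and>
       (\<not> complete_between E (\<beta> v) (\<beta> x) \<and> \<not> mixed E (\<beta> v) (\<beta> x))"
      unfolding Nw_def non_edge_def using x xx uv B R by auto
    show ?thesis
      unfolding blackw[OF x] redw[OF x]
      using xx(4) x 1 2 mixed_Un[OF ne[OF uv(1)] ne[OF uv(2)] ne[OF xx(1)], of E]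
      by (simp add: complete_between_Un)
  qed
  have "({x, y} \<in> black ?T \<longleftrightarrow> complete_between E (?\<beta> x) (?\<beta> y)) \<and>
        ({x, y} \<in> red ?T \<longleftrightarrow> mixed E (?\<beta> x) (?\<beta> y))"
    if xy: "x \<in> verts ?T" "y \<in> verts ?T" "x \<noteq> y" for x y
  proof -
    consider "x = w" "y \<in> V'" | "y = w" "x \<in> V'" | "x \<in> V'" "y \<in> V'"
      using xy unfolding c by auto
    then show ?thesis
    proof cases
      case 1 then show ?thesis using new by simp
    next
      case 2
      have "{x, y} = {w, x}" using 2 by auto
      then show ?thesis using new[OF 2(2)] unfolding 2(1)
        by (simp only: mixed_sym[of E "?\<beta> x"] complete_between_sym[of E "?\<beta> x"])
    next
      case 3
      then have "x \<in> verts T" "y \<in> verts T" "x \<noteq> w" "y \<noteq> w" using wV unfolding V'_def by auto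
      then show ?thesis using blacko[OF 3] redo[OF 3] B[of x y] R[of x y] xy(3) by simp
    qed
  qed
  then show ?thesis unfolding represents_def using tri' bij' by simp
qed

lemma represents_initial:
  assumes "finite V" "E \<subseteq> pairs V"
  shows "represents E (trigraph_of_graph V E) (\<lambda>x. {x}) ((\<lambda>x. {x}) ` V)"
  using assms
  by (auto simp: represents_def is_trigraph_def trigraph_of_graph_def bij_betw_def
       complete_between_def mixed_def)

text \<open>The sequence of partitions that remains to be traversed, without any choice of names for new vertices.\<close>

inductive reducible :: "'a set set \<Rightarrow> nat \<Rightarrow> 'a set set \<Rightarrow> bool" for E d where
  single: "card P = 1 \<Longrightarrow> reducible E d P"
| step: "(\<And>X. X \<in> P \<Longrightarrow> rdeg E P X \<le> d) \<Longrightarrow> X \<in> P \<Longrightarrow> Y \<in> P \<Longrightarrow> X \<noteq> Y \<Longrightarrow>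
    reducible E d (merge_blocks P X Y) \<Longrightarrow> reducible E d P"

text \<open>The only thing to supply at each merge is a fresh name for the new vertex, and the vertex set is
finite while the type is not.\<close>

lemma contraction_sequence_of_reducible:
  fixes T :: "'a::infinite trigraph"
  assumes "reducible E d P" "represents E T \<beta> P" "partition_on V P"
  shows "\<exists>Ts. contraction_sequence d T Ts"
  using assms
proof (induction P arbitrary: T \<beta> rule: reducible.induct)
  case (single P)
  have tri: "is_trigraph T" and bij: "bij_betw \<beta> (verts T) P"
    using single.prems(1) unfolding represents_def by auto
  have c: "card (verts T) = 1" using bij_betw_same_card[OF bij] single by simp
  have "red_degree T x \<le> d" if "x \<in> verts T" for x
  proof -
    have "{Y \<in> P - {\<beta> x}. mixed E (\<beta> x) Y} = {}"
      using single.hyps that bij unfolding bij_betw_def by (auto simp: card_1_singleton_iff)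
    then show ?thesis unfolding red_degree_eq_rdeg[OF single.prems(1) that] rdeg_def
      by (metis card.empty zero_le)
  qed
  then have "contraction_sequence d T [T]" using c tri unfolding contraction_sequence_def by simp
  then show ?case by blast
next
  case (step P X Y)
  have tri: "is_trigraph T" and bij: "bij_betw \<beta> (verts T) P"
    using step.prems(1) unfolding represents_def by auto
  have "X \<in> \<beta> ` verts T" "Y \<in> \<beta> ` verts T"
    using step.hyps(2,3) bij unfolding bij_betw_def by auto
  then obtain u v where uv: "u \<in> verts T" "v \<in> verts T" "X = \<beta> u" "Y = \<beta> v"
    by auto
  have "finite (verts T)" using tri unfolding is_trigraph_def by simp
  then obtain w where w: "w \<notin> verts T" using ex_new_if_finite[OF infinite_UNIV] by metis
  have ne: "u \<noteq> v" using step.hyps uv by auto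
  let ?T = "contract T u v w"
  have "represents E ?T (\<beta>(w := X \<union> Y)) (merge_blocks P X Y)"
    unfolding uv(3,4) by (rule represents_contract[OF step.prems uv(1,2) ne w])
  then obtain Ts where Ts: "contraction_sequence d ?T Ts"
    using step.IH partition_on_merge[OF step.prems(2) step.hyps(2-4)] by metis
  have ct: "contracts_to T ?T" unfolding contracts_to_def using uv ne w by blast
  have "red_degree T x \<le> d" if "x \<in> verts T" for x
    unfolding red_degree_eq_rdeg[OF step.prems(1) that]
    using step.hyps(1) that bij unfolding bij_betw_def by blast
  then have "contraction_sequence d T (T # Ts)"
    using Ts ct tri unfolding contraction_sequence_def
    by (auto simp: successively_Cons)
  then show ?case ..
qed

text \<open>Every contraction loses exactly one block.\<close>

lemma partition_of_contraction_sequence: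
  fixes T :: "'a::infinite trigraph"
  assumes "contraction_sequence d T Ts" "represents E T \<beta> P" "partition_on V P" "i < length Ts"
  shows "\<exists>\<beta>' Q. represents E (Ts ! i) \<beta>' Q \<and> partition_on V Q \<and> card Q + i = card P"
  using assms(4)
proof (induction i)
  case 0
  have "Ts ! 0 = T" using assms(1) by (auto simp: contraction_sequence_def hd_conv_nth)
  then show ?case using assms(2,3) by (intro exI[of _ \<beta>] exI[of _ P]) simp
next
  case (Suc i)
  then obtain \<beta>' Q where Q: "represents E (Ts ! i) \<beta>' Q" "partition_on V Q" "card Q + i = card P"
    by auto
  have "contracts_to (Ts ! i) (Ts ! Suc i)"
    using assms(1) Suc.prems unfolding contraction_sequence_def
    by (auto simp: successively_conv_nth)
  then obtain u v w where uvw: "u \<in> verts (Ts ! i)" "v \<in> verts (Ts ! i)" "u \<noteq> v" "w \<notin> verts (Ts ! i)"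
    "Ts ! Suc i = contract (Ts ! i) u v w"
    unfolding contracts_to_def by blast
  have bij: "bij_betw \<beta>' (verts (Ts ! i)) Q" and fin: "finite (verts (Ts ! i))"
    using Q(1) unfolding represents_def is_trigraph_def by auto
  have fQ: "finite Q" using bij fin bij_betw_finite by blast
  have b: "\<beta>' u \<in> Q" "\<beta>' v \<in> Q" "\<beta>' u \<noteq> \<beta>' v"
    using bij uvw unfolding bij_betw_def inj_on_def by auto
  have "card (merge_blocks Q (\<beta>' u) (\<beta>' v)) + Suc i = card P"
    using card_merge[OF Q(2) b fQ] Q(3) by simp
  then show ?case
    unfolding uvw(5)
    using represents_contract[OF Q(1,2) uvw(1-4)] partition_on_merge[OF Q(2) b]
    by (intro exI[of _ "\<beta>'(w := \<beta>' u \<union> \<beta>' v)"] exI[of _ "merge_blocks Q (\<beta>' u) (\<beta>' v)"])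
      (simp del: fun_upd_apply)
qed

section \<open>Uniformly random subsets\<close>

text \<open>The expectation of \<open>f E\<close> for a uniformly random subset \<open>E\<close> of \<open>A\<close>. For edge probability one half this
replaces the product measure by finite sums.\<close>

definition avg :: "'a set \<Rightarrow> ('a set \<Rightarrow> real) \<Rightarrow> real" where
  "avg A f = (\<Sum>E\<in>Pow A. f E) / 2 ^ card A"

abbreviation pr :: "'a set \<Rightarrow> ('a set \<Rightarrow> bool) \<Rightarrow> real" where
  "pr A P \<equiv> avg A (\<lambda>E. of_bool (P E))"

lemma prob_random_graph:
  "measure_pmf.prob (random_graph n (1/2)) {E. P E} = pr (pairs {1..n}) P"
proof -
  have fin: "finite (pairs {1..n})" unfolding pairs_def by simp
  have "random_graph n (1/2) = pmf_of_set (Pow (pairs {1..n}))"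
    unfolding random_graph_def by (rule pmf_of_set_Pow_conv_bernoulli[OF fin])
  then have "measure_pmf.prob (random_graph n (1/2)) {E. P E}
      = card (Pow (pairs {1..n}) \<inter> {E. P E}) / card (Pow (pairs {1..n}))"
    using fin by (simp add: measure_pmf_of_set Pow_not_empty)
  moreover have "(\<Sum>E\<in>Pow (pairs {1..n}). of_bool (P E) :: real)
      = card (Pow (pairs {1..n}) \<inter> {E. P E})"
    using fin by (subst sum_of_bool_eq) auto
  ultimately show ?thesis unfolding avg_def using fin by (simp add: card_Pow)
qed

lemma avg_empty [simp]: "avg {} f = f {}"
  by (simp add: avg_def)

lemma avg_insert:
  assumes "finite A" "e \<notin> A"
  shows "avg (insert e A) f = (avg A f + avg A (\<lambda>E. f (insert e E))) / 2"
proof -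
  have "(\<Sum>E\<in>Pow (insert e A). f E) = (\<Sum>E\<in>Pow A. f E) + (\<Sum>E\<in>insert e ` Pow A. f E)"
    unfolding Pow_insert using assms by (intro sum.union_disjoint) auto
  also have "(\<Sum>E\<in>insert e ` Pow A. f E) = (\<Sum>E\<in>Pow A. f (insert e E))"
    using assms by (subst sum.reindex) (auto simp: inj_on_def)
  finally show ?thesis using assms by (simp add: avg_def field_simps)
qed

lemma avg_cong: "(\<And>E. E \<subseteq> A \<Longrightarrow> f E = g E) \<Longrightarrow> avg A f = avg A g"
  by (simp add: avg_def)

lemma avg_mono: "(\<And>E. E \<subseteq> A \<Longrightarrow> f E \<le> g E) \<Longrightarrow> avg A f \<le> avg A g"
  by (auto simp: avg_def intro!: divide_right_mono sum_mono)

lemma avg_const [simp]: "finite A \<Longrightarrow> avg A (\<lambda>_. c) = c"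
  by (simp add: avg_def card_Pow)

lemma avg_cmult: "avg A (\<lambda>E. c * f E) = c * avg A f"
  by (simp add: avg_def sum_distrib_left)

lemma avg_multc: "avg A (\<lambda>E. f E * c) = avg A f * c"
  by (simp add: avg_def sum_distrib_right[symmetric])

lemma avg_add: "avg A (\<lambda>E. f E + g E) = avg A f + avg A g"
  by (simp add: avg_def sum.distrib add_divide_distrib)

lemma avg_diff: "avg A (\<lambda>E. f E - g E) = avg A f - avg A g"
  by (simp add: avg_def sum_subtractf diff_divide_distrib)

lemma avg_sum: "avg A (\<lambda>E. \<Sum>i\<in>I. f i E) = (\<Sum>i\<in>I. avg A (f i))"
  unfolding avg_def by (subst sum.swap) (simp add: sum_divide_distrib)

text \<open>Fubini: a random subset of a disjoint union is the union of independent random subsets.\<close>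

lemma avg_Un:
  assumes "finite A" "finite B" "A \<inter> B = {}"
  shows "avg (A \<union> B) f = avg A (\<lambda>E. avg B (\<lambda>E'. f (E \<union> E')))"
  using assms(1,3)
proof (induction A arbitrary: f)
  case (insert e A)
  have "avg (insert e A \<union> B) f = (avg (A \<union> B) f + avg (A \<union> B) (\<lambda>E. f (insert e E))) / 2"
    using insert assms(2) by (simp add: avg_insert)
  then show ?case using insert by (simp add: avg_insert)
qed simp

lemma avg_restrict:
  assumes "finite B" "A \<subseteq> B" "\<And>E. E \<subseteq> B \<Longrightarrow> f E = f (E \<inter> A)"
  shows "avg B f = avg A f"
proof -
  have fin: "finite A" "finite (B - A)" using assms finite_subset by auto
  have "B = A \<union> (B - A)" using assms by auto
  then have "avg B f = avg A (\<lambda>E. avg (B - A) (\<lambda>E'. f (E \<union> E')))"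
    using avg_Un[OF fin] by (metis Diff_disjoint)
  also have "\<dots> = avg A (\<lambda>E. avg (B - A) (\<lambda>E'. f E))"
  proof (intro avg_cong)
    fix E E' assume "E \<subseteq> A" "E' \<subseteq> B - A"
    then have "(E \<union> E') \<inter> A = E" "E \<union> E' \<subseteq> B" "E \<inter> A = E" "E \<subseteq> B" using assms(2) by auto
    then show "f (E \<union> E') = f E" using assms(3) by metis
  qed
  finally show ?thesis using fin by simp
qed

text \<open>Two functions of disjoint parts of the random set are independent.\<close>

lemma avg_mult:
  assumes "finite B" "A \<subseteq> B" "\<And>E. f E = f (E \<inter> A)" "\<And>E. g E = g (E - A)"
  shows "avg B (\<lambda>E. f E * g E) = avg B f * avg B g"
proof -
  have fin: "finite A" "finite (B - A)" using assms finite_subset by auto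
  have B: "B = A \<union> (B - A)" using assms by auto
  have "avg B (\<lambda>E. f E * g E) = avg A (\<lambda>E. avg (B - A) (\<lambda>E'. f (E \<union> E') * g (E \<union> E')))"
    by (subst B, subst avg_Un[OF fin]) auto
  also have "\<dots> = avg A (\<lambda>E. avg (B - A) (\<lambda>E'. f E * g E'))"
  proof (intro avg_cong)
    fix E E' assume "E \<subseteq> A" "E' \<subseteq> B - A"
    then have "(E \<union> E') \<inter> A = E" "(E \<union> E') - A = E'" "E \<inter> A = E" by auto
    then show "f (E \<union> E') * g (E \<union> E') = f E * g E'" using assms(3,4) by metis
  qed
  also have "\<dots> = avg A f * avg (B - A) g"
    by (simp add: avg_cmult avg_multc)
  also have "avg A f = avg B f" using assms by (intro avg_restrict[symmetric]) auto
  also have "avg (B - A) g = avg B g"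
  proof (intro avg_restrict[symmetric])
    fix E assume "E \<subseteq> B"
    then have "E \<inter> (B - A) = E - A" by auto
    then show "g E = g (E \<inter> (B - A))" using assms(4) by metis
  qed (use assms in auto)
  finally show ?thesis .
qed

lemma avg_prod:
  assumes "finite I" "finite B" "\<And>i. i \<in> I \<Longrightarrow> A i \<subseteq> B" "disjoint_family_on A I"
    "\<And>i E. i \<in> I \<Longrightarrow> f i E = f i (E \<inter> A i)"
  shows "avg B (\<lambda>E. \<Prod>i\<in>I. f i E) = (\<Prod>i\<in>I. avg B (f i))"
  using assms(1,3-5)
proof (induction I)
  case (insert i I)
  have dis: "A j \<inter> A i = {}" if "j \<in> I" for j
    using insert.prems(2) insert.hyps(2) that unfolding disjoint_family_on_def by auto
  have *: "f j E = f j (E - A i)" if "j \<in> I" for j E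
  proof -
    have "(E - A i) \<inter> A j = E \<inter> A j" using dis[OF that] by auto
    then show ?thesis using insert.prems(3)[of j E] insert.prems(3)[of j "E - A i"] that by simp
  qed
  have "avg B (\<lambda>E. f i E * (\<Prod>i\<in>I. f i E)) = avg B (f i) * avg B (\<lambda>E. \<Prod>i\<in>I. f i E)"
  proof (rule avg_mult[where A = "A i", OF assms(2)])
    show "A i \<subseteq> B" using insert.prems by simp
    show "f i E = f i (E \<inter> A i)" for E using insert.prems(3)[of i E] by simp
    show "(\<Prod>j\<in>I. f j E) = (\<Prod>j\<in>I. f j (E - A i))" for E
      by (rule prod.cong[OF refl]) (rule *)
  qed
  moreover have "avg B (\<lambda>E. \<Prod>i\<in>I. f i E) = (\<Prod>i\<in>I. avg B (f i))"
  proof (rule insert.IH)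
    show "disjoint_family_on A I" using insert.prems(2) by (auto simp: disjoint_family_on_def)
  qed (use insert.prems(1,3) in blast)+
  ultimately show ?case using insert.hyps by simp
qed (use assms(2) in simp)

text \<open>Markov's inequality in the form used for all tail bounds below.\<close>

lemma pr_le_avg:
  assumes "\<And>E. E \<subseteq> A \<Longrightarrow> 0 \<le> f E" "\<And>E. E \<subseteq> A \<Longrightarrow> P E \<Longrightarrow> 1 \<le> f E"
  shows "pr A P \<le> avg A f"
  using assms by (intro avg_mono) (auto simp: of_bool_def)

lemma pr_mono: "(\<And>E. E \<subseteq> A \<Longrightarrow> P E \<Longrightarrow> Q E) \<Longrightarrow> pr A P \<le> pr A Q"
  by (intro avg_mono) auto

lemma pr_nonneg: "0 \<le> pr A P"
  by (simp add: avg_def sum_nonneg)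

lemma pr_le_1: "finite A \<Longrightarrow> pr A P \<le> 1"
  using avg_mono[of A "\<lambda>E. of_bool (P E)" "\<lambda>_. 1"] by simp

lemma pr_not: "finite A \<Longrightarrow> pr A (\<lambda>E. \<not> P E) = 1 - pr A P"
  by (simp add: of_bool_not_iff avg_diff)

lemma pr_disj: "pr A (\<lambda>E. P E \<or> Q E) \<le> pr A P + pr A Q"
  unfolding avg_add[symmetric] by (intro avg_mono) auto

lemma pr_union_bound:
  assumes "finite I" "\<And>i. i \<in> I \<Longrightarrow> pr A (P i) \<le> c"
  shows "pr A (\<lambda>E. \<exists>i\<in>I. P i E) \<le> real (card I) * c"
proof -
  have "pr A (\<lambda>E. \<exists>i\<in>I. P i E) \<le> avg A (\<lambda>E. \<Sum>i\<in>I. of_bool (P i E))"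
  proof (rule pr_le_avg)
    fix E assume "\<exists>i\<in>I. P i E"
    then obtain i where "i \<in> I" "P i E" by auto
    then show "1 \<le> (\<Sum>i\<in>I. of_bool (P i E) :: real)"
      using assms(1) member_le_sum[of i I "\<lambda>i. of_bool (P i E) :: real"] by simp
  qed (simp add: sum_nonneg)
  also have "\<dots> \<le> real (card I) * c"
    unfolding avg_sum by (rule sum_bounded_above) (rule assms(2))
  finally show ?thesis .
qed

text \<open>Deferred decisions: \<open>M E\<close> is chosen by looking only at \<open>E \<inter> B\<close>, while the bad event \<open>R m\<close> for a fixed
\<open>m\<close> depends only on the rest. Conditioning on \<open>E \<inter> B\<close> makes \<open>M E\<close> constant, so a bound that holds for every
fixed \<open>m\<close> passes to the chosen one, without a union bound over the possible values of \<open>M\<close>.\<close>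

lemma pr_choice:
  assumes "finite A" "B \<subseteq> A" "\<And>E. M E = M (E \<inter> B)"
    "\<And>m E. R m E = R m (E - B)" "\<And>E. Q E \<Longrightarrow> pr A (R (M E)) \<le> c"
    "\<And>E. Q E = Q (E \<inter> B)" "0 \<le> c"
  shows "pr A (\<lambda>E. Q E \<and> R (M E) E) \<le> c"
proof -
  have fin: "finite B" "finite (A - B)" using assms finite_subset by auto
  have A: "A = B \<union> (A - B)" using assms by auto
  have "pr A (\<lambda>E. Q E \<and> R (M E) E)
     = avg B (\<lambda>E. avg (A - B) (\<lambda>E'. of_bool (Q (E \<union> E') \<and> R (M (E \<union> E')) (E \<union> E'))))"
    by (subst A, subst avg_Un[OF fin]) auto
  also have "\<dots> \<le> avg B (\<lambda>E. c)"
  proof (rule avg_mono)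
    fix E assume E: "E \<subseteq> B"
    have *: "Q (E \<union> E') = Q E" "M (E \<union> E') = M E" "R m (E \<union> E') = R m E'" if "E' \<subseteq> A - B" for E' m
    proof -
      have "(E \<union> E') \<inter> B = E" "E \<inter> B = E" "E \<union> E' - B = E'" using E that by auto
      then show "Q (E \<union> E') = Q E" "M (E \<union> E') = M E" "R m (E \<union> E') = R m E'"
        using assms(3,4,6) by metis+
    qed
    have "avg (A - B) (\<lambda>E'. of_bool (Q (E \<union> E') \<and> R (M (E \<union> E')) (E \<union> E')))
       = avg (A - B) (\<lambda>E'. of_bool (Q E \<and> R (M E) E'))"
      using * by (intro avg_cong) simp
    also have "\<dots> \<le> c"
    proof (cases "Q E")
      case True
      have "avg (A - B) (\<lambda>E'. of_bool (R (M E) E')) = avg A (\<lambda>E'. of_bool (R (M E) E'))"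
      proof (rule avg_restrict[symmetric])
        fix E' assume "E' \<subseteq> A"
        then have "E' \<inter> (A - B) = E' - B" by auto
        then show "of_bool (R (M E) E') = (of_bool (R (M E) (E' \<inter> (A - B))) :: real)"
          using assms(4)[of "M E" E'] by simp
      qed (use assms in auto)
      then show ?thesis using True assms(5)[of E] by simp
    qed (use assms(7) fin in simp)
    finally show "avg (A - B) (\<lambda>E'. of_bool (Q (E \<union> E') \<and> R (M (E \<union> E')) (E \<union> E'))) \<le> c" .
  qed
  also have "\<dots> = c" using fin by simp
  finally show ?thesis .
qed

section \<open>Splitting vertices and splitting pairs\<close>

text \<open>The potential edges between \<open>X\<close> and \<open>Y\<close>. Whether two sets are mixed depends on these alone, and for
disjoint sets \<open>Y\<close> and \<open>Z\<close> they do not overlap, which is the source of all independence below.\<close>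

definition cross :: "'a set \<Rightarrow> 'a set \<Rightarrow> 'a set set" where
  "cross X Y = (\<lambda>(x, y). {x, y}) ` (X \<times> Y)"

lemma cross_subset_pairs:
  assumes "X \<subseteq> V" "Y \<subseteq> V" "X \<inter> Y = {}"
  shows "cross X Y \<subseteq> pairs V"
  using assms by (auto simp: cross_def pairs_def card_2_iff) blast

lemma mixed_cross: "cross X Y \<subseteq> C \<Longrightarrow> mixed E X Y = mixed (E \<inter> C) X Y"
  unfolding mixed_def cross_def by fast

lemma cross_mono: "Y \<subseteq> Z \<Longrightarrow> cross X Y \<subseteq> cross X Z"
  unfolding cross_def by auto

lemma cross_disjoint:
  assumes "X \<inter> Y = {}" "X \<inter> Z = {}" "Y \<inter> Z = {}"
  shows "cross X Y \<inter> cross X Z = {}"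
  using assms unfolding cross_def by (auto simp: doubleton_eq_iff)

lemma finite_cross: "finite X \<Longrightarrow> finite Y \<Longrightarrow> finite (cross X Y)"
  unfolding cross_def by simp

text \<open>For a pair \<open>X = {u, v}\<close> these are the vertices adjacent to exactly one of \<open>u\<close> and \<open>v\<close>.\<close>

definition splitters :: "'a set set \<Rightarrow> 'a set \<Rightarrow> 'a set \<Rightarrow> nat" where
  "splitters E Z X = card {y \<in> Z - X. mixed E X {y}}"

text \<open>The change of the red degree of \<open>X\<close> when the vertices of \<open>Y\<close>, so far singletons, are merged into
one block.\<close>

definition excess :: "'a set set \<Rightarrow> 'a set \<Rightarrow> 'a set \<Rightarrow> real" where
  "excess E X Y = of_bool (mixed E X Y) - real (card {y \<in> Y. mixed E X {y}})"

abbreviation total_excess :: "'a set set \<Rightarrow> 'a set \<Rightarrow> 'a set set \<Rightarrow> real" where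
  "total_excess E X I \<equiv> (\<Sum>Y\<in>I. excess E X Y)"

lemma excess_cross: "cross X Y \<subseteq> C \<Longrightarrow> excess E X Y = excess (E \<inter> C) X Y"
proof -
  assume C: "cross X Y \<subseteq> C"
  have "mixed E X {y} = mixed (E \<inter> C) X {y}" if "y \<in> Y" for y
    using C cross_mono[of "{y}" Y X] that by (intro mixed_cross) auto
  then have "{y \<in> Y. mixed E X {y}} = {y \<in> Y. mixed (E \<inter> C) X {y}}" by auto
  then show ?thesis unfolding excess_def using mixed_cross[OF C, of E] by simp
qed

lemma avg_mixed_pair_vertex:
  assumes "card X = 2" "y \<notin> X" "finite B" "cross X {y} \<subseteq> B"
  shows "avg B (\<lambda>E. h (mixed E X {y})) = (h True + h False) / 2"
proof -
  obtain a b where X: "X = {a, b}" "a \<noteq> b" using assms(1) by (auto simp: card_2_iff)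
  have c: "cross X {y} = {{a, y}, {b, y}}" unfolding X cross_def by auto
  have ne: "{a, y} \<noteq> {b, y}" using assms(2) X by (auto simp: doubleton_eq_iff)
  have "avg B (\<lambda>E. h (mixed E X {y})) = avg (cross X {y}) (\<lambda>E. h (mixed E X {y}))"
    by (rule avg_restrict[OF assms(3,4)]) (simp flip: mixed_cross)
  also have "\<dots> = (h True + h False) / 2"
    unfolding c using ne by (simp add: avg_insert X mixed_def field_simps)
  finally show ?thesis .
qed

text \<open>Of the 16 possible bipartite graphs between two pairs, 4 have excess \<open>-1\<close> (both vertices of \<open>Y\<close> split
\<open>X\<close>) and 2 have excess \<open>1\<close> (\<open>X\<close> is completely joined to exactly one vertex of \<open>Y\<close> and has no edge to
the other).\<close>

lemma avg_excess:
  assumes "card X = 2" "card Y = 2" "X \<inter> Y = {}" "finite B" "cross X Y \<subseteq> B"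
  shows "avg B (\<lambda>E. h (excess E X Y)) = (4 * h (- 1) + 10 * h 0 + 2 * h 1) / 16"
proof -
  obtain a b where X: "X = {a, b}" "a \<noteq> b" using assms(1) by (auto simp: card_2_iff)
  obtain c d where Y: "Y = {c, d}" "c \<noteq> d" using assms(2) by (auto simp: card_2_iff)
  have dist: "a \<noteq> c" "a \<noteq> d" "b \<noteq> c" "b \<noteq> d" using assms(3) X Y by auto
  have c: "cross X Y = {{a, c}, {b, c}, {a, d}, {b, d}}" unfolding X Y cross_def by auto
  have ne: "{a, c} \<noteq> {b, c}" "{a, c} \<noteq> {a, d}" "{a, c} \<noteq> {b, d}" "{b, c} \<noteq> {a, d}"
    "{b, c} \<noteq> {b, d}" "{a, d} \<noteq> {b, d}" using dist X Y by (auto simp: doubleton_eq_iff)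
  define e1 e2 e3 e4 where "e1 = {a, c}" "e2 = {b, c}" "e3 = {a, d}" "e4 = {b, d}"
  note e = this
  have ex: "excess E X Y = of_bool ((e1 \<in> E \<or> e2 \<in> E \<or> e3 \<in> E \<or> e4 \<in> E) \<and>
      (e1 \<notin> E \<or> e2 \<notin> E \<or> e3 \<notin> E \<or> e4 \<notin> E)) -
      (of_bool ((e1 \<in> E) \<noteq> (e2 \<in> E)) + of_bool ((e3 \<in> E) \<noteq> (e4 \<in> E)))" for E
  proof -
    have "{y \<in> Y. mixed E X {y}} =
      (if (e1 \<in> E) \<noteq> (e2 \<in> E) then {c} else {}) \<union> (if (e3 \<in> E) \<noteq> (e4 \<in> E) then {d} else {})"
      unfolding X Y mixed_def e by auto
    then have "real (card {y \<in> Y. mixed E X {y}})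
      = of_bool ((e1 \<in> E) \<noteq> (e2 \<in> E)) + of_bool ((e3 \<in> E) \<noteq> (e4 \<in> E))"
      using Y(2) by simp
    moreover have "mixed E X Y \<longleftrightarrow> (e1 \<in> E \<or> e2 \<in> E \<or> e3 \<in> E \<or> e4 \<in> E) \<and>
      (e1 \<notin> E \<or> e2 \<notin> E \<or> e3 \<notin> E \<or> e4 \<notin> E)"
      unfolding X Y mixed_def e by auto
    ultimately show ?thesis unfolding excess_def by (simp only:)
  qed
  have "avg B (\<lambda>E. h (excess E X Y)) = avg (cross X Y) (\<lambda>E. h (excess E X Y))"
    by (rule avg_restrict[OF assms(4,5)]) (simp flip: excess_cross)
  also have "\<dots> = (4 * h (- 1) + 10 * h 0 + 2 * h 1) / 16"
    unfolding ex c e[symmetric] using ne[folded e] by (simp add: avg_insert field_simps)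
  finally show ?thesis .
qed

lemma pr_not_mixed:
  assumes "finite X" "finite Y" "X \<noteq> {}" "Y \<noteq> {}" "X \<inter> Y = {}" "finite B" "cross X Y \<subseteq> B"
  shows "pr B (\<lambda>E. \<not> mixed E X Y) = 2 / 2 ^ (card X * card Y)"
proof -
  let ?C = "cross X Y"
  have fC: "finite ?C" using assms by (intro finite_cross) auto
  have "inj_on (\<lambda>(x, y). {x, y}) (X \<times> Y)" using assms(5) by (auto simp: inj_on_def doubleton_eq_iff)
  then have cC: "card ?C = card X * card Y"
    unfolding cross_def by (simp add: card_image card_cartesian_product)
  have neC: "?C \<noteq> {}" using assms unfolding cross_def by auto
  have "pr B (\<lambda>E. \<not> mixed E X Y) = pr ?C (\<lambda>E. \<not> mixed E X Y)"
    by (rule avg_restrict[OF assms(6,7)]) (simp flip: mixed_cross)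
  also have "\<dots> = pr ?C (\<lambda>E. E \<in> {{}, ?C})"
  proof (rule avg_cong)
    fix E assume E: "E \<subseteq> ?C"
    have "\<not> mixed E X Y \<longleftrightarrow> ?C \<inter> E = {} \<or> ?C \<subseteq> E" unfolding mixed_def cross_def by auto
    also have "\<dots> \<longleftrightarrow> E \<in> {{}, ?C}" using E by auto
    finally show "of_bool (\<not> mixed E X Y) = (of_bool (E \<in> {{}, ?C}) :: real)" by simp
  qed
  also have "\<dots> = card (Pow ?C \<inter> {{}, ?C}) / 2 ^ card ?C"
    unfolding avg_def using fC by (subst sum_of_bool_eq) (auto simp: Collect_disj_eq insert_commute)
  also have "Pow ?C \<inter> {{}, ?C} = {{}, ?C}" by auto
  finally show ?thesis using neC cC by simp
qed

lemma disjoint_family_cross: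
  assumes "\<And>Y. Y \<in> I \<Longrightarrow> X \<inter> Y = {}" "disjoint I"
  shows "disjoint_family_on (cross X) I"
  unfolding disjoint_family_on_def
proof (intro ballI impI)
  fix Y Z assume "Y \<in> I" "Z \<in> I" "Y \<noteq> Z"
  then show "cross X Y \<inter> cross X Z = {}"
    using assms by (intro cross_disjoint) (auto dest: disjointD)
qed

text \<open>For \<open>c = 2\<close> the base of the power on the right is exactly 1, and for \<open>c = 3/2\<close> it is \<open>47/48\<close>. The first value
makes a sum of excesses exceed \<open>s\<close> with probability at most \<open>2 powr (- s)\<close>, whatever the number of summands;
the second makes a long sum negative.\<close>

lemma avg_powr_excess:
  assumes "card X = 2" "finite I" "disjoint I" "\<And>Y. Y \<in> I \<Longrightarrow> card Y = 2 \<and> X \<inter> Y = {} \<and> cross X Y \<subseteq> B"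
    "finite B" "c > 0"
  shows "avg B (\<lambda>E. c powr total_excess E X I) = ((4 / c + 10 + 2 * c) / 16) ^ card I"
proof -
  have "avg B (\<lambda>E. c powr total_excess E X I) = avg B (\<lambda>E. \<Prod>Y\<in>I. c powr excess E X Y)"
    using assms by (simp add: powr_sum)
  also have "\<dots> = (\<Prod>Y\<in>I. avg B (\<lambda>E. c powr excess E X Y))"
  proof (rule avg_prod[where A = "cross X"])
    show "disjoint_family_on (cross X) I" using assms by (intro disjoint_family_cross) auto
    show "c powr excess E X Y = c powr excess (E \<inter> cross X Y) X Y" for E Y
      by (simp flip: excess_cross)
  qed (use assms in auto)
  also have "\<dots> = (\<Prod>Y\<in>I. (4 / c + 10 + 2 * c) / 16)"
  proof (rule prod.cong)
    fix Y assume "Y \<in> I"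
    then show "avg B (\<lambda>E. c powr excess E X Y) = (4 / c + 10 + 2 * c) / 16"
      using assms(4)[of Y] assms(1,5,6) avg_excess[of X Y B "\<lambda>t. c powr t"]
      by (simp add: powr_minus_divide)
  qed simp
  finally show ?thesis by simp
qed

lemma pr_excess_ge:
  assumes "card X = 2" "finite I" "disjoint I" "\<And>Y. Y \<in> I \<Longrightarrow> card Y = 2 \<and> X \<inter> Y = {} \<and> cross X Y \<subseteq> B"
    "finite B"
  shows "pr B (\<lambda>E. total_excess E X I \<ge> s) \<le> 2 powr (- s)"
proof -
  have "pr B (\<lambda>E. total_excess E X I \<ge> s)
     \<le> avg B (\<lambda>E. 2 powr (- s) * 2 powr total_excess E X I)"
    by (rule pr_le_avg) (auto simp flip: powr_add intro!: ge_one_powr_ge_zero)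
  also have "\<dots> = 2 powr (- s)"
    unfolding avg_cmult by (subst avg_powr_excess[OF assms]) simp_all
  finally show ?thesis .
qed

lemma pr_excess_not_small:
  assumes "card X = 2" "finite I" "disjoint I" "\<And>Y. Y \<in> I \<Longrightarrow> card Y = 2 \<and> X \<inter> Y = {} \<and> cross X Y \<subseteq> B"
    "finite B"
  shows "pr B (\<lambda>E. total_excess E X I \<ge> - (card I / 100)) \<le> exp (- (card I / 100))"
proof -
  let ?n = "real (card I)"
  have "pr B (\<lambda>E. total_excess E X I \<ge> - (?n / 100))
     \<le> avg B (\<lambda>E. (3/2) powr (?n / 100) * (3/2) powr total_excess E X I)"
    by (rule pr_le_avg) (auto simp flip: powr_add intro!: ge_one_powr_ge_zero)
  also have "\<dots> = (3/2) powr (?n / 100) * (47/48) ^ card I"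
    unfolding avg_cmult by (subst avg_powr_excess[OF assms]) simp_all
  also have "\<dots> \<le> exp (?n / 100 * (1/2)) * exp (- (1/48)) ^ card I"
  proof (rule mult_mono)
    have "ln (3/2::real) \<le> 1/2" using ln_le_minus_one[of "3/2::real"] by simp
    then show "(3/2) powr (?n / 100) \<le> exp (?n / 100 * (1/2))"
      unfolding powr_def using mult_left_mono[of "ln (3/2)" "1/2 :: real" "?n / 100"] by simp
    have "47/48 \<le> exp (- (1/48) :: real)" using exp_ge_add_one_self[of "- (1/48) :: real"] by simp
    then show "(47/48) ^ card I \<le> exp (- (1/48) :: real) ^ card I" by (intro power_mono) auto
  qed simp_all
  also have "\<dots> = exp (?n / 100 * (1/2) - ?n / 48)"
    by (simp flip: exp_of_nat_mult exp_add add: mult.commute)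
  also have "\<dots> \<le> exp (- (?n / 100))" by simp
  finally show ?thesis .
qed

text \<open>A pair is completely joined to a given set of four vertices, or without edges to it, with probability
\<open>2 / 2^8\<close>. So the random variable \<open>(1/2)^N\<close>, where \<open>N\<close> counts the pairs of \<open>I\<close> that are not mixed with
\<open>X\<close>, has expectation \<open>(255/256) ^ card I\<close>.\<close>

lemma pr_few_not_mixed:
  assumes "card X = 4" "finite I" "disjoint I" "\<And>Y. Y \<in> I \<Longrightarrow> card Y = 2 \<and> X \<inter> Y = {} \<and> cross X Y \<subseteq> B"
    "finite B"
  shows "pr B (\<lambda>E. real (card {Y \<in> I. \<not> mixed E X Y}) \<le> s) \<le> 2 powr s * (255/256) ^ card I"
proof -
  have fX: "finite X" "X \<noteq> {}" using assms(1) by (auto intro: card_ge_0_finite)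
  have "pr B (\<lambda>E. real (card {Y \<in> I. \<not> mixed E X Y}) \<le> s)
     \<le> avg B (\<lambda>E. 2 powr s * (\<Prod>Y\<in>I. 1 - 1/2 * of_bool (\<not> mixed E X Y)))"
  proof (rule pr_le_avg)
    fix E
    have "(\<Prod>Y\<in>I. 1 - 1/2 * of_bool (\<not> mixed E X Y)) = (\<Prod>Y\<in>{Y \<in> I. \<not> mixed E X Y}. 1/2 :: real)"
      using assms(2) by (intro prod.mono_neutral_cong_right) auto
    also have "\<dots> = 2 powr (- real (card {Y \<in> I. \<not> mixed E X Y}))"
      by (simp add: powr_minus_divide powr_realpow power_one_over)
    finally have *: "(\<Prod>Y\<in>I. 1 - 1/2 * of_bool (\<not> mixed E X Y))
      = 2 powr (- real (card {Y \<in> I. \<not> mixed E X Y}))" .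
    show "0 \<le> 2 powr s * (\<Prod>Y\<in>I. 1 - 1/2 * of_bool (\<not> mixed E X Y))" unfolding * by simp
    assume "real (card {Y \<in> I. \<not> mixed E X Y}) \<le> s"
    then show "1 \<le> 2 powr s * (\<Prod>Y\<in>I. 1 - 1/2 * of_bool (\<not> mixed E X Y))"
      unfolding * by (auto simp flip: powr_add intro!: ge_one_powr_ge_zero)
  qed
  also have "\<dots> = 2 powr s * (\<Prod>Y\<in>I. avg B (\<lambda>E. 1 - 1/2 * of_bool (\<not> mixed E X Y)))"
    unfolding avg_cmult
  proof (subst avg_prod[where A = "cross X"])
    show "disjoint_family_on (cross X) I" using assms by (intro disjoint_family_cross) auto
    show "1 - 1/2 * of_bool (\<not> mixed E X Y) = (1 - 1/2 * of_bool (\<not> mixed (E \<inter> cross X Y) X Y) :: real)"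
      for E Y by (simp flip: mixed_cross)
  qed (use assms in auto)
  also have "(\<Prod>Y\<in>I. avg B (\<lambda>E. 1 - 1/2 * of_bool (\<not> mixed E X Y))) = (\<Prod>Y\<in>I. 255/256)"
  proof (rule prod.cong)
    fix Y assume "Y \<in> I"
    then have Y: "card Y = 2" "X \<inter> Y = {}" "cross X Y \<subseteq> B" using assms(4) by auto
    then have "finite Y" "Y \<noteq> {}" by (auto intro: card_ge_0_finite)
    then show "avg B (\<lambda>E. 1 - 1/2 * of_bool (\<not> mixed E X Y)) = 255/256"
      using fX Y assms(1,5) pr_not_mixed[of X Y B] by (simp only: avg_diff avg_cmult avg_const) simp
  qed simp
  finally show ?thesis by simp
qed

text \<open>The moment generating function of a fair coin is sub-Gaussian.\<close>

lemma cosh_half_le: "(exp (l / 2) + exp (- l / 2)) / 2 \<le> exp (l\<^sup>2 / 8 :: real)"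
proof -
  have *: "(exp (l / 2) + exp (- l / 2)) / 2 \<le> exp (l\<^sup>2 / 8 :: real)" if l: "l \<ge> 0" for l
  proof -
    have pos: "1 + 1/2 * (exp l - 1) > 0" using exp_gt_zero[of l] by (simp add: field_simps add_pos_pos)
    have "- l * (1/2) + ln (1 + 1/2 * (exp l - 1)) \<le> l\<^sup>2 / 8"
      using Hoeffdings_lemma_aux[OF l, of "1/2"] by simp
    then have "exp (- l * (1/2) + ln (1 + 1/2 * (exp l - 1))) \<le> exp (l\<^sup>2 / 8)"
      by (simp only: exp_le_cancel_iff)
    then have "exp (- l / 2) * (1 + 1/2 * (exp l - 1)) \<le> exp (l\<^sup>2 / 8)"
      unfolding exp_add exp_ln[OF pos] by simp
    moreover have "exp (- l / 2) * exp l = exp (l / 2)" by (simp flip: exp_add)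
    ultimately show ?thesis by (simp add: field_simps)
  qed
  show ?thesis using *[of l] *[of "- l"] by (cases "l \<ge> 0") (simp_all add: add.commute)
qed

text \<open>Different vertices split \<open>X\<close> independently, each with probability one half.\<close>

lemma avg_exp_splitters:
  assumes "card X = 2" "finite Z" "cross X (Z - X) \<subseteq> B" "finite B" "real (card (Z - X)) \<le> N"
  shows "avg B (\<lambda>E. exp (l * (real (splitters E Z X) - card (Z - X) / 2))) \<le> exp (l\<^sup>2 * N / 8)"
proof -
  let ?Z = "Z - X"
  have cb: "cross X {y} \<subseteq> B" if "y \<in> ?Z" for y
    using cross_mono[of "{y}" ?Z X] that assms(3) by auto
  have "exp (l * (real (splitters E Z X) - card ?Z / 2))
     = (\<Prod>y\<in>?Z. exp (l * (of_bool (mixed E X {y}) - 1/2)))" for E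
  proof -
    have "real (splitters E Z X) = (\<Sum>y\<in>?Z. of_bool (mixed E X {y}))"
      unfolding splitters_def using assms(2) by (subst sum_of_bool_eq) (auto intro!: arg_cong[where f = card])
    then have "l * (real (splitters E Z X) - card ?Z / 2) = (\<Sum>y\<in>?Z. l * (of_bool (mixed E X {y}) - 1/2))"
      by (simp add: sum_subtractf sum_distrib_left right_diff_distrib)
    then show ?thesis using assms(2) by (simp add: exp_sum)
  qed
  then have "avg B (\<lambda>E. exp (l * (real (splitters E Z X) - card ?Z / 2)))
     = avg B (\<lambda>E. \<Prod>y\<in>?Z. exp (l * (of_bool (mixed E X {y}) - 1/2)))" by simp
  also have "\<dots> = (\<Prod>y\<in>?Z. avg B (\<lambda>E. exp (l * (of_bool (mixed E X {y}) - 1/2))))"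
  proof (rule avg_prod[where A = "\<lambda>y. cross X {y}"])
    show "disjoint_family_on (\<lambda>y. cross X {y}) ?Z"
      unfolding disjoint_family_on_def by (intro ballI impI cross_disjoint) auto
  qed (use assms cb in \<open>simp_all flip: mixed_cross\<close>)
  also have "\<dots> = (\<Prod>y\<in>?Z. (exp (l / 2) + exp (- l / 2)) / 2)"
    using assms cb
    by (intro prod.cong refl, subst avg_mixed_pair_vertex[where h = "\<lambda>b. exp (l * (of_bool b - 1/2))"]) auto
  also have "\<dots> \<le> exp (l\<^sup>2 / 8) ^ card ?Z"
    using cosh_half_le[of l] by (simp add: power_mono)
  also have "\<dots> = exp (card ?Z * (l\<^sup>2 / 8))" by (simp flip: exp_of_nat_mult)
  also have "\<dots> \<le> exp (l\<^sup>2 * N / 8)"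
    using mult_right_mono[OF assms(5), of "l\<^sup>2 / 8"] by (simp add: mult.commute)
  finally show ?thesis .
qed

lemma pr_splitters_deviation:
  assumes "card X = 2" "finite Z" "cross X (Z - X) \<subseteq> B" "finite B" "real (card (Z - X)) \<le> N"
    "N > 0" and s: "s \<ge> 0" and c: "c\<^sup>2 = 1"
  shows "pr B (\<lambda>E. s \<le> c * (real (splitters E Z X) - card (Z - X) / 2)) \<le> exp (- (2 * s\<^sup>2 / N))"
proof -
  \<comment> \<open>the value minimising \<open>l\<^sup>2 * N / 8 - l * s\<close>\<close>
  define l where "l = 4 * s / N"
  have l: "l \<ge> 0" using assms s by (simp add: l_def)
  let ?D = "\<lambda>E. real (splitters E Z X) - card (Z - X) / 2"
  have "pr B (\<lambda>E. s \<le> c * ?D E) \<le> avg B (\<lambda>E. exp (- l * s) * exp (l * c * ?D E))"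
  proof (rule pr_le_avg)
    fix E assume "s \<le> c * ?D E"
    then have "0 \<le> l * (c * ?D E - s)" using l by simp
    then show "1 \<le> exp (- l * s) * exp (l * c * ?D E)" by (simp flip: exp_add add: algebra_simps)
  qed simp
  also have "\<dots> \<le> exp (- l * s) * exp ((l * c)\<^sup>2 * N / 8)"
    unfolding avg_cmult using avg_exp_splitters[OF assms(1-5), of "l * c"] by simp
  also have "\<dots> = exp (- (2 * s\<^sup>2 / N))"
    unfolding l_def power_mult_distrib c using assms(6)
    by (simp flip: exp_add) (simp add: field_simps power2_eq_square)
  finally show ?thesis .
qed

section \<open>Disjoint pairs with few splitters\<close>

text \<open>The probability that a binomial variable with \<open>w\<close> fair trials is at most \<open>t\<close>.\<close>

definition tail_prob :: "nat \<Rightarrow> nat \<Rightarrow> real" where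
  "tail_prob w t = (\<Sum>i\<le>t. real (w choose i)) / 2 ^ w"

lemma card_small_subsets:
  assumes "finite W"
  shows "card {Z. Z \<subseteq> W \<and> card Z \<le> t} = (\<Sum>i\<le>t. card W choose i)"
proof -
  have "{Z. Z \<subseteq> W \<and> card Z \<le> t} = (\<Union>i\<le>t. {Z. Z \<subseteq> W \<and> card Z = i})" by auto
  also have "card \<dots> = (\<Sum>i\<le>t. card {Z. Z \<subseteq> W \<and> card Z = i})"
    using assms by (intro card_UN_disjoint) auto
  finally show ?thesis by (simp add: n_subsets[OF assms])
qed

text \<open>Comparison with a fixed set \<open>S\<close> maps a uniformly random neighbourhood of \<open>u\<close> in \<open>W\<close> bijectively to a
uniformly random subset of \<open>W\<close>.\<close>

lemma pr_row:
  assumes "finite W" "u \<notin> W"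
  shows "pr (cross {u} W) (\<lambda>E. card {y \<in> W. ({u, y} \<in> E) \<noteq> (y \<in> S)} \<le> t) = tail_prob (card W) t"
proof -
  let ?R = "cross {u} W" and ?g = "\<lambda>E. {y \<in> W. ({u, y} \<in> E) \<noteq> (y \<in> S)}"
  have R: "?R = (\<lambda>y. {u, y}) ` W" unfolding cross_def by auto
  have inj: "inj_on (\<lambda>y. {u, y}) W" by (auto simp: inj_on_def doubleton_eq_iff)
  have cR: "card ?R = card W" unfolding R using inj by (rule card_image)
  have "(\<Sum>E\<in>Pow ?R. of_bool (card (?g E) \<le> t)) = (\<Sum>Z\<in>Pow W. of_bool (card Z \<le> t) :: real)"
  proof (rule sum.reindex_bij_witness[where j = ?g
        and i = "\<lambda>Z. (\<lambda>y. {u, y}) ` {y \<in> W. (y \<in> Z) \<noteq> (y \<in> S)}"])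
    fix E assume "E \<in> Pow ?R"
    then show "(\<lambda>y. {u, y}) ` {y \<in> W. (y \<in> ?g E) \<noteq> (y \<in> S)} = E"
      unfolding R by (auto simp: image_iff)
  next
    fix Z assume "Z \<in> Pow W"
    moreover have "{u, y} \<in> (\<lambda>y. {u, y}) ` {y \<in> W. (y \<in> Z) \<noteq> (y \<in> S)} \<longleftrightarrow> (y \<in> Z) \<noteq> (y \<in> S)"
      if "y \<in> W" for y
      using that by (auto simp: image_iff doubleton_eq_iff)
    ultimately show "?g ((\<lambda>y. {u, y}) ` {y \<in> W. (y \<in> Z) \<noteq> (y \<in> S)}) = Z" by auto
  qed (auto simp: R)
  also have "\<dots> = card {Z. Z \<subseteq> W \<and> card Z \<le> t}"
    using assms(1) by (subst sum_of_bool_eq) (auto simp: Pow_def Int_def)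
  finally show ?thesis
    unfolding avg_def cR tail_prob_def card_small_subsets[OF assms(1)] by simp
qed

lemma splitters_pair:
  assumes "u \<notin> W" "v \<notin> W"
  shows "splitters E W {u, v} = card {y \<in> W. ({u, y} \<in> E) \<noteq> ({v, y} \<in> E)}"
  unfolding splitters_def mixed_def using assms by (intro arg_cong[where f = card]) auto

text \<open>Given all other edges, the randomness of the row of \<open>u\<close> alone makes the event for \<open>{u, v}\<close> have
its probability, so this event is independent of everything that does not involve the row of \<open>u\<close>.\<close>

lemma avg_row:
  assumes "finite B" "finite W" "u \<notin> W" "v \<notin> W" "u \<noteq> v" "cross {u} W \<subseteq> B"
    "\<And>E. h E = h (E - cross {u} W)"
  shows "avg B (\<lambda>E. of_bool (splitters E W {u, v} \<le> t) * h E) = tail_prob (card W) t * avg B h"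
proof -
  let ?R = "cross {u} W"
  have fin: "finite ?R" "finite (B - ?R)" using assms by (auto intro: finite_cross)
  have B: "B = (B - ?R) \<union> ?R" using assms by auto
  have "avg B (\<lambda>E. of_bool (splitters E W {u, v} \<le> t) * h E)
     = avg (B - ?R) (\<lambda>E. avg ?R (\<lambda>E'. of_bool (splitters (E \<union> E') W {u, v} \<le> t) * h (E \<union> E')))"
    by (subst B, subst avg_Un) (use fin in auto)
  also have "\<dots> = avg (B - ?R) (\<lambda>E. tail_prob (card W) t * h E)"
  proof (rule avg_cong)
    fix E assume E: "E \<subseteq> B - ?R"
    have "avg ?R (\<lambda>E'. of_bool (splitters (E \<union> E') W {u, v} \<le> t) * h (E \<union> E'))
      = avg ?R (\<lambda>E'. of_bool (card {y \<in> W. ({u, y} \<in> E') \<noteq> (y \<in> {y. {v, y} \<in> E})} \<le> t) * h E)"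
    proof (rule avg_cong)
      fix E' assume E': "E' \<subseteq> ?R"
      have "E \<union> E' - ?R = E" using E E' by auto
      then have "h (E \<union> E') = h E" using assms(7) by metis
      moreover have "{u, y} \<in> E \<union> E' \<longleftrightarrow> {u, y} \<in> E'" "{v, y} \<in> E \<union> E' \<longleftrightarrow> {v, y} \<in> E"
        if "y \<in> W" for y
      proof -
        have "{u, y} \<in> ?R" "{v, y} \<notin> ?R"
          using that assms(3-5) unfolding cross_def by (auto simp: doubleton_eq_iff)
        then show "{u, y} \<in> E \<union> E' \<longleftrightarrow> {u, y} \<in> E'" "{v, y} \<in> E \<union> E' \<longleftrightarrow> {v, y} \<in> E"
          using E E' by auto
      qed
      then have "{y \<in> W. ({u, y} \<in> E \<union> E') \<noteq> ({v, y} \<in> E \<union> E')}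
        = {y \<in> W. ({u, y} \<in> E') \<noteq> (y \<in> {y. {v, y} \<in> E})}" by auto
      ultimately show "of_bool (splitters (E \<union> E') W {u, v} \<le> t) * h (E \<union> E') =
         of_bool (card {y \<in> W. ({u, y} \<in> E') \<noteq> (y \<in> {y. {v, y} \<in> E})} \<le> t) * h E"
        unfolding splitters_pair[OF assms(3,4)] by simp
    qed
    also have "\<dots> = tail_prob (card W) t * h E"
      unfolding avg_multc pr_row[OF assms(2,3)] ..
    finally show "avg ?R (\<lambda>E'. of_bool (splitters (E \<union> E') W {u, v} \<le> t) * h (E \<union> E'))
      = tail_prob (card W) t * h E" .
  qed
  also have "\<dots> = tail_prob (card W) t * avg (B - ?R) h" by (rule avg_cmult)
  also have "avg (B - ?R) h = avg B h"
  proof (rule avg_restrict[symmetric])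
    fix E assume "E \<subseteq> B"
    then have "E \<inter> (B - ?R) = E - ?R" by auto
    then show "h E = h (E \<inter> (B - ?R))" using assms(7) by metis
  qed (use assms in auto)
  finally show ?thesis .
qed

lemma pr_few_splitters:
  assumes "finite B" "finite W" "X \<in> pairs U" "U \<inter> W = {}" "cross U W \<subseteq> B"
  shows "pr B (\<lambda>E. splitters E W X \<le> t) = tail_prob (card W) t"
proof -
  obtain u v where X: "X = {u, v}" "u \<noteq> v" "u \<in> U" "v \<in> U"
    using assms(3) by (auto simp: pairs_def card_2_iff)
  have "cross {u} W \<subseteq> B" using assms(5) X(3) unfolding cross_def by auto
  then show ?thesis using avg_row[OF assms(1,2), of u v "\<lambda>_. 1" t] assms(1,4) X by auto
qed

text \<open>Two distinct pairs, even if they share a vertex, are independent: one of them contains a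
vertex that is not in the other, and lemma \<open>avg_row\<close> applies to the row of that vertex.\<close>

lemma avg_few_splitters_independent:
  assumes "finite B" "finite W" "X \<in> pairs U" "X' \<in> pairs U" "X \<noteq> X'" "U \<inter> W = {}" "cross U W \<subseteq> B"
  shows "avg B (\<lambda>E. of_bool (splitters E W X \<le> t) * of_bool (splitters E W X' \<le> t))
    = (tail_prob (card W) t)\<^sup>2"
proof -
  have cX: "card X = 2" "X \<subseteq> U" and cX': "card X' = 2" "X' \<subseteq> U" using assms by (auto simp: pairs_def)
  have "finite X'" using cX'(1) by (auto intro: card_ge_0_finite)
  then have "\<not> X \<subseteq> X'" using card_subset_eq[of X' X] cX cX' assms(5) by auto
  then obtain u where u: "u \<in> X" "u \<notin> X'" by auto
  then obtain v where X: "X = {u, v}" "u \<noteq> v" using cX(1) by (auto simp: card_2_iff)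
  have sub: "cross {u} W \<subseteq> B" using assms(7) X cX(2) unfolding cross_def by auto
  have "splitters E W X' = splitters (E - cross {u} W) W X'" for E
  proof -
    have "{x, y} \<notin> cross {u} W" if "x \<in> X'" "y \<in> W" for x y
      using that u cX' assms(6) unfolding cross_def by (auto simp: doubleton_eq_iff)
    then show ?thesis unfolding splitters_def mixed_def
      by (intro arg_cong[where f = card]) auto
  qed
  then have "avg B (\<lambda>E. of_bool (splitters E W {u, v} \<le> t) * of_bool (splitters E W X' \<le> t))
    = tail_prob (card W) t * pr B (\<lambda>E. splitters E W X' \<le> t)"
    using assms X cX sub by (intro avg_row) auto
  then show ?thesis
    using pr_few_splitters[OF assms(1,2,4,6,7)] X by (simp add: power2_eq_square)
qed

text \<open>Discarding every pair that meets another one costs at most one pair for each ordered couple of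
intersecting pairs.\<close>

lemma exists_matching_of_few_cherries:
  assumes "finite G"
  shows "\<exists>M\<subseteq>G. disjoint M \<and> card G \<le> card M + card {(X, Y). X \<in> G \<and> Y \<in> G \<and> X \<noteq> Y \<and> X \<inter> Y \<noteq> {}}"
proof (intro exI conjI)
  let ?M = "{X \<in> G. \<forall>Y\<in>G. X \<noteq> Y \<longrightarrow> X \<inter> Y = {}}"
  let ?C = "{(X, Y). X \<in> G \<and> Y \<in> G \<and> X \<noteq> Y \<and> X \<inter> Y \<noteq> {}}"
  show "?M \<subseteq> G" by auto
  show "disjoint ?M" by (auto simp: disjoint_def)
  have fC: "finite ?C" by (rule finite_subset[of _ "G \<times> G"]) (use assms in auto)
  have "G - ?M \<subseteq> fst ` ?C" by force
  then have "card (G - ?M) \<le> card (fst ` ?C)" using fC by (intro card_mono) auto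
  also have "\<dots> \<le> card ?C" using fC by (rule card_image_le)
  finally have "card (G - ?M) \<le> card ?C" .
  moreover have "card (G - ?M) = card G - card ?M" using assms by (intro card_Diff_subset) auto
  ultimately show "card G \<le> card ?M + card ?C" by simp
qed

lemma card_pairs: "finite U \<Longrightarrow> card (pairs U) = card U choose 2"
  unfolding pairs_def by (simp add: n_subsets)

lemma finite_pairs: "finite U \<Longrightarrow> finite (pairs U)"
  unfolding pairs_def by simp

lemma card_cherries:
  assumes "finite U"
  shows "card {(X, Y). X \<in> pairs U \<and> Y \<in> pairs U \<and> X \<noteq> Y \<and> X \<inter> Y \<noteq> {}} \<le> card U ^ 3"
proof -
  have "{(X, Y). X \<in> pairs U \<and> Y \<in> pairs U \<and> X \<noteq> Y \<and> X \<inter> Y \<noteq> {}}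
     \<subseteq> (\<lambda>(a, b, c). ({a, b}, {a, c})) ` (U \<times> U \<times> U)"
  proof clarify
    fix X Y assume XY: "X \<in> pairs U" "Y \<in> pairs U" "X \<inter> Y \<noteq> {}"
    then obtain a where a: "a \<in> X" "a \<in> Y" by auto
    obtain b where b: "X = {a, b}" using XY(1) a(1) by (auto simp: pairs_def card_2_iff)
    obtain c where c: "Y = {a, c}" using XY(2) a(2) by (auto simp: pairs_def card_2_iff)
    have "(a, b, c) \<in> U \<times> U \<times> U" using XY b c by (auto simp: pairs_def)
    then show "(X, Y) \<in> (\<lambda>(a, b, c). ({a, b}, {a, c})) ` (U \<times> U \<times> U)"
      using b c by (intro image_eqI[of _ _ "(a, b, c)"]) auto
  qed
  then have "card {(X, Y). X \<in> pairs U \<and> Y \<in> pairs U \<and> X \<noteq> Y \<and> X \<inter> Y \<noteq> {}}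
     \<le> card (U \<times> U \<times> U)"
    using assms by (meson card_image_le card_mono finite_SigmaI finite_imageI le_trans)
  then show ?thesis by (simp add: card_cartesian_product power3_eq_cube algebra_simps)
qed

abbreviation similar_matching_exists ::
    "'a set \<Rightarrow> 'a set \<Rightarrow> nat \<Rightarrow> nat \<Rightarrow> 'a set set \<Rightarrow> bool" where
  "similar_matching_exists U W k t E \<equiv>
    \<exists>M. M \<subseteq> pairs U \<and> disjoint M \<and> card M = k \<and> (\<forall>X\<in>M. splitters E W X \<le> t)"

text \<open>By pairwise independence the number of pairs with few splitters has variance at most its mean \<open>N q\<close>, so
it is at least \<open>N q / 2\<close> with high probability (Chebyshev). The expected number of intersecting couples among
them is at most \<open>(card U)^3 q^2\<close>, which is much smaller than \<open>N q\<close> when \<open>card U * q\<close> is small (Markov).\<close>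

lemma pr_no_matching:
  assumes "finite B" "finite U" "finite W" "U \<inter> W = {}" "cross U W \<subseteq> B"
    and q: "q = tail_prob (card W) t" "q > 0"
    and N: "N = real (card U choose 2)" "N > 0"
    and k: "k \<le> N * q / 4"
  shows "pr B (\<lambda>E. \<not> similar_matching_exists U W k t E)
     \<le> 4 / (N * q) + 4 * real (card U) ^ 3 * q / N"
proof -
  define f where "f = (\<lambda>X E. of_bool (splitters E W X \<le> t) :: real)"
  define C where "C = {(X, Y). X \<in> pairs U \<and> Y \<in> pairs U \<and> X \<noteq> Y \<and> X \<inter> Y \<noteq> {}}"
  have fp: "finite (pairs U)" using assms by (simp add: finite_pairs)
  have fC: "finite C" by (rule finite_subset[of _ "pairs U \<times> pairs U"]) (use fp in \<open>auto simp: C_def\<close>)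
  have cp: "real (card (pairs U)) = N" using assms(2) N by (simp add: card_pairs)
  have f1: "avg B (f X) = q" if "X \<in> pairs U" for X
    unfolding f_def q by (rule pr_few_splitters) (use assms that in auto)
  have f2: "avg B (\<lambda>E. f X E * f Y E) = (if X = Y then q else q\<^sup>2)"
    if "X \<in> pairs U" "Y \<in> pairs U" for X Y
  proof (cases "X = Y")
    case True
    then have "(\<lambda>E. f X E * f Y E) = f X" unfolding f_def by auto
    then show ?thesis using f1 that True by simp
  next
    case False
    then show ?thesis unfolding f_def q using assms that
      by (subst avg_few_splitters_independent) auto
  qed
  define S where "S = (\<lambda>E. \<Sum>X\<in>pairs U. f X E)"
  define D where "D = (\<lambda>E. \<Sum>(X, Y)\<in>C. f X E * f Y E)"
  have aS: "avg B S = N * q" unfolding S_def avg_sum using f1 cp by simp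
  have "avg B (\<lambda>E. (S E)\<^sup>2) = (\<Sum>X\<in>pairs U. \<Sum>Y\<in>pairs U. if X = Y then q else q\<^sup>2)"
    unfolding S_def power2_eq_square sum_product avg_sum
    using f2 by (intro sum.cong refl) (simp add: power2_eq_square)
  also have "\<dots> \<le> (\<Sum>X\<in>pairs U. \<Sum>Y\<in>pairs U. (if X = Y then q else 0) + q\<^sup>2)"
    using q by (intro sum_mono) auto
  also have "\<dots> = N * q + N\<^sup>2 * q\<^sup>2"
    using fp cp by (simp add: sum.distrib power2_eq_square algebra_simps)
  finally have aS2: "avg B (\<lambda>E. (S E)\<^sup>2) \<le> N * q + N\<^sup>2 * q\<^sup>2" .
  have "avg B (\<lambda>E. (S E - N * q)\<^sup>2) = avg B (\<lambda>E. ((S E)\<^sup>2 - (2 * N * q) * S E) + (N * q)\<^sup>2)"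
    by (intro avg_cong) (simp add: power2_eq_square algebra_simps)
  also have "\<dots> \<le> N * q"
    using aS2 aS assms(1) by (simp only: avg_add avg_diff avg_cmult avg_const) (simp add: power2_eq_square algebra_simps)
  finally have var: "avg B (\<lambda>E. (S E - N * q)\<^sup>2) \<le> N * q" .
  have "pr B (\<lambda>E. S E < N * q / 2) \<le> avg B (\<lambda>E. (4 / (N * q)\<^sup>2) * (S E - N * q)\<^sup>2)"
  proof (rule pr_le_avg)
    fix E assume "S E < N * q / 2"
    then have "N * q / 2 \<le> N * q - S E" by simp
    moreover have "0 \<le> N * q / 2" using q(2) N(2) by simp
    ultimately have "(N * q / 2)\<^sup>2 \<le> (N * q - S E)\<^sup>2" by (rule power_mono)
    then have "(N * q)\<^sup>2 \<le> 4 * (S E - N * q)\<^sup>2" by (simp add: power2_commute power_divide)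
    then show "1 \<le> 4 / (N * q)\<^sup>2 * (S E - N * q)\<^sup>2" using q N by (simp add: field_simps)
  qed simp
  also have "\<dots> \<le> (4 / (N * q)\<^sup>2) * (N * q)"
    unfolding avg_cmult using var by (intro mult_left_mono) auto
  also have "\<dots> = 4 / (N * q)" using q N by (simp add: power2_eq_square)
  finally have 1: "pr B (\<lambda>E. S E < N * q / 2) \<le> 4 / (N * q)" .
  have "avg B D = (\<Sum>(X, Y)\<in>C. q\<^sup>2)"
    unfolding D_def case_prod_beta avg_sum
  proof (rule sum.cong[OF refl])
    fix z assume "z \<in> C"
    then have "fst z \<in> pairs U" "snd z \<in> pairs U" "fst z \<noteq> snd z" unfolding C_def by auto
    then show "avg B (\<lambda>E. f (fst z) E * f (snd z) E) = q\<^sup>2" using f2 by simp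
  qed
  also have "\<dots> = card C * q\<^sup>2" by (simp add: case_prod_beta)
  also have "\<dots> \<le> real (card U) ^ 3 * q\<^sup>2"
    using card_cherries[OF assms(2)] unfolding C_def
    by (intro mult_right_mono) (simp_all flip: of_nat_power)
  finally have aD: "avg B D \<le> real (card U) ^ 3 * q\<^sup>2" .
  have "pr B (\<lambda>E. D E \<ge> N * q / 4) \<le> avg B (\<lambda>E. 4 / (N * q) * D E)"
  proof (rule pr_le_avg)
    fix E show "0 \<le> 4 / (N * q) * D E"
      unfolding D_def f_def using q N by (intro mult_nonneg_nonneg sum_nonneg) auto
    assume "D E \<ge> N * q / 4"
    then show "1 \<le> 4 / (N * q) * D E" using q N by (simp add: field_simps)
  qed
  also have "\<dots> \<le> 4 / (N * q) * (real (card U) ^ 3 * q\<^sup>2)"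
    unfolding avg_cmult using aD q N by (intro mult_left_mono) auto
  also have "\<dots> = 4 * real (card U) ^ 3 * q / N" using q N by (simp add: power2_eq_square)
  finally have 2: "pr B (\<lambda>E. D E \<ge> N * q / 4) \<le> 4 * real (card U) ^ 3 * q / N" .
  have "pr B (\<lambda>E. \<not> similar_matching_exists U W k t E)
    \<le> pr B (\<lambda>E. S E < N * q / 2 \<or> D E \<ge> N * q / 4)"
  proof (rule pr_mono, rule ccontr)
    fix E assume no: "\<not> similar_matching_exists U W k t E"
      and "\<not> (S E < N * q / 2 \<or> D E \<ge> N * q / 4)"
    then have SD: "S E \<ge> N * q / 2" "D E < N * q / 4" by auto
    let ?G = "{X \<in> pairs U. splitters E W X \<le> t}"
    let ?C = "{(X, Y). X \<in> ?G \<and> Y \<in> ?G \<and> X \<noteq> Y \<and> X \<inter> Y \<noteq> {}}"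
    have S: "S E = card ?G" unfolding S_def f_def using fp
      by (subst sum_of_bool_eq) (auto simp: Int_def)
    have "D E = (\<Sum>z\<in>C. of_bool (splitters E W (fst z) \<le> t \<and> splitters E W (snd z) \<le> t))"
      unfolding D_def f_def by (intro sum.cong refl) auto
    also have "\<dots> = card (C \<inter> {z. splitters E W (fst z) \<le> t \<and> splitters E W (snd z) \<le> t})"
      using fC by (subst sum_of_bool_eq) auto
    also have "C \<inter> {z. splitters E W (fst z) \<le> t \<and> splitters E W (snd z) \<le> t} = ?C"
      unfolding C_def by auto
    finally have D: "D E = card ?C" .
    obtain M where M: "M \<subseteq> ?G" "disjoint M" "card ?G \<le> card M + card ?C"
      using exists_matching_of_few_cherries[of ?G] fp by auto
    have "real (card ?G) \<le> real (card M) + real (card ?C)" using M(3) by linarith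
    then have "k \<le> card M" using SD S D k by linarith
    then obtain M' where M': "M' \<subseteq> M" "card M' = k"
      by (meson obtain_subset_with_card_n)
    have "disjoint M'" using M(2) M'(1) by (meson disjoint_def subsetD)
    then show False using no M M' by blast
  qed
  also have "\<dots> \<le> 4 / (N * q) + 4 * real (card U) ^ 3 * q / N"
    using pr_disj[of B "\<lambda>E. S E < N * q / 2" "\<lambda>E. D E \<ge> N * q / 4"] 1 2 by linarith
  finally show ?thesis .
qed

text \<open>The right order of magnitude is needed here: a bound weaker by a power of \<open>m\<close> would change the exponent
in the count of pairs with few splitters.\<close>

lemma central_binomial_lower: "m \<ge> 1 \<Longrightarrow> 4 ^ m / (2 * sqrt m) \<le> real (2 * m choose m)"
proof (induction m rule: nat_induct_at_least)
  case base
  then show ?case by simp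
next
  case (Suc m)
  have eq: "real (2 * m + 2 choose (m + 1)) = 2 * (2 * m + 1) / (m + 1) * real (2 * m choose m)"
  proof -
    have "real (2 * m choose m) = fact (2 * m) / (fact m * fact m)"
      by (simp add: binomial_fact)
    moreover have "real (2 * m + 2 choose (m + 1)) = fact (2 * m + 2) / (fact (m + 1) * fact (m + 1))"
      by (subst binomial_fact) (simp_all del: binomial_Suc_Suc fact_Suc)
    moreover have "fact (2 * m + 2) = (2 * real m + 2) * (2 * real m + 1) * fact (2 * m)"
      "fact (m + 1) = (real m + 1) * fact m"
      by (simp_all add: algebra_simps)
    moreover have "(2 * real m + 2) * (2 * real m + 1) * F / (((real m + 1) * G) * ((real m + 1) * G))
      = 2 * (2 * real m + 1) / (real m + 1) * (F / (G * G))" if "G > 0" for F G :: real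
      using that by (simp add: divide_simps) (simp add: algebra_simps)
    ultimately show ?thesis by (simp only: of_nat_add of_nat_mult of_nat_numeral of_nat_1 fact_gt_zero mult.assoc)
  qed
  have "2 * sqrt m * sqrt (m + 1) \<le> 2 * m + 1"
  proof -
    have "sqrt (real m) * sqrt (real m + 1) = sqrt (real m * (real m + 1))" by (simp add: real_sqrt_mult)
    also have "\<dots> \<le> sqrt ((real m + 1/2)\<^sup>2)" by (intro real_sqrt_le_mono) (simp add: power2_eq_square algebra_simps)
    finally show ?thesis by (simp add: add.commute)
  qed
  then have "2 * sqrt m * sqrt (m + 1) * sqrt (m + 1) \<le> (2 * m + 1) * sqrt (m + 1)"
    by (intro mult_right_mono) auto
  then have "2 * sqrt m * (m + 1) \<le> (2 * m + 1) * sqrt (m + 1)"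
    by (simp add: mult.assoc)
  then have "2 / sqrt (m + 1) \<le> (2 * m + 1) / ((m + 1) * sqrt m)"
    using Suc by (simp add: pos_divide_le_eq pos_le_divide_eq mult_ac)
  then have "4 ^ m * (2 / sqrt (m + 1)) \<le> 4 ^ m * ((2 * m + 1) / ((m + 1) * sqrt m))"
    by (rule mult_left_mono) simp
  moreover have "4 ^ m * (2 / x) = 4 ^ Suc m / (2 * x)" for x :: real by simp
  moreover have "4 ^ m * (a / (b * x)) = 2 * a / b * (4 ^ m / (2 * x))" for a b x :: real by simp
  ultimately have "4 ^ Suc m / (2 * sqrt (Suc m)) \<le> 2 * (2 * m + 1) / (m + 1) * (4 ^ m / (2 * sqrt m))"
    by (simp only: Suc_eq_plus1)
  also have "\<dots> \<le> 2 * (2 * m + 1) / (m + 1) * real (2 * m choose m)"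
    using Suc.IH by (intro mult_left_mono) auto
  finally show ?case using eq by (simp add: add.commute)
qed

text \<open>The quotient of the two binomial coefficients is the product of the factors \<open>(r - j + i) / (r + i)\<close> for
\<open>1 \<le> i \<le> j\<close>, and each of them is at least \<open>1 - j / r\<close>.\<close>

lemma binomial_off_centre:
  assumes "j \<le> r" "r \<ge> 1"
  shows "real (2 * r choose r) * (1 - j / r) ^ j \<le> real (2 * r choose (r - j))"
proof -
  have le: "fact (r - j) * ((1 - j / r) ^ i * fact (r + i)) \<le> (fact r * fact (r - j + i) :: real)" for i
  proof (induction i)
    case (Suc i)
    have "(1 - j / r) * real (r + Suc i) = real (r - j + Suc i) - real (j * Suc i) / r"
      using assms by (simp add: field_simps of_nat_diff)
    also have "\<dots> \<le> real (r - j + Suc i)" by simp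
    finally have st: "(1 - j / r) * real (r + Suc i) \<le> real (r - j + Suc i)" .
    have "(fact (r - j) * ((1 - j / r) ^ i * fact (r + i))) * ((1 - j / r) * real (r + Suc i))
      \<le> (fact r * fact (r - j + i)) * real (r - j + Suc i)"
    proof (rule mult_mono[OF Suc st])
      have "real j / r \<le> 1" using assms by simp
      then show "0 \<le> (1 - j / r) * real (r + Suc i)" by (intro mult_nonneg_nonneg) auto
    qed simp
    then show ?case by (simp add: mult_ac)
  qed simp
  have b1: "real (2 * r choose r) = fact (2 * r) / (fact r * fact r)"
    by (simp add: binomial_fact)
  have b2: "real (2 * r choose (r - j)) = fact (2 * r) / (fact (r - j) * fact (r + j))"
    using assms by (subst binomial_fact) (auto simp: mult_2)
  have "(1 - j / r) ^ j / (fact r * fact r) \<le> 1 / (fact (r - j) * fact (r + j) :: real)"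
    using le[of j] assms by (simp add: field_simps)
  then have "fact (2 * r) * ((1 - j / r) ^ j / (fact r * fact r)) \<le> fact (2 * r) * (1 / (fact (r - j) * fact (r + j) :: real))"
    by (rule mult_left_mono) simp
  then show ?thesis unfolding b1 b2 by simp
qed

text \<open>A single summand is about \<open>1 / sqrt r\<close> times too small, hence \<open>h + 1\<close> of them are used.\<close>

lemma tail_prob_lower:
  assumes "T + h \<le> r" "r \<ge> 1"
  shows "(real h + 1) / (2 * sqrt r) * (1 - real (T + h) / r) ^ (T + h) \<le> tail_prob (2 * r) (r - T)"
proof -
  let ?J = "T + h"
  have "(\<Sum>j\<in>{T..?J}. 4 ^ r / (2 * sqrt r) * (1 - real ?J / r) ^ ?J) \<le> (\<Sum>j\<in>{T..?J}. real (2 * r choose (r - j)))"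
  proof (rule sum_mono)
    fix j assume j: "j \<in> {T..?J}"
    have "(1 - real ?J / r) ^ ?J \<le> (1 - real ?J / r) ^ j"
      using j assms by (intro power_decreasing) (auto simp: field_simps)
    also have "\<dots> \<le> (1 - real j / r) ^ j"
    proof (rule power_mono)
      have "real j / r \<le> real ?J / r" using j by (intro divide_right_mono) auto
      then show "1 - real ?J / r \<le> 1 - real j / r" by simp
    qed (use assms in \<open>auto simp: field_simps\<close>)
    finally have "4 ^ r / (2 * sqrt r) * (1 - real ?J / r) ^ ?J \<le> real (2 * r choose r) * (1 - real j / r) ^ j"
      using central_binomial_lower[OF assms(2)] assms by (intro mult_mono) (auto simp: field_simps)
    also have "\<dots> \<le> real (2 * r choose (r - j))"
      using j assms by (intro binomial_off_centre) auto
    finally show "4 ^ r / (2 * sqrt r) * (1 - real ?J / r) ^ ?J \<le> real (2 * r choose (r - j))" .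
  qed
  also have "\<dots> = (\<Sum>i\<in>(\<lambda>j. r - j) ` {T..?J}. real (2 * r choose i))"
    using assms by (subst sum.reindex) (auto simp: inj_on_def)
  also have "\<dots> \<le> (\<Sum>i\<le>r - T. real (2 * r choose i))"
    by (intro sum_mono2) auto
  finally have "(real h + 1) * (4 ^ r / (2 * sqrt r) * (1 - real ?J / r) ^ ?J) \<le> (\<Sum>i\<le>r - T. real (2 * r choose i))"
    using assms by (simp add: mult_ac add.commute)
  then have "(real h + 1) * (4 ^ r / (2 * sqrt r) * (1 - real ?J / r) ^ ?J) / 4 ^ r
      \<le> (\<Sum>i\<le>r - T. real (2 * r choose i)) / 4 ^ r"
    by (rule divide_right_mono) simp
  also have "\<dots> = tail_prob (2 * r) (r - T)"
    unfolding tail_prob_def by (simp add: power_mult)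
  finally have "(real h + 1) * (4 ^ r / (2 * sqrt r) * (1 - real ?J / r) ^ ?J) / 4 ^ r \<le> tail_prob (2 * r) (r - T)" .
  moreover have "(real h + 1) * (4 ^ r / (2 * sqrt r) * x) / 4 ^ r = (real h + 1) / (2 * sqrt r) * x" for x
    by simp
  ultimately show ?thesis by (simp only:)
qed

section \<open>The lower bound for given parameters\<close>

text \<open>A block of size \<open>b\<close> lowers the number of blocks by \<open>b - 1\<close>, which is at least \<open>b / 2\<close> unless \<open>b = 1\<close>.\<close>

lemma singletons_of_partition:
  assumes "finite V" "partition_on V Q" "card Q + k = card V"
  shows "card {y \<in> V. {y} \<notin> Q} \<le> 2 * k"
    and "(\<And>X. X \<in> Q \<Longrightarrow> card X \<le> 2) \<Longrightarrow> card {X \<in> Q. card X = 2} = k"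
proof -
  have fQ: "finite Q" using finite_elements[OF assms(1,2)] .
  have ne: "{} \<notin> Q" and un: "\<Union>Q = V" and dis: "disjoint Q"
    using assms(2) by (auto simp: partition_on_def)
  have fX: "finite X" "card X \<ge> 1" if "X \<in> Q" for X
  proof -
    have "X \<subseteq> V" "X \<noteq> {}" using that un ne by auto
    then show "finite X" "card X \<ge> 1" using assms(1) finite_subset[of X V]
      by (auto simp: Suc_le_eq card_gt_0_iff)
  qed
  define S where "S = {X \<in> Q. card X = 1}"
  define R where "R = {X \<in> Q. card X \<noteq> 1}"
  have QSR: "Q = S \<union> R" "S \<inter> R = {}" "finite S" "finite R" unfolding S_def R_def using fQ by auto
  have "card V = (\<Sum>X\<in>Q. card X)"
    unfolding un[symmetric] using fX by (intro card_Union_disjoint dis) auto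
  also have "\<dots> = card S + (\<Sum>X\<in>R. card X)"
    using QSR by (simp add: sum.union_disjoint) (simp add: S_def)
  finally have V: "card V = card S + (\<Sum>X\<in>R. card X)" .
  have Q: "card Q = card S + card R" using QSR by (simp add: card_Un_disjoint)
  have R2: "2 * card R \<le> (\<Sum>X\<in>R. card X)"
  proof -
    have "2 \<le> card X" if "X \<in> R" for X using fX(2)[of X] that unfolding R_def by auto
    then show ?thesis using sum_bounded_below[of R 2 card] by (simp add: mult.commute)
  qed
  have "{y \<in> V. {y} \<notin> Q} = \<Union>R"
  proof (intro equalityI subsetI)
    fix y assume y: "y \<in> {y \<in> V. {y} \<notin> Q}"
    then obtain X where "X \<in> Q" "y \<in> X" using un by auto
    then show "y \<in> \<Union>R" using y unfolding R_def by (auto simp: card_1_singleton_iff)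
  next
    fix y assume "y \<in> \<Union>R"
    then obtain X where X: "X \<in> Q" "card X \<noteq> 1" "y \<in> X" unfolding R_def by auto
    have "{y} \<notin> Q"
    proof
      assume "{y} \<in> Q"
      then have "X = {y}" using dis X by (metis disjointD disjoint_iff singletonI)
      then show False using X by simp
    qed
    then show "y \<in> {y \<in> V. {y} \<notin> Q}" using X un by auto
  qed
  also have "card (\<Union>R) = (\<Sum>X\<in>R. card X)"
    using fX dis unfolding R_def by (intro card_Union_disjoint) (auto simp: disjoint_def)
  finally show "card {y \<in> V. {y} \<notin> Q} \<le> 2 * k" using V Q R2 assms(3) by linarith
  assume le2: "\<And>X. X \<in> Q \<Longrightarrow> card X \<le> 2"
  have two: "card X = 2" if "X \<in> R" for X
    using le2[of X] fX(2)[of X] that unfolding R_def by auto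
  then have "(\<Sum>X\<in>R. card X) = 2 * card R" by simp
  moreover have "R = {X \<in> Q. card X = 2}" using two unfolding R_def by auto
  ultimately show "card {X \<in> Q. card X = 2} = k" using V Q assms(3) by simp
qed

lemma mixed_mono: "mixed E X Y \<Longrightarrow> X \<subseteq> X' \<Longrightarrow> mixed E X' Y"
  unfolding mixed_def by blast

text \<open>A vertex that splits \<open>T\<close> and is still a singleton contributes a red edge at \<open>X\<close>, and at most \<open>2 k\<close>
vertices are no longer singletons.\<close>

lemma splitters_le_rdeg:
  assumes "finite V" "partition_on V Q" "card Q + k = card V" "X \<in> Q" "T \<subseteq> X" "card T \<ge> 2"
  shows "splitters E V T \<le> rdeg E Q X + 2 * k"
proof -
  have fQ: "finite Q" using finite_elements[OF assms(1,2)] .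
  have "X \<subseteq> V" using assms(2,4) by (auto simp: partition_on_def)
  then have fX: "finite X" using assms(1) by (rule finite_subset)
  then have "card X \<ge> 2" using assms(6) card_mono[OF fX assms(5)] by simp
  then have Xs: "{y} \<noteq> X" for y by auto
  let ?A = "{y \<in> V. {y} \<in> Q \<and> mixed E X {y}}"
  have "{y \<in> V - T. mixed E T {y}} \<subseteq> ?A \<union> {y \<in> V. {y} \<notin> Q}"
    using mixed_mono[OF _ assms(5)] by auto
  then have "splitters E V T \<le> card (?A \<union> {y \<in> V. {y} \<notin> Q})"
    unfolding splitters_def using assms(1) by (intro card_mono) auto
  also have "\<dots> \<le> card ?A + card {y \<in> V. {y} \<notin> Q}" by (rule card_Un_le)
  also have "card {y \<in> V. {y} \<notin> Q} \<le> 2 * k" by (rule singletons_of_partition[OF assms(1-3)])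
  also have "card ?A = card ((\<lambda>y. {y}) ` ?A)" by (simp add: card_image)
  also have "\<dots> \<le> rdeg E Q X"
    unfolding rdeg_def using fQ Xs by (intro card_mono) auto
  finally show ?thesis by simp
qed

text \<open>A vertex that splits one of the three pairs splits exactly two of them. The summand 3 accounts for the
members of the triple, which may split the pair that they do not belong to.\<close>

lemma splitters_triple:
  assumes "finite V" "u \<noteq> v" "v \<noteq> w" "u \<noteq> w"
  shows "splitters E V {u, v} + splitters E V {v, w} + splitters E V {u, w} \<le> 2 * splitters E V {u, v, w} + 3"
proof -
  let ?Z = "V - {u, v, w}"
  have sum: "card {y \<in> ?Z. P y} = (\<Sum>y\<in>?Z. of_bool (P y))" for P
    using assms(1) by (subst sum_of_bool_eq) (auto intro!: arg_cong[where f = card])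
  have sp: "splitters E V X \<le> card {y \<in> ?Z. mixed E X {y}} + 1"
    if "{u, v, w} = insert z X" for X z
  proof -
    have "{y \<in> V - X. mixed E X {y}} \<subseteq> insert z {y \<in> ?Z. mixed E X {y}}" using that by auto
    then have "splitters E V X \<le> card (insert z {y \<in> ?Z. mixed E X {y}})"
      unfolding splitters_def using assms(1) by (intro card_mono) auto
    also have "\<dots> \<le> card {y \<in> ?Z. mixed E X {y}} + 1" using assms(1) by (simp add: card_insert_if)
    finally show ?thesis .
  qed
  have "card {y \<in> ?Z. mixed E {u, v} {y}} + card {y \<in> ?Z. mixed E {v, w} {y}} + card {y \<in> ?Z. mixed E {u, w} {y}}
    \<le> 2 * splitters E V {u, v, w}"
    unfolding splitters_def sum sum.distrib[symmetric] sum_distrib_left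
    by (intro sum_mono) (auto simp: mixed_def)
  moreover have "splitters E V {u, v} \<le> card {y \<in> ?Z. mixed E {u, v} {y}} + 1"
    by (rule sp[of w]) auto
  moreover have "splitters E V {v, w} \<le> card {y \<in> ?Z. mixed E {v, w} {y}} + 1"
    by (rule sp[of u]) auto
  moreover have "splitters E V {u, w} \<le> card {y \<in> ?Z. mixed E {u, w} {y}} + 1"
    by (rule sp[of v]) auto
  ultimately show ?thesis by linarith
qed

lemma partition_of_contraction_sequence_at:
  fixes V :: "'a::infinite set"
  assumes "contraction_sequence d (trigraph_of_graph V E) Ts" "finite V" "E \<subseteq> pairs V" "k < card V"
  obtains Q where "partition_on V Q" "card Q + k = card V" "\<And>X. X \<in> Q \<Longrightarrow> rdeg E Q X \<le> d"
proof -
  let ?P = "(\<lambda>x. {x}) ` V"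
  note rep = represents_initial[OF assms(2,3)]
  have part: "partition_on V ?P" by (auto simp: partition_on_def disjoint_def)
  have cP: "card ?P = card V" by (simp add: card_image)
  note seq = partition_of_contraction_sequence[OF assms(1) rep part]
  have ne: "Ts \<noteq> []" and c1: "card (verts (last Ts)) = 1"
    using assms(1) by (auto simp: contraction_sequence_def)
  obtain \<beta> Q where Q: "represents E (Ts ! (length Ts - 1)) \<beta> Q" "card Q + (length Ts - 1) = card ?P"
    using seq[of "length Ts - 1"] ne by auto
  then have "card Q = 1"
    using c1 ne unfolding represents_def by (metis bij_betw_same_card last_conv_nth)
  moreover have "length Ts \<noteq> 0" using ne by simp
  ultimately have k: "k < length Ts" using Q(2) cP assms(4) by linarith
  obtain \<beta> Q where Q: "represents E (Ts ! k) \<beta> Q" "partition_on V Q" "card Q + k = card V"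
    using seq[OF k] cP by auto
  have "rdeg E Q X \<le> d" if "X \<in> Q" for X
  proof -
    have "X \<in> \<beta> ` verts (Ts ! k)" using Q(1) that by (simp add: represents_def bij_betw_def)
    then obtain x where x: "x \<in> verts (Ts ! k)" "X = \<beta> x" by auto
    have "red_degree (Ts ! k) x \<le> d"
      using assms(1) x(1) k by (auto simp: contraction_sequence_def)
    then show ?thesis using red_degree_eq_rdeg[OF Q(1) x(1)] x(2) by simp
  qed
  then show ?thesis using Q that by blast
qed

text \<open>Look at the partition after \<open>k\<close> contractions. If every pair has at least \<open>a\<close> splitters then a block with
three vertices has red degree at least about \<open>3a/2\<close>, which is too much. So there are \<open>k\<close> blocks of size two.\<close>

lemma many_similar_pairs_of_contraction_sequence:
  fixes V :: "'a::infinite set"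
  assumes "contraction_sequence d (trigraph_of_graph V E) Ts" "finite V" "E \<subseteq> pairs V" "k < card V"
    and a: "\<And>X. X \<in> pairs V \<Longrightarrow> a \<le> real (splitters E V X)"
    and d: "2 * real d + 4 * real k + 3 < 3 * a"
  shows "k \<le> card {X \<in> pairs V. splitters E V X \<le> d + 2 * k}"
proof -
  obtain Q where Q: "partition_on V Q" "card Q + k = card V" "\<And>X. X \<in> Q \<Longrightarrow> rdeg E Q X \<le> d"
    using partition_of_contraction_sequence_at[OF assms(1-4)] by metis
  have sub: "X \<subseteq> V" if "X \<in> Q" for X using Q(1) that by (auto simp: partition_on_def)
  have le2: "card X \<le> 2" if "X \<in> Q" for X
  proof (rule ccontr)
    assume "\<not> card X \<le> 2"
    then have "3 \<le> card X" by simp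
    then obtain T where T: "T \<subseteq> X" "card T = 3" by (meson obtain_subset_with_card_n)
    then obtain u v w where uvw: "T = {u, v, w}" "u \<noteq> v" "v \<noteq> w" "u \<noteq> w"
      by (auto simp: card_3_iff)
    have "{u, v} \<in> pairs V" "{v, w} \<in> pairs V" "{u, w} \<in> pairs V"
      using T uvw sub[OF that] by (auto simp: pairs_def)
    then have "3 * a \<le> real (splitters E V {u, v} + splitters E V {v, w} + splitters E V {u, w})"
      using a[of "{u, v}"] a[of "{v, w}"] a[of "{u, w}"] by simp
    also have "\<dots> \<le> real (2 * splitters E V T + 3)"
      unfolding of_nat_le_iff uvw(1) by (rule splitters_triple[OF assms(2) uvw(2-4)])
    also have "splitters E V T \<le> rdeg E Q X + 2 * k"
      using T by (intro splitters_le_rdeg[OF assms(2) Q(1,2) that T(1)]) simp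
    also have "rdeg E Q X \<le> d" by (rule Q(3)[OF that])
    finally show False using d by simp
  qed
  have "k = card {X \<in> Q. card X = 2}"
    using singletons_of_partition(2)[OF assms(2) Q(1,2)] le2 by simp
  also have "\<dots> \<le> card {X \<in> pairs V. splitters E V X \<le> d + 2 * k}"
  proof (intro card_mono subsetI)
    show "finite {X \<in> pairs V. splitters E V X \<le> d + 2 * k}" using finite_pairs[OF assms(2)] by simp
    fix X assume X: "X \<in> {X \<in> Q. card X = 2}"
    then have "splitters E V X \<le> rdeg E Q X + 2 * k"
      by (intro splitters_le_rdeg[OF assms(2) Q(1,2)]) auto
    also have "rdeg E Q X \<le> d" using Q(3) X by simp
    finally show "X \<in> {X \<in> pairs V. splitters E V X \<le> d + 2 * k}"
      using X sub[of X] by (simp add: pairs_def)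
  qed
  finally show ?thesis .
qed

lemma card_pairs_le: "finite V \<Longrightarrow> real (card (pairs V)) \<le> real (card V) ^ 2"
  by (simp add: card_pairs flip: of_nat_power) (cases "card V < 2", simp_all add: binomial_le_pow binomial_eq_0)

lemma cross_pair_subset:
  assumes "X \<in> pairs V" "Z \<subseteq> V"
  shows "cross X (Z - X) \<subseteq> pairs V"
  using assms by (intro cross_subset_pairs) (auto simp: pairs_def)

abbreviation has_sequence :: "nat \<Rightarrow> nat set \<Rightarrow> nat set set \<Rightarrow> bool" where
  "has_sequence d V E \<equiv> \<exists>Ts. contraction_sequence d (trigraph_of_graph V E) Ts"

text \<open>The first summand bounds, by Markov's inequality, the probability that \<open>k\<close> pairs are as similar as a
contraction sequence requires; the second the probability that some pair is so similar that triples
cannot be excluded.\<close>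

lemma pr_contraction_sequence_small:
  fixes n k d :: nat and s1 s2 :: real
  assumes "n \<ge> 2" "1 \<le> k" "k < n" "0 \<le> s1" "0 \<le> s2"
    and 1: "real d + 2 * real k \<le> (real n - 2) / 2 - s1"
    and 2: "2 * real d + 4 * real k + 3 < 3 * ((real n - 2) / 2 - s2)"
  shows "pr (pairs {1..n}) (\<lambda>E. has_sequence d {1..n} E)
    \<le> (real n)\<^sup>2 * exp (- (2 * s1\<^sup>2 / n)) / k + (real n)\<^sup>2 * exp (- (2 * s2\<^sup>2 / n))"
proof -
  let ?V = "{1..n}" and ?B = "pairs {1..n}"
  have fB: "finite ?B" by (intro finite_pairs) simp
  have cB: "real (card ?B) \<le> (real n)\<^sup>2" using card_pairs_le[of ?V] by simp
  have cV: "card (?V - X) = n - 2" if "X \<in> ?B" for X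
    using that by (auto simp: pairs_def card_Diff_subset card_ge_0_finite)
  have tail: "pr ?B (\<lambda>E. real (splitters E ?V X) \<le> (real n - 2) / 2 - s) \<le> exp (- (2 * s\<^sup>2 / n))"
    if "X \<in> ?B" "0 \<le> s" for X s
  proof -
    have "card X = 2" using that by (simp add: pairs_def)
    moreover have "real (n - 2) = real n - 2" using assms(1) by simp
    ultimately show ?thesis
      using pr_splitters_deviation[of X ?V ?B "real n" s "-1"] that cV[OF that(1)] fB assms(1)
        cross_pair_subset[OF that(1), of ?V] by (simp add: algebra_simps)
  qed
  let ?bad1 = "\<lambda>E. real k \<le> (\<Sum>X\<in>?B. of_bool (real (splitters E ?V X) \<le> (real n - 2) / 2 - s1))"
  let ?bad2 = "\<lambda>E. \<exists>X\<in>?B. real (splitters E ?V X) \<le> (real n - 2) / 2 - s2"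
  have "pr ?B ?bad2 \<le> card ?B * exp (- (2 * s2\<^sup>2 / n))"
    by (rule pr_union_bound[OF fB tail[OF _ assms(5)]])
  also have "\<dots> \<le> (real n)\<^sup>2 * exp (- (2 * s2\<^sup>2 / n))"
    using cB by (rule mult_right_mono) simp
  finally have b2: "pr ?B ?bad2 \<le> (real n)\<^sup>2 * exp (- (2 * s2\<^sup>2 / n))" .
  have "pr ?B ?bad1 \<le> avg ?B (\<lambda>E. (1 / k) * (\<Sum>X\<in>?B. of_bool (real (splitters E ?V X) \<le> (real n - 2) / 2 - s1)))"
    using assms(2) by (intro pr_le_avg) (auto simp: sum_nonneg)
  also have "\<dots> \<le> (1 / k) * (card ?B * exp (- (2 * s1\<^sup>2 / n)))"
    unfolding avg_cmult avg_sum using tail assms(4)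
    by (intro mult_left_mono sum_bounded_above) auto
  also have "\<dots> \<le> (1 / k) * ((real n)\<^sup>2 * exp (- (2 * s1\<^sup>2 / n)))"
    using cB by (intro mult_left_mono mult_right_mono) auto
  finally have b1: "pr ?B ?bad1 \<le> (real n)\<^sup>2 * exp (- (2 * s1\<^sup>2 / n)) / k" by simp
  have "pr ?B (\<lambda>E. has_sequence d ?V E) \<le> pr ?B (\<lambda>E. ?bad1 E \<or> ?bad2 E)"
  proof (rule pr_mono, rule disjCI)
    fix E assume E: "E \<subseteq> ?B" and ex: "has_sequence d ?V E" and no: "\<not> ?bad2 E"
    obtain Ts where "contraction_sequence d (trigraph_of_graph ?V E) Ts" using ex by auto
    then have "k \<le> card {X \<in> ?B. splitters E ?V X \<le> d + 2 * k}"
    proof (rule many_similar_pairs_of_contraction_sequence)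
      show "(real n - 2) / 2 - s2 \<le> real (splitters E ?V X)" if "X \<in> ?B" for X
        using no that by force
    qed (use E assms in auto)
    also have "\<dots> \<le> card {X \<in> ?B. real (splitters E ?V X) \<le> (real n - 2) / 2 - s1}"
      using fB 1 by (intro card_mono) auto
    finally have "real k \<le> card {X \<in> ?B. real (splitters E ?V X) \<le> (real n - 2) / 2 - s1}" by simp
    also have "\<dots> = (\<Sum>X\<in>?B. of_bool (real (splitters E ?V X) \<le> (real n - 2) / 2 - s1))"
      using fB by (subst sum_of_bool_eq) (auto simp: Int_def)
    finally show "?bad1 E" .
  qed
  also have "\<dots> \<le> pr ?B ?bad1 + pr ?B ?bad2" by (rule pr_disj)
  finally show ?thesis using b1 b2 by linarith
qed

section \<open>Contracting along a matching\<close>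

lemma card_partition_pos:
  assumes "finite V" "partition_on V P" "X \<in> P"
  shows "finite X" "X \<noteq> {}" "X \<subseteq> V"
proof -
  show "X \<noteq> {}" "X \<subseteq> V" using assms(2,3) by (auto simp: partition_on_def)
  then show "finite X" using assms(1) by (metis finite_subset)
qed

abbreviation unmixed_pairs :: "'a set set \<Rightarrow> 'a set set \<Rightarrow> 'a set \<Rightarrow> 'a set set" where
  "unmixed_pairs E F X \<equiv> {Y \<in> F. X \<inter> Y = {} \<and> \<not> mixed E X Y}"

text \<open>The red degree is less than the number of blocks.\<close>

lemma reducible_few_blocks:
  assumes "finite V" "V \<noteq> {}" "partition_on V P" "card P \<le> d + 1"
  shows "reducible E d P"
  using assms(3,4)
proof (induction "card P" arbitrary: P rule: less_induct)
  case less
  have fP: "finite P" using finite_elements[OF assms(1) less.prems(1)] .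
  have "P \<noteq> {}" using less.prems(1) assms(2) by (auto simp: partition_on_def)
  then have c: "card P \<ge> 1" using fP by (simp add: Suc_le_eq card_gt_0_iff)
  show ?case
  proof (cases "card P = 1")
    case False
    then have "2 \<le> card P" using c by simp
    then obtain T where "T \<subseteq> P" "card T = 2" by (meson obtain_subset_with_card_n)
    then obtain X Y where XY: "X \<in> P" "Y \<in> P" "X \<noteq> Y" by (auto simp: card_2_iff)
    show ?thesis
    proof (rule reducible.step[OF _ XY])
      fix Z assume "Z \<in> P"
      then have "rdeg E P Z \<le> card P - 1"
        unfolding rdeg_def using fP by (subst card_Diff_singleton[symmetric]) (auto intro!: card_mono)
      then show "rdeg E P Z \<le> d" using less.prems(2) by simp
    next
      have "card (merge_blocks P X Y) = card P - 1" by (rule card_merge(1)[OF less.prems(1) XY fP])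
      then show "reducible E d (merge_blocks P X Y)"
        using c less.prems(2)
        by (intro less.hyps partition_on_merge[OF less.prems(1) XY]) auto
    qed
  qed (rule reducible.single)
qed

text \<open>Any two blocks of size at most two may be merged next. Every set \<open>X\<close> of at most four vertices has at
least \<open>h\<close> pairs of \<open>F\<close> with which it is not mixed, and after \<open>s\<close> merges all but \<open>2 s\<close> pairs of \<open>F\<close> are
still blocks. So \<open>X\<close> has red degree at most \<open>(N - s) - (h - 2 s)\<close>, and this suffices for \<open>t\<close> merges, after which
at most \<open>d + 1\<close> blocks are left.\<close>

lemma reducible_by_doubling:
  assumes "finite V" "V \<noteq> {}"
    and hom: "\<And>X. X \<subseteq> V \<Longrightarrow> X \<noteq> {} \<Longrightarrow> card X \<le> 4 \<Longrightarrow> h \<le> card (unmixed_pairs E F X)"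
    and "finite F" "{} \<notin> F" "N \<le> d + 1 + t" "N + t \<le> d + h" "2 * t + 2 \<le> N"
    and "partition_on V P" "\<And>X. X \<in> P \<Longrightarrow> card X \<le> 4" "card {X \<in> P. card X > 2} \<le> s"
      "card (F - P) \<le> 2 * s" "card P + s = N"
  shows "reducible E d P"
  using assms(9-)
proof (induction "card P" arbitrary: P s rule: less_induct)
  case less
  have fP: "finite P" using finite_elements[OF assms(1) less.prems(1)] .
  show ?case
  proof (cases "card P \<le> d + 1")
    case True
    then show ?thesis using reducible_few_blocks[OF assms(1,2) less.prems(1)] by simp
  next
    case False
    then have st: "s < t" using assms(6) less.prems(5) by simp
    let ?small = "{X \<in> P. card X \<le> 2}"
    have "P = ?small \<union> {X \<in> P. card X > 2}" by auto
    then have "card P \<le> card ?small + card {X \<in> P. card X > 2}"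
      using card_Un_le[of ?small "{X \<in> P. card X > 2}"] by simp
    then have "2 \<le> card ?small" using less.prems(3,5) st assms(8) by linarith
    then obtain T where "T \<subseteq> ?small" "card T = 2" by (meson obtain_subset_with_card_n)
    then obtain A B where AB: "A \<in> P" "B \<in> P" "A \<noteq> B" "card A \<le> 2" "card B \<le> 2"
      by (auto simp: card_2_iff)
    show ?thesis
    proof (rule reducible.step[OF _ AB(1-3)])
      fix X assume X: "X \<in> P"
      let ?H = "(unmixed_pairs E F X)"
      have "h \<le> card ?H"
        using card_partition_pos[OF assms(1) less.prems(1) X] less.prems(2)[OF X] by (intro hom)
      also have "?H \<subseteq> (?H \<inter> P) \<union> (F - P)" by auto
      then have "card ?H \<le> card ((?H \<inter> P) \<union> (F - P))" using assms(4) by (intro card_mono) auto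
      also have "\<dots> \<le> card (?H \<inter> P) + card (F - P)" by (rule card_Un_le)
      finally have h: "h \<le> card (?H \<inter> P) + 2 * s" using less.prems(4) by simp
      have "X \<notin> ?H" using card_partition_pos(2)[OF assms(1) less.prems(1) X] by auto
      then have dis: "{Y \<in> P - {X}. mixed E X Y} \<inter> (?H \<inter> P) = {}"
        by auto
      have "rdeg E P X + card (?H \<inter> P) = card ({Y \<in> P - {X}. mixed E X Y} \<union> (?H \<inter> P))"
        unfolding rdeg_def using fP dis by (intro card_Un_disjoint[symmetric]) auto
      also have "\<dots> \<le> card P" using fP by (intro card_mono) auto
      finally show "rdeg E P X \<le> d" using h st assms(7) less.prems(5) by linarith
    next
      let ?P = "merge_blocks P A B"
      have cm: "card ?P = card P - 1" "card P \<ge> 2" by (rule card_merge[OF less.prems(1) AB(1-3) fP])+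
      have cAB: "card (A \<union> B) \<le> 4" using card_Un_le[of A B] AB by simp
      show "reducible E d ?P"
      proof (rule less.hyps)
        show "card ?P < card P" using cm by simp
        show "partition_on V ?P" by (rule partition_on_merge[OF less.prems(1) AB(1-3)])
        show "card X \<le> 4" if "X \<in> ?P" for X
          using that cAB less.prems(2) unfolding merge_blocks_def by auto
        \<comment> \<open>The new block may be large, and at most the two blocks merged leave \<open>F \<inter> P\<close>.\<close>
        have "card {X \<in> ?P. card X > 2} \<le> card (insert (A \<union> B) {X \<in> P. card X > 2})"
          using fP unfolding merge_blocks_def by (intro card_mono) auto
        then show "card {X \<in> ?P. card X > 2} \<le> Suc s"
          using less.prems(3) card_insert_le_m1[of "Suc s" "{X \<in> P. card X > 2}" "A \<union> B"] by simp
        have "card (F - ?P) \<le> card ((F - P) \<union> {A, B})"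
          using assms(4) unfolding merge_blocks_def by (intro card_mono) auto
        also have "\<dots> \<le> card (F - P) + card {A, B}" by (rule card_Un_le)
        finally show "card (F - ?P) \<le> 2 * Suc s" using less.prems(4) AB(3) by simp
        show "card ?P + Suc s = N" using cm less.prems(5) by simp
      qed
    qed
  qed
qed

text \<open>The pairs of \<open>M\<close> have been contracted, and all other vertices are singletons.\<close>

definition matching_partition :: "'a set \<Rightarrow> 'a set set \<Rightarrow> 'a set set" where
  "matching_partition V M = M \<union> (\<lambda>x. {x}) ` (V - \<Union>M)"

lemma partition_on_matching_partition:
  assumes "M \<subseteq> pairs V" "disjoint M"
  shows "partition_on V (matching_partition V M)"
proof -
  have "\<Union>M \<subseteq> V" "{} \<notin> M" using assms(1) by (auto simp: pairs_def)
  moreover have "disjoint (matching_partition V M)"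
    unfolding matching_partition_def
  proof (rule disjoint_union[OF assms(2)])
    show "disjoint ((\<lambda>x. {x}) ` (V - \<Union>M))" by (auto simp: disjoint_def)
  qed auto
  ultimately show ?thesis unfolding partition_on_def matching_partition_def by auto
qed

lemma card_matching_partition:
  assumes "M \<subseteq> pairs V" "disjoint M" "finite V"
  shows "card (matching_partition V M) + card M = card V"
proof -
  have fM: "finite M" using assms finite_subset[OF _ finite_pairs] by metis
  have M2: "card X = 2" "X \<subseteq> V" if "X \<in> M" for X using that assms(1) by (auto simp: pairs_def)
  then have fX: "finite X" if "X \<in> M" for X using that by (auto intro: card_ge_0_finite)
  have U: "\<Union>M \<subseteq> V" using M2 by auto
  have "card (\<Union>M) = (\<Sum>X\<in>M. card X)" using fX by (intro card_Union_disjoint assms(2))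
  also have "\<dots> = 2 * card M" using M2 by simp
  finally have cU: "card (\<Union>M) = 2 * card M" .
  have "card (matching_partition V M) = card M + card ((\<lambda>x. {x}) ` (V - \<Union>M))"
    unfolding matching_partition_def
  proof (rule card_Un_disjoint[OF fM])
    show "finite ((\<lambda>x. {x}) ` (V - \<Union>M))" using assms(3) by simp
  qed auto
  also have "card ((\<lambda>x. {x}) ` (V - \<Union>M)) = card V - card (\<Union>M)"
    using U assms(3) by (simp add: card_image card_Diff_subset finite_subset)
  finally show ?thesis using cU card_mono[OF assms(3) U] by simp
qed

lemma merge_matching_partition:
  assumes "M \<subseteq> pairs V" "disjoint (insert {u, v} M)" "{u, v} \<in> pairs V" "{u, v} \<notin> M"
  shows "{u} \<in> matching_partition V M" "{v} \<in> matching_partition V M" "{u} \<noteq> {v}"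
    "merge_blocks (matching_partition V M) {u} {v} = matching_partition V (insert {u, v} M)"
proof -
  have uv: "u \<in> V" "v \<in> V" "u \<noteq> v" using assms(3) by (auto simp: pairs_def card_2_iff doubleton_eq_iff)
  have dis: "{u, v} \<inter> Y = {}" if "Y \<in> M" for Y
    using disjointD[OF assms(2), of "{u, v}" Y] that assms(4) by auto
  then have n: "u \<notin> \<Union>M" "v \<notin> \<Union>M" by auto
  show "{u} \<in> matching_partition V M" "{v} \<in> matching_partition V M" "{u} \<noteq> {v}"
    using uv n unfolding matching_partition_def by auto
  have "{u} \<notin> M" "{v} \<notin> M" using n by auto
  then show "merge_blocks (matching_partition V M) {u} {v} = matching_partition V (insert {u, v} M)"
    unfolding merge_blocks_def matching_partition_def using uv n by auto
qed

text \<open>The splitters count the red edges at \<open>X\<close> if all other vertices were singletons, and each pair of \<open>M\<close>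
corrects this number by its excess.\<close>

lemma rdeg_pair:
  assumes "M \<subseteq> pairs V" "disjoint M" "finite V" "X \<in> M"
  shows "real (rdeg E (matching_partition V M) X) = splitters E V X + total_excess E X (M - {X})"
proof -
  have fM: "finite M" using assms finite_subset[OF _ finite_pairs] by metis
  have M2: "card Y = 2" "Y \<subseteq> V" if "Y \<in> M" for Y using that assms(1) by (auto simp: pairs_def)
  then have fX: "finite Y" if "Y \<in> M" for Y using that by (auto intro: card_ge_0_finite)
  have dis: "X \<inter> Y = {}" if "Y \<in> M - {X}" for Y using disjointD[OF assms(2,4), of Y] that by auto
  let ?S = "{y \<in> V - \<Union>M. mixed E X {y}}"
  have nb: "{Y \<in> matching_partition V M - {X}. mixed E X Y} = {Y \<in> M - {X}. mixed E X Y} \<union> (\<lambda>y. {y}) ` ?S"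
    using assms(4) unfolding matching_partition_def by auto
  have "rdeg E (matching_partition V M) X = card {Y \<in> M - {X}. mixed E X Y} + card ((\<lambda>y. {y}) ` ?S)"
    unfolding rdeg_def nb using fM assms(3) by (intro card_Un_disjoint) auto
  also have "card ((\<lambda>y. {y}) ` ?S) = card ?S" by (simp add: card_image)
  finally have r: "rdeg E (matching_partition V M) X = card {Y \<in> M - {X}. mixed E X Y} + card ?S" .
  have un: "{y \<in> V - X. mixed E X {y}} = ?S \<union> (\<Union>Y\<in>M - {X}. {y \<in> Y. mixed E X {y}})"
  proof -
    have "y \<notin> X" if "y \<in> Y" "Y \<in> M - {X}" for y Y using dis[OF that(2)] that(1) by auto
    then have "V - X = (V - \<Union>M) \<union> \<Union>(M - {X})" using M2(2) assms(4) by blast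
    then show ?thesis by blast
  qed
  have "splitters E V X = card ?S + card (\<Union>Y\<in>M - {X}. {y \<in> Y. mixed E X {y}})"
    unfolding splitters_def un using fM fX assms(3) by (intro card_Un_disjoint) auto
  also have "card (\<Union>Y\<in>M - {X}. {y \<in> Y. mixed E X {y}}) = (\<Sum>Y\<in>M - {X}. card {y \<in> Y. mixed E X {y}})"
  proof (rule card_UN_disjoint)
    show "\<forall>Y\<in>M - {X}. \<forall>Z\<in>M - {X}. Y \<noteq> Z \<longrightarrow> {y \<in> Y. mixed E X {y}} \<inter> {y \<in> Z. mixed E X {y}} = {}"
    proof (intro ballI impI)
      fix Y Z assume "Y \<in> M - {X}" "Z \<in> M - {X}" "Y \<noteq> Z"
      then have "Y \<inter> Z = {}" using disjointD[OF assms(2)] by simp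
      then show "{y \<in> Y. mixed E X {y}} \<inter> {y \<in> Z. mixed E X {y}} = {}" by auto
    qed
  qed (use fM fX in auto)
  finally have s: "splitters E V X = card ?S + (\<Sum>Y\<in>M - {X}. card {y \<in> Y. mixed E X {y}})" .
  have "(\<Sum>Y\<in>M - {X}. of_bool (mixed E X Y) :: real) = card {Y \<in> M - {X}. mixed E X Y}"
    using fM by (subst sum_of_bool_eq) (auto intro!: arg_cong[where f = card])
  then show ?thesis
    unfolding r s excess_def by (simp add: sum_subtractf)
qed

text \<open>Two singletons are never mixed.\<close>

lemma rdeg_singleton:
  assumes "finite M" "x \<notin> \<Union>M"
  shows "rdeg E (matching_partition V M) {x} \<le> card {Y \<in> M. mixed E {x} Y}"
proof -
  have "{Y \<in> matching_partition V M - {{x}}. mixed E {x} Y} \<subseteq> {Y \<in> M. mixed E {x} Y}"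
    unfolding matching_partition_def mixed_def by auto
  then show ?thesis unfolding rdeg_def using assms(1) by (intro card_mono) auto
qed

lemma reducible_along_matching:
  assumes "distinct L" "set L \<subseteq> pairs V" "disjoint (set L)"
    and deg: "\<And>j X. j < length L \<Longrightarrow> X \<in> matching_partition V (set (take j L)) \<Longrightarrow>
      rdeg E (matching_partition V (set (take j L))) X \<le> d"
    and last: "reducible E d (matching_partition V (set L))"
  shows "reducible E d ((\<lambda>x. {x}) ` V)"
proof -
  have "reducible E d (matching_partition V (set (take 0 L)))"
  proof (rule inc_induct[where j = "length L" and P = "\<lambda>j. reducible E d (matching_partition V (set (take j L)))"])
    show "reducible E d (matching_partition V (set (take (length L) L)))" using last by simp
  next
    fix j assume j: "0 \<le> j" "j < length L" and IH: "reducible E d (matching_partition V (set (take (Suc j) L)))"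
    let ?M = "set (take j L)"
    have ins: "set (take (Suc j) L) = insert (L ! j) ?M"
      using j by (simp add: take_Suc_conv_app_nth)
    have nin: "L ! j \<notin> ?M" using assms(1) j by (auto simp: in_set_conv_nth nth_eq_iff_index_eq)
    have sub: "insert (L ! j) ?M \<subseteq> set L" using j by (auto dest: in_set_takeD)
    then have dis: "disjoint (insert (L ! j) ?M)" using assms(3) unfolding disjoint_def by blast
    have Lj: "L ! j \<in> pairs V" and M: "?M \<subseteq> pairs V" using assms(2) sub by auto
    then obtain u v where uv: "L ! j = {u, v}" by (auto simp: pairs_def card_2_iff)
    note mm = merge_matching_partition[OF M dis[unfolded uv] Lj[unfolded uv] nin[unfolded uv]]
    show "reducible E d (matching_partition V ?M)"
      by (rule reducible.step[OF _ mm(1-3)]) (use deg[OF j(2)] IH ins mm(4) uv in simp_all)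
  qed simp
  then show ?thesis by (simp add: matching_partition_def)
qed

text \<open>First the pairs of \<open>ms\<close> are contracted, then the pairs of \<open>fs\<close> in their order, and finally arbitrary
blocks. The pairs of \<open>ms\<close> have few splitters, and \<open>b\<close> is an allowance for the fluctuation of excesses. The
first \<open>m\<close> pairs of \<open>fs\<close> profit from the negative excess towards \<open>ms\<close>. The later ones profit from
those first \<open>m\<close> pairs, against which the bound \<open>length ms\<close> for the excess towards \<open>ms\<close> is affordable.
Singletons and larger blocks are harmless because of the many pairs of \<open>fs\<close> with which they are not mixed.\<close>

lemma reducible_of_matchings:
  fixes a b c :: real
  assumes V: "finite V" "V \<noteq> {}"
    and L: "distinct (ms @ fs)" "set (ms @ fs) \<subseteq> pairs V" "disjoint (set (ms @ fs))"
    and hom: "\<And>X. X \<subseteq> V \<Longrightarrow> X \<noteq> {} \<Longrightarrow> card X \<le> 4 \<Longrightarrow>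
        h \<le> card (unmixed_pairs E (set fs) X)"
    and ms1: "\<And>X. X \<in> set ms \<Longrightarrow> splitters E V X + 2 * b \<le> real d"
    and ms2: "\<And>X i. X \<in> set ms \<Longrightarrow> i \<le> length ms \<Longrightarrow> total_excess E X (set (take i ms) - {X}) \<le> b"
    and ms3: "\<And>X j. X \<in> set ms \<Longrightarrow> j \<le> length fs \<Longrightarrow> total_excess E X (set (take j fs)) \<le> b"
    and fs1: "\<And>X. X \<in> set fs \<Longrightarrow> splitters E V X \<le> a"
    and fs2: "\<And>X. X \<in> set (take m fs) \<Longrightarrow> a + total_excess E X (set ms) + b \<le> real d"
    and fs3: "\<And>X j. X \<in> set fs \<Longrightarrow> j \<le> length fs \<Longrightarrow> total_excess E X (set (take j fs) - {X}) \<le> b"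
    and fs4: "\<And>X j. X \<in> set (drop m fs) \<Longrightarrow> m \<le> j \<Longrightarrow> j \<le> length fs \<Longrightarrow>
        a + length ms + total_excess E X (set (take j fs) - {X}) \<le> real d"
    and N: "N + length ms + length fs = card V" "N \<le> d + 1 + t" "N + t \<le> d + h" "2 * t + 2 \<le> N"
    and fsd: "length fs + length ms \<le> d + h"
  shows "reducible E d ((\<lambda>x. {x}) ` V)"
proof (rule reducible_along_matching[OF L])
  let ?L = "ms @ fs"
  have cL: "card (set ?L) = length ms + length fs" using distinct_card[OF L(1)] by simp
  have dist: "distinct ms" "distinct fs" "set ms \<inter> set fs = {}" using L(1) by auto
  show "reducible E d (matching_partition V (set ?L))"
  proof (rule reducible_by_doubling[OF V, where F = "set fs" and h = h and N = N and t = t and s = 0])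
    show "h \<le> card (unmixed_pairs E (set fs) X)"
      if "X \<subseteq> V" "X \<noteq> {}" "card X \<le> 4" for X using hom[OF that] .
    show "partition_on V (matching_partition V (set ?L))"
      by (rule partition_on_matching_partition[OF L(2,3)])
    have le2: "card X \<le> 2" if "X \<in> matching_partition V (set ?L)" for X
      using that L(2) unfolding matching_partition_def pairs_def by auto
    then show "card X \<le> 4" if "X \<in> matching_partition V (set ?L)" for X using that by fastforce
    have "{X \<in> matching_partition V (set ?L). card X > 2} = {}" using le2 by fastforce
    then show "card {X \<in> matching_partition V (set ?L). card X > 2} \<le> 0" by (simp only: card.empty)
    have "set fs - matching_partition V (set ?L) = {}" unfolding matching_partition_def by auto
    then show "card (set fs - matching_partition V (set ?L)) \<le> 2 * 0" by (simp only: card.empty)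
    show "card (matching_partition V (set ?L)) + 0 = N"
      using card_matching_partition[OF L(2,3) V(1)] cL N(1) by simp
    show "{} \<notin> set fs" using L(2) by (auto simp: pairs_def)
  qed (use N in auto)
next
  let ?L = "ms @ fs"
  have dist: "distinct ms" "distinct fs" "set ms \<inter> set fs = {}" using L(1) by auto
  fix j X assume j: "j < length ?L" and X: "X \<in> matching_partition V (set (take j ?L))"
  let ?M = "set (take j ?L)"
  have sub: "?M \<subseteq> set ?L" by (rule set_take_subset)
  have M: "?M \<subseteq> pairs V" "disjoint ?M" using sub L(2,3) unfolding disjoint_def by blast+
  have spl: "?M = set (take j ms) \<union> set (take (j - length ms) fs)" by simp
  have j': "j - length ms \<le> length fs" using j by simp
  show "rdeg E (matching_partition V ?M) X \<le> d"
  proof (cases "X \<in> ?M")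
    case False
    then obtain x where x: "X = {x}" "x \<in> V" "x \<notin> \<Union>?M" using X unfolding matching_partition_def by auto
    have "rdeg E (matching_partition V ?M) X \<le> card {Y \<in> ?M. mixed E {x} Y}"
      unfolding x(1) by (rule rdeg_singleton) (use x in auto)
    also have "\<dots> \<le> card (set ms \<union> {Y \<in> set fs. mixed E {x} Y})"
      using sub by (intro card_mono) auto
    also have "\<dots> \<le> length ms + card {Y \<in> set fs. mixed E {x} Y}"
      using card_Un_le[of "set ms"] card_length[of ms] by (meson add_le_mono1 le_trans)
    also have "card {Y \<in> set fs. mixed E {x} Y} + h \<le> length fs"
    proof -
      have "h \<le> card (unmixed_pairs E (set fs) {x})" using x by (intro hom) auto
      then have "card {Y \<in> set fs. mixed E {x} Y} + h
          \<le> card {Y \<in> set fs. mixed E {x} Y} + card (unmixed_pairs E (set fs) {x})" by simp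
      also have "\<dots> = card ({Y \<in> set fs. mixed E {x} Y} \<union> (unmixed_pairs E (set fs) {x}))"
        by (intro card_Un_disjoint[symmetric]) auto
      also have "\<dots> \<le> card (set fs)" by (intro card_mono) auto
      also have "\<dots> \<le> length fs" by (rule card_length)
      finally show ?thesis .
    qed
    then have "length ms + card {Y \<in> set fs. mixed E {x} Y} \<le> length ms + (length fs - h)" by simp
    also have "\<dots> \<le> d"
      using fsd \<open>card {Y \<in> set fs. mixed E {x} Y} + h \<le> length fs\<close> by linarith
    finally show ?thesis .
  next
    case True
    have r: "real (rdeg E (matching_partition V ?M) X) = splitters E V X + total_excess E X (?M - {X})"
      by (rule rdeg_pair[OF M V(1) True])
    have disj: "set (take j ms) \<inter> set (take (j - length ms) fs) = {}"
      using dist(3) by (meson disjoint_iff in_set_takeD)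
    have split: "total_excess E X (?M - {X}) = total_excess E X (set (take j ms) - {X})
       + total_excess E X (set (take (j - length ms) fs) - {X})"
      unfolding spl Un_Diff using disj by (intro sum.union_disjoint) auto
    have "real (rdeg E (matching_partition V ?M) X) \<le> d"
    proof (cases "X \<in> set ms")
      case True
      then have "X \<notin> set (take (j - length ms) fs)" using dist(3) by (meson disjoint_iff in_set_takeD)
      then have "total_excess E X (set (take (j - length ms) fs) - {X}) \<le> b"
        using ms3[OF True j'] by simp
      moreover have "total_excess E X (set (take j ms) - {X}) \<le> b"
        using ms2[OF True, of "min j (length ms)"] by (cases "j \<le> length ms") simp_all
      ultimately show ?thesis using ms1[OF True] unfolding r split by linarith
    next
      case False
      then have Xf: "X \<in> set (take (j - length ms) fs)" using True unfolding spl by (auto dest: in_set_takeD)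
      then have "length (take (j - length ms) fs) > 0" by (metis length_pos_if_in_set)
      then have jm: "length ms \<le> j" by simp
      then have ts: "set (take j ms) - {X} = set ms" using False by auto
      have Xfs: "X \<in> set fs" using Xf by (rule in_set_takeD)
      note f1 = fs1[OF Xfs]
      \<comment> \<open>The pairs of \<open>fs\<close> are contracted only after all of \<open>ms\<close>, which is why the whole of \<open>ms\<close> counts.\<close>
      show ?thesis
      proof (cases "X \<in> set (take m fs)")
        case True
        show ?thesis using fs2[OF True] f1 fs3[OF Xfs j'] unfolding r split ts by linarith
      next
        case False
        then have Xd: "X \<in> set (drop m fs)" using Xfs by (metis Un_iff append_take_drop_id set_append)
        have mj: "m \<le> j - length ms"
        proof (rule ccontr)
          assume "\<not> m \<le> j - length ms"
          then have "set (take (j - length ms) fs) \<subseteq> set (take m fs)" by (intro set_take_subset_set_take) simp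
          then show False using Xf False by auto
        qed
        have "total_excess E X (set ms) \<le> (\<Sum>Y\<in>set ms. 1)"
          by (intro sum_mono) (simp add: excess_def of_bool_def)
        then have "total_excess E X (set ms) \<le> length ms" using dist(1) by (simp add: distinct_card)
        then show ?thesis using fs4[OF Xd mj j'] f1 unfolding r split ts by linarith
      qed
    qed
    then show ?thesis by simp
  qed
qed

section \<open>The upper bound for given parameters\<close>

lemma disjoint_subset: "disjoint G \<Longrightarrow> F \<subseteq> G \<Longrightarrow> disjoint F"
  unfolding disjoint_def by blast

lemma card_disjoint_meeting:
  assumes "disjoint F" "finite X"
  shows "card {Y \<in> F. X \<inter> Y \<noteq> {}} \<le> card X"
proof (rule card_inj_on_le)
  let ?f = "\<lambda>Y. SOME x. x \<in> X \<inter> Y"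
  have f: "?f Y \<in> X \<inter> Y" if "X \<inter> Y \<noteq> {}" for Y using that by (metis some_in_eq)
  show "inj_on ?f {Y \<in> F. X \<inter> Y \<noteq> {}}"
  proof (rule inj_onI)
    fix Y Z assume YZ: "Y \<in> {Y \<in> F. X \<inter> Y \<noteq> {}}" "Z \<in> {Y \<in> F. X \<inter> Y \<noteq> {}}" and eq: "?f Y = ?f Z"
    then have "?f Y \<in> Y \<inter> Z" using f[of Y] f[of Z] by auto
    then show "Y = Z" using disjointD[OF assms(1), of Y Z] YZ by blast
  qed
  show "?f ` {Y \<in> F. X \<inter> Y \<noteq> {}} \<subseteq> X" using f by auto
qed (rule assms(2))

text \<open>It is enough to consider sets of exactly four vertices: a smaller set has at least as many pairs with which
it is not mixed as any set containing it.\<close>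

lemma pr_few_homogeneous:
  assumes "finite V" "F \<subseteq> pairs V" "disjoint F"
  shows "pr (pairs V) (\<lambda>E. \<exists>X\<in>{X. X \<subseteq> V \<and> card X = 4}. card (unmixed_pairs E F X) \<le> h)
    \<le> real (card V) ^ 4 * (2 powr h * (255/256) ^ (card F - 4))"
proof -
  let ?c = "2 powr h * (255/256) ^ (card F - 4)"
  have fB: "finite (pairs V)" by (rule finite_pairs[OF assms(1)])
  then have fF: "finite F" using assms(2) by (metis finite_subset)
  have "pr (pairs V) (\<lambda>E. card (unmixed_pairs E F X) \<le> h) \<le> ?c"
    if X: "X \<in> {X. X \<subseteq> V \<and> card X = 4}" for X
  proof -
    let ?I = "{Y \<in> F. X \<inter> Y = {}}"
    have fX: "finite X" using X by (auto intro: card_ge_0_finite)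
    have "?I \<union> {Y \<in> F. X \<inter> Y \<noteq> {}} = F" by auto
    then have "card F \<le> card ?I + card {Y \<in> F. X \<inter> Y \<noteq> {}}"
      using card_Un_le[of ?I "{Y \<in> F. X \<inter> Y \<noteq> {}}"] by simp
    then have cI: "card F - 4 \<le> card ?I" using card_disjoint_meeting[OF assms(3) fX] X by auto
    have eq: "(unmixed_pairs E F X) = {Y \<in> ?I. \<not> mixed E X Y}" for E by auto
    have "pr (pairs V) (\<lambda>E. real (card {Y \<in> ?I. \<not> mixed E X Y}) \<le> real h) \<le> 2 powr h * (255/256) ^ card ?I"
    proof (rule pr_few_not_mixed)
      show "disjoint ?I" by (rule disjoint_subset[OF assms(3)]) auto
      show "card Y = 2 \<and> X \<inter> Y = {} \<and> cross X Y \<subseteq> pairs V" if "Y \<in> ?I" for Y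
        using that X assms(2) cross_subset_pairs[of X V Y] by (auto simp: pairs_def)
    qed (use X fF fB in auto)
    also have "\<dots> \<le> ?c" using cI by (intro mult_left_mono power_decreasing) auto
    finally show ?thesis unfolding eq by simp
  qed
  then have "pr (pairs V) (\<lambda>E. \<exists>X\<in>{X. X \<subseteq> V \<and> card X = 4}. card (unmixed_pairs E F X) \<le> h)
     \<le> real (card {X. X \<subseteq> V \<and> card X = 4}) * ?c"
    using assms(1) by (intro pr_union_bound) auto
  also have "card {X. X \<subseteq> V \<and> card X = 4} \<le> card V ^ 4"
    using n_subsets[OF assms(1), of 4] by (cases "card V < 4") (auto simp: binomial_eq_0 binomial_le_pow)
  then have "real (card {X. X \<subseteq> V \<and> card X = 4}) * ?c \<le> real (card V) ^ 4 * ?c"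
    by (intro mult_right_mono) (simp_all flip: of_nat_power)
  finally show ?thesis .
qed

lemma pr_splitters_large:
  assumes "finite V" "Z \<subseteq> V" "\<X> \<subseteq> pairs V" "real (card Z) \<le> N" "N > 0" "s \<ge> 0"
  shows "pr (pairs V) (\<lambda>E. \<exists>X\<in>\<X>. splitters E Z X \<ge> card (Z - X) / 2 + s)
    \<le> (real (card V))\<^sup>2 * exp (- (2 * s\<^sup>2 / N))"
proof -
  have fB: "finite (pairs V)" by (rule finite_pairs[OF assms(1)])
  have fX: "finite \<X>" using assms(3) fB by (metis finite_subset)
  have fZ: "finite Z" using assms(1,2) finite_subset by auto
  have "pr (pairs V) (\<lambda>E. splitters E Z X \<ge> card (Z - X) / 2 + s) \<le> exp (- (2 * s\<^sup>2 / N))"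
    if "X \<in> \<X>" for X
  proof -
    have X: "X \<in> pairs V" "card X = 2" using that assms(3) by (auto simp: pairs_def)
    have "card (Z - X) \<le> card Z" using fZ by (intro card_mono) auto
    then show ?thesis
      using pr_splitters_deviation[OF X(2) fZ cross_pair_subset[OF X(1) assms(2)] fB, of N s 1] assms
      by (simp add: algebra_simps)
  qed
  then have "pr (pairs V) (\<lambda>E. \<exists>X\<in>\<X>. splitters E Z X \<ge> card (Z - X) / 2 + s)
     \<le> real (card \<X>) * exp (- (2 * s\<^sup>2 / N))"
    by (rule pr_union_bound[OF fX])
  also have "\<dots> \<le> (real (card V))\<^sup>2 * exp (- (2 * s\<^sup>2 / N))"
    using card_mono[OF fB assms(3)] card_pairs_le[OF assms(1)] by (intro mult_right_mono) auto
  finally show ?thesis .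
qed

text \<open>The pair \<open>X\<close> itself may belong to \<open>L\<close> and is then left out. In the second bound \<open>i\<close> is a common lower bound
for the number of summands.\<close>

lemma pr_excess_prefix:
  assumes "finite V" "\<X> \<subseteq> pairs V" "set L \<subseteq> pairs V" "disjoint (set L)"
    "\<And>X Y. X \<in> \<X> \<Longrightarrow> Y \<in> set L \<Longrightarrow> X \<noteq> Y \<Longrightarrow> X \<inter> Y = {}"
  shows "pr (pairs V) (\<lambda>E. \<exists>(X, j)\<in>\<X> \<times> {..length L}. total_excess E X (set (take j L) - {X}) \<ge> b)
    \<le> real (card \<X> * (length L + 1)) * 2 powr (- b)"
    "pr (pairs V) (\<lambda>E. \<exists>(X, j)\<in>\<X> \<times> {..length L}. i \<le> card (set (take j L) - {X}) \<and>
        total_excess E X (set (take j L) - {X}) \<ge> - (real i / 100))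
    \<le> real (card \<X> * (length L + 1)) * exp (- (real i / 100))"
proof -
  have fB: "finite (pairs V)" by (rule finite_pairs[OF assms(1)])
  have fX: "finite \<X>" using assms(2) fB by (metis finite_subset)
  have prem: "card X = 2" "finite (set (take j L) - {X})" "disjoint (set (take j L) - {X})"
      "Y \<in> set (take j L) - {X} \<Longrightarrow> card Y = 2 \<and> X \<inter> Y = {} \<and> cross X Y \<subseteq> pairs V"
    if "X \<in> \<X>" for X Y j
  proof -
    have sub: "set (take j L) \<subseteq> set L" by (rule set_take_subset)
    show "card X = 2" using that assms(2) by (auto simp: pairs_def)
    show "finite (set (take j L) - {X})" by simp
    show "disjoint (set (take j L) - {X})" by (rule disjoint_subset[OF assms(4)]) (use sub in auto)
    assume "Y \<in> set (take j L) - {X}"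
    then have "Y \<in> set L" "Y \<noteq> X" using sub by auto
    moreover from this have "X \<inter> Y = {}" using assms(5)[OF that] by auto
    moreover have "X \<subseteq> V" "Y \<subseteq> V" "card Y = 2" using calculation(1) that assms(2,3) by (auto simp: pairs_def)
    ultimately show "card Y = 2 \<and> X \<inter> Y = {} \<and> cross X Y \<subseteq> pairs V"
      using cross_subset_pairs[of X V Y] by simp
  qed
  have ub: "pr (pairs V) (\<lambda>E. \<exists>(X, j)\<in>\<X> \<times> {..length L}. P X j E) \<le> real (card \<X> * (length L + 1)) * c"
    if P: "\<And>X j. X \<in> \<X> \<Longrightarrow> pr (pairs V) (P X j) \<le> c" for P c
  proof -
    have "pr (pairs V) (\<lambda>E. \<exists>z\<in>\<X> \<times> {..length L}. P (fst z) (snd z) E) \<le> real (card (\<X> \<times> {..length L})) * c"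
      by (rule pr_union_bound) (use fX P in auto)
    then show ?thesis by (simp add: case_prod_beta card_cartesian_product)
  qed
  show "pr (pairs V) (\<lambda>E. \<exists>(X, j)\<in>\<X> \<times> {..length L}. total_excess E X (set (take j L) - {X}) \<ge> b)
    \<le> real (card \<X> * (length L + 1)) * 2 powr (- b)"
  proof (rule ub)
    fix X j assume X: "X \<in> \<X>"
    show "pr (pairs V) (\<lambda>E. total_excess E X (set (take j L) - {X}) \<ge> b) \<le> 2 powr (- b)"
      by (rule pr_excess_ge[OF prem(1-4)[OF X] fB])
  qed
  show "pr (pairs V) (\<lambda>E. \<exists>(X, j)\<in>\<X> \<times> {..length L}. i \<le> card (set (take j L) - {X}) \<and>
        total_excess E X (set (take j L) - {X}) \<ge> - (real i / 100))
    \<le> real (card \<X> * (length L + 1)) * exp (- (real i / 100))"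
  proof (rule ub)
    fix X j assume X: "X \<in> \<X>"
    let ?I = "set (take j L) - {X}"
    show "pr (pairs V) (\<lambda>E. i \<le> card ?I \<and> total_excess E X ?I \<ge> - (real i / 100)) \<le> exp (- (real i / 100))"
    proof (cases "i \<le> card ?I")
      case True
      have "pr (pairs V) (\<lambda>E. i \<le> card ?I \<and> total_excess E X ?I \<ge> - (real i / 100))
         \<le> pr (pairs V) (\<lambda>E. total_excess E X ?I \<ge> - (card ?I / 100))"
        using True by (intro pr_mono) (auto intro: order_trans[rotated])
      also have "\<dots> \<le> exp (- (card ?I / 100))"
        by (rule pr_excess_not_small[OF prem(1-4)[OF X] fB])
      also have "\<dots> \<le> exp (- (real i / 100))" using True by simp
      finally show ?thesis .
    qed (use fB in simp)
  qed
qed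

text \<open>A fixed perfect matching of the interval from \<open>m + 1\<close> to \<open>m + 2 * l\<close>.\<close>

definition consecutive_pairs :: "nat \<Rightarrow> nat \<Rightarrow> nat set list" where
  "consecutive_pairs m l = map (\<lambda>i. {m + 2 * i + 1, m + 2 * i + 2}) [0..<l]"

lemma consecutive_pairs_eqD:
  "{m + 2 * i + 1, m + 2 * i + 2} \<inter> {m + 2 * j + 1, m + 2 * j + 2} \<noteq> {} \<Longrightarrow> i = (j :: nat)"
  by auto

lemma length_consecutive_pairs [simp]: "length (consecutive_pairs m l) = l"
  by (simp add: consecutive_pairs_def)

lemma distinct_consecutive_pairs: "distinct (consecutive_pairs m l)"
proof -
  have "inj_on (\<lambda>i. {m + 2 * i + 1, m + 2 * i + 2}) {0..<l}"
    by (rule inj_onI, rule consecutive_pairs_eqD[of m]) auto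
  then show ?thesis by (simp add: consecutive_pairs_def distinct_map)
qed

lemma disjoint_consecutive_pairs: "disjoint (set (consecutive_pairs m l))"
proof (rule disjointI)
  fix X Y assume XY: "X \<in> set (consecutive_pairs m l)" "Y \<in> set (consecutive_pairs m l)" "X \<noteq> Y"
  obtain i where i: "X = {m + 2 * i + 1, m + 2 * i + 2}" using XY(1) by (auto simp: consecutive_pairs_def)
  obtain j where j: "Y = {m + 2 * j + 1, m + 2 * j + 2}" using XY(2) by (auto simp: consecutive_pairs_def)
  have "i \<noteq> j" using XY(3) i j by blast
  then show "X \<inter> Y = {}" using consecutive_pairs_eqD[of m i j] unfolding i j by blast
qed

lemma set_consecutive_pairs: "set (consecutive_pairs m l) \<subseteq> pairs {m + 1..m + 2 * l}"
  by (auto simp: consecutive_pairs_def pairs_def)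

lemma take_consecutive_pairs: "i \<le> l \<Longrightarrow> take i (consecutive_pairs m l) = consecutive_pairs m i"
  by (simp add: consecutive_pairs_def take_map)

lemma splitters_split:
  assumes "finite Z" "W \<subseteq> Z"
  shows "splitters E Z X = splitters E W X + splitters E (Z - W) X"
proof -
  have "{y \<in> Z - X. mixed E X {y}} = {y \<in> W - X. mixed E X {y}} \<union> {y \<in> (Z - W) - X. mixed E X {y}}"
    using assms by auto
  then show ?thesis unfolding splitters_def using assms finite_subset[of W Z]
    by (simp add: card_Un_disjoint disjoint_iff)
qed

lemma splitters_cong_cross: "X \<subseteq> U \<Longrightarrow> splitters E W X = splitters (E \<inter> cross U W) W X"
proof -
  assume X: "X \<subseteq> U"
  have "mixed E X {y} = mixed (E \<inter> cross U W) X {y}" if "y \<in> W" for y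
    by (rule mixed_cross) (use that X in \<open>auto simp: cross_def\<close>)
  then show ?thesis unfolding splitters_def by (intro arg_cong[where f = card]) auto
qed

lemma excess_outside:
  assumes "X \<subseteq> U" "X \<inter> W = {}" "Y \<inter> W = {}"
  shows "excess E X Y = excess (E - cross U W) X Y"
proof -
  have "cross X Y \<subseteq> - cross U W"
    using assms unfolding cross_def by (auto simp: doubleton_eq_iff)
  then have "excess E X Y = excess (E \<inter> - cross U W) X Y" by (rule excess_cross)
  then show ?thesis by (simp add: Diff_eq)
qed

text \<open>This is all that the deterministic argument uses about the pairs contracted first.\<close>

definition useful_matching where
  "useful_matching U W F k t b E ms \<longleftrightarrow>
    distinct ms \<and> length ms = k \<and> set ms \<subseteq> pairs U \<and> disjoint (set ms) \<and>
    (\<forall>X\<in>set ms. splitters E W X \<le> t) \<and>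
    (\<forall>X\<in>set ms. \<forall>i\<le>k. total_excess E X (set (take i ms) - {X}) < b) \<and>
    (\<forall>X\<in>F. total_excess E X (set ms) < - (real k / 100))"

text \<open>A matching of pairs with few splitters in \<open>W\<close> is picked by looking at the edges between \<open>U\<close> and \<open>W\<close>.
The excesses that matter, between two of its pairs and between its pairs and a pair inside \<open>S\<close>, depend on
other edges, so for them the matching is as good as fixed. The union bound then runs over the pairs and
the prefixes of this single matching.\<close>

lemma pr_bad_matching:
  fixes b :: real
  assumes "finite V" "U \<subseteq> V" "W \<subseteq> V" "U \<inter> W = {}" "S \<subseteq> V" "S \<inter> U = {}" "S \<inter> W = {}"
    "F \<subseteq> pairs S"
  shows "pr (pairs V) (\<lambda>E. similar_matching_exists U W k t E \<and>
    \<not> (\<exists>ms. useful_matching U W F k t b E ms))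
    \<le> real (k * (k + 1)) * 2 powr (- b) + real (card F * (k + 1)) * exp (- (real k / 100))"
proof -
  define shape where "shape ms \<longleftrightarrow> distinct ms \<and> length ms = k \<and> set ms \<subseteq> pairs U \<and> disjoint (set ms)" for ms
  define valid where "valid E ms \<longleftrightarrow> shape ms \<and> (\<forall>X\<in>set ms. splitters E W X \<le> t)" for E ms
  define Q where "Q E \<longleftrightarrow> (\<exists>ms. valid E ms)" for E
  define M where "M E = (SOME ms. valid E ms)" for E
  define R where "R ms E \<longleftrightarrow> shape ms \<and>
     ((\<exists>X\<in>set ms. \<exists>i\<le>k. total_excess E X (set (take i ms) - {X}) \<ge> b) \<or>
      (\<exists>X\<in>F. total_excess E X (set ms) \<ge> - (real k / 100)))" for ms E
  let ?C = "cross U W" and ?c = "real (k * (k + 1)) * 2 powr (- b) + real (card F * (k + 1)) * exp (- (real k / 100))"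
  have fB: "finite (pairs V)" by (rule finite_pairs[OF assms(1)])
  have fF: "finite F" using assms(1,5,8) by (meson finite_pairs finite_subset)
  have FV: "F \<subseteq> pairs V" "pairs U \<subseteq> pairs V" using assms(2,5,8) by (auto simp: pairs_def)
  have FU: "X \<inter> Y = {}" if "X \<in> F" "Y \<in> pairs U" for X Y
    using that assms(6,8) by (auto simp: pairs_def)
  have vcong: "valid E ms = valid (E \<inter> ?C) ms" for E ms
  proof -
    have "splitters E W X = splitters (E \<inter> ?C) W X" if "shape ms" "X \<in> set ms" for X
      by (rule splitters_cong_cross) (use that in \<open>auto simp: shape_def pairs_def\<close>)
    then show ?thesis unfolding valid_def by auto
  qed
  have Rcong: "R ms E = R ms (E - ?C)" for ms E
  proof (cases "shape ms")
    case True
    have e1: "excess E X Y = excess (E - ?C) X Y" if "X \<in> set ms" "Y \<in> set ms" for X Y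
      by (rule excess_outside) (use that True assms(4) in \<open>auto simp: shape_def pairs_def\<close>)
    have e2: "excess E X Y = excess (E - ?C) X Y" if "X \<in> F" "Y \<in> set ms" for X Y
    proof -
      have "cross X Y \<subseteq> - ?C"
        using that True assms(4,6-8) unfolding cross_def shape_def pairs_def
        by (auto simp: doubleton_eq_iff) blast+
      then have "excess E X Y = excess (E \<inter> - ?C) X Y" by (rule excess_cross)
      then show ?thesis by (simp add: Diff_eq)
    qed
    have "total_excess E X (set (take i ms) - {X}) = total_excess (E - ?C) X (set (take i ms) - {X})"
      if "X \<in> set ms" for X i
      using that by (intro sum.cong refl e1) (auto dest: in_set_takeD)
    moreover have "total_excess E X (set ms) = total_excess (E - ?C) X (set ms)" if "X \<in> F" for X
      using that by (intro sum.cong refl e2)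
    ultimately show ?thesis unfolding R_def by simp
  qed (simp add: R_def)
  have pR: "pr (pairs V) (R ms) \<le> ?c" for ms
  proof (cases "shape ms")
    case True
    then have ms: "distinct ms" "length ms = k" "set ms \<subseteq> pairs U" "disjoint (set ms)"
      by (auto simp: shape_def)
    have cms: "card (set ms) = k" using distinct_card ms by blast
    let ?R1 = "\<lambda>E. \<exists>(X, j)\<in>set ms \<times> {..length ms}. total_excess E X (set (take j ms) - {X}) \<ge> b"
    let ?R2 = "\<lambda>E. \<exists>(X, j)\<in>F \<times> {..length ms}. k \<le> card (set (take j ms) - {X}) \<and>
        total_excess E X (set (take j ms) - {X}) \<ge> - (real k / 100)"
    have "pr (pairs V) (R ms) \<le> pr (pairs V) (\<lambda>E. ?R1 E \<or> ?R2 E)"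
    proof (rule pr_mono)
      fix E assume "R ms E"
      then consider X i where "X \<in> set ms" "i \<le> k" "total_excess E X (set (take i ms) - {X}) \<ge> b"
        | X where "X \<in> F" "total_excess E X (set ms) \<ge> - (real k / 100)"
        unfolding R_def by auto
      then show "?R1 E \<or> ?R2 E"
      proof cases
        case 1
        then show ?thesis using ms(2) by (intro disjI1 bexI[of _ "(X, i)"]) auto
      next
        case 2
        have "X \<notin> set ms"
        proof
          assume "X \<in> set ms"
          then have "X \<inter> X = {}" "card X = 2" using FU[OF 2(1)] ms(3) by (auto simp: pairs_def)
          then show False by simp
        qed
        then have "set (take k ms) - {X} = set ms" using ms(2) by simp
        then show ?thesis using 2 ms(2) cms by (intro disjI2 bexI[of _ "(X, k)"]) auto
      qed
    qed
    also have "\<dots> \<le> pr (pairs V) ?R1 + pr (pairs V) ?R2" by (rule pr_disj)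
    also have "\<dots> \<le> real (card (set ms) * (length ms + 1)) * 2 powr (- b)
       + real (card F * (length ms + 1)) * exp (- (real k / 100))"
    proof (rule add_mono)
      have msV: "set ms \<subseteq> pairs V" using ms(3) FV(2) by auto
      show "pr (pairs V) ?R1 \<le> real (card (set ms) * (length ms + 1)) * 2 powr (- b)"
        by (rule pr_excess_prefix(1)[OF assms(1) msV msV ms(4)]) (use disjointD[OF ms(4)] in auto)
      show "pr (pairs V) ?R2 \<le> real (card F * (length ms + 1)) * exp (- (real k / 100))"
        by (rule pr_excess_prefix(2)[OF assms(1) FV(1) msV ms(4)]) (use FU ms(3) in auto)
    qed
    finally show ?thesis using cms ms(2) by simp
  next
    case False
    then have "R ms = (\<lambda>_. False)" by (simp add: R_def fun_eq_iff)
    then show ?thesis using fB by (simp add: add_nonneg_nonneg)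
  qed
  have main: "pr (pairs V) (\<lambda>E. Q E \<and> R (M E) E) \<le> ?c"
  proof (rule pr_choice[where M = M and R = R and Q = Q and B = ?C, OF fB])
    show "?C \<subseteq> pairs V" by (rule cross_subset_pairs) (use assms in auto)
    have v: "valid E = valid (E \<inter> ?C)" for E by (rule ext) (rule vcong)
    show "M E = M (E \<inter> ?C)" for E unfolding M_def using v[of E] by simp
    show "Q E = Q (E \<inter> ?C)" for E unfolding Q_def using v[of E] by simp
    show "R ms E = R ms (E - ?C)" for ms E by (rule Rcong)
    show "pr (pairs V) (R (M E)) \<le> ?c" for E by (rule pR)
  qed (simp add: add_nonneg_nonneg)
  have imp: "Q E \<and> R (M E) E"
    if ex: "similar_matching_exists U W k t E"
      and no: "\<not> (\<exists>ms. useful_matching U W F k t b E ms)" for E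
  proof -
    obtain N where N: "N \<subseteq> pairs U" "disjoint N" "card N = k" "\<forall>X\<in>N. splitters E W X \<le> t" using ex by auto
    have "finite N" using N(1) assms(1,2) by (meson finite_pairs finite_subset)
    then obtain ms where "set ms = N" "distinct ms" using finite_distinct_list by blast
    then have "valid E ms" using N distinct_card[of ms] by (auto simp: valid_def shape_def)
    then have Q: "Q E" by (auto simp: Q_def)
    then have v: "valid E (M E)" unfolding Q_def M_def by (rule someI_ex)
    have "R (M E) E"
    proof (rule ccontr)
      assume "\<not> R (M E) E"
      then have "(\<forall>X\<in>set (M E). \<forall>i\<le>k. total_excess E X (set (take i (M E)) - {X}) < b) \<and>
        (\<forall>X\<in>F. total_excess E X (set (M E)) < - (real k / 100))"
        using v unfolding R_def valid_def by (fastforce simp: not_le)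
      then show False using no v unfolding useful_matching_def valid_def shape_def by blast
    qed
    then show ?thesis using Q by simp
  qed
  show ?thesis
    by (rule order_trans[OF pr_mono main], elim conjE, rule imp)
qed

text \<open>The failure events are, in the order of the summands of the bound: too few disjoint pairs with few splitters, bad
excesses at these pairs, a set of four vertices mixed with almost all pairs of the fixed matching, a pair with far
too many splitters, a pair of \<open>U\<close> with too many splitters outside \<open>W\<close>, a large excess towards a prefix of the
fixed matching, and a long prefix of the fixed matching towards which the excess is not negative enough.\<close>

lemma pr_no_contraction_sequence:
  fixes n m r k T t h d N :: nat and b s2 s3 q :: real
  assumes n: "3 * m + 2 * r \<le> n" "n \<le> 3 * m + 2 * r + 1" "2 \<le> m" "T \<le> r"
    and q: "q = tail_prob (2 * r) (r - T)" "0 < q" "real k \<le> real (m choose 2) * q / 4"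
    and s: "0 \<le> s2" "0 \<le> s3"
    and d1: "real n / 2 - T + s3 + 2 * b \<le> d"
    and d2: "real n / 2 + s2 - real k / 100 + b \<le> d"
    and d3: "real n / 2 + s2 + real k - (real m - 1) / 100 \<le> d"
    and N: "N + k + m + r = n" "N \<le> d + 1 + t" "N + t \<le> d + h" "2 * t + 2 \<le> N" "m + r + k \<le> d + h"
  shows "pr (pairs {1..n}) (\<lambda>E. \<not> has_sequence d {1..n} E)
    \<le> (4 / (real (m choose 2) * q) + 4 * real m ^ 3 * q / real (m choose 2)) +
      (real (k * (k + 1)) * 2 powr (- b) + real (m * (k + 1)) * exp (- (real k / 100))) +
      real n ^ 4 * (2 powr h * (255/256) ^ (m + r - 4)) +
      real n ^ 2 * exp (- (2 * s2\<^sup>2 / n)) + real n ^ 2 * exp (- (2 * s3\<^sup>2 / (3 * real m + 1))) +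
      real (n ^ 2 * (n + 1)) * 2 powr (- b) + real (n ^ 2 * (n + 1)) * exp (- ((real m - 1) / 100))"
proof -
  define V U S W where "V = {1..n}" and "U = {1..m}" and "S = {m + 1..m + 2 * m}"
    and "W = {3 * m + 1..3 * m + 2 * r}"
  note defs = V_def U_def S_def W_def
  define fs where "fs = consecutive_pairs m (m + r)"
  define Z where "Z = V - W"
  define \<X> where "\<X> = pairs U \<union> set fs"
  have lfs: "length fs = m + r" by (simp add: fs_def)
  have dfs: "distinct fs" "disjoint (set fs)"
    by (simp_all add: fs_def distinct_consecutive_pairs disjoint_consecutive_pairs)
  have cfs: "card (set fs) = m + r" using distinct_card[OF dfs(1)] lfs by simp
  have pfs: "set fs \<subseteq> pairs {m + 1..m + 2 * (m + r)}" unfolding fs_def by (rule set_consecutive_pairs)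
  moreover have "{m + 1..m + 2 * (m + r)} \<subseteq> V" using n(1) unfolding V_def by auto
  ultimately have fsV: "set fs \<subseteq> pairs V" unfolding pairs_def by blast
  have FS: "set (take m fs) \<subseteq> pairs S"
    unfolding fs_def S_def take_consecutive_pairs[OF le_add1] by (rule set_consecutive_pairs)
  have cFS: "card (set (take m fs)) = m" using dfs(1) lfs by (simp add: distinct_card)
  have fin: "finite V" "finite U" "finite W" by (simp_all add: defs)
  have sub: "U \<subseteq> V" "W \<subseteq> V" "U \<inter> W = {}" "S \<subseteq> V" "S \<inter> U = {}" "S \<inter> W = {}"
    using n by (auto simp: defs)
  have cards: "card V = n" "card U = m" "card W = 2 * r" by (simp_all add: defs)
  have fB: "finite (pairs V)" by (rule finite_pairs[OF fin(1)])
  have UV: "pairs U \<subseteq> pairs V" using sub by (auto simp: pairs_def)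
  have XV: "\<X> \<subseteq> pairs V" using UV fsV by (auto simp: \<X>_def)
  have Ufs: "X \<inter> Y = {}" if "X \<in> pairs U" "Y \<in> set fs" for X Y
  proof -
    have "X \<subseteq> {1..m}" using that(1) by (auto simp: pairs_def U_def)
    moreover have "Y \<subseteq> {m + 1..m + 2 * (m + r)}" using that(2) pfs by (auto simp: pairs_def)
    ultimately show ?thesis by force
  qed
  have Ufs': "X \<notin> set fs" if "X \<in> pairs U" for X
  proof
    assume "X \<in> set fs"
    then have "X = {}" using Ufs[OF that] by blast
    then show False using that by (simp add: pairs_def)
  qed
  have Xfs: "X \<inter> Y = {}" if "X \<in> \<X>" "Y \<in> set fs" "X \<noteq> Y" for X Y
    using that Ufs disjointD[OF dfs(2)] unfolding \<X>_def by blast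
  have cZ: "real (card Z) \<le> 3 * real m + 1" "real (card Z) = real n - 2 * real r"
  proof -
    have "card Z = n - 2 * r" unfolding Z_def using sub(2) fin cards by (simp add: card_Diff_subset)
    then show "real (card Z) \<le> 3 * real m + 1" "real (card Z) = real n - 2 * real r" using n by linarith+
  qed
  have cX: "real (card \<X> * (length fs + 1)) \<le> real (n ^ 2 * (n + 1))"
  proof -
    have "real (card \<X>) \<le> real (n ^ 2)"
      using card_mono[OF fB XV] card_pairs_le[OF fin(1)] cards by simp
    then have "card \<X> \<le> n ^ 2" by (simp only: of_nat_le_iff)
    moreover have "length fs + 1 \<le> n + 1" using lfs n by simp
    ultimately show ?thesis by (simp only: of_nat_le_iff mult_le_mono)
  qed
  have U2: "real (m choose 2) > 0" using n(3) by simp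
  define e1 where "e1 = (\<lambda>E. \<not> similar_matching_exists U W k (r - T) E)"
  define e2 where "e2 = (\<lambda>E. \<not> e1 E \<and> \<not> (\<exists>ms. useful_matching U W (set (take m fs)) k (r - T) b E ms))"
  define e3 where "e3 = (\<lambda>E. \<exists>X\<in>{X. X \<subseteq> V \<and> card X = 4}. card (unmixed_pairs E (set fs) X) \<le> h)"
  define e4 where "e4 = (\<lambda>E. \<exists>X\<in>pairs V. splitters E V X \<ge> card (V - X) / 2 + s2)"
  define e5 where "e5 = (\<lambda>E. \<exists>X\<in>pairs U. splitters E Z X \<ge> card (Z - X) / 2 + s3)"
  define e6 where "e6 = (\<lambda>E. \<exists>(X, j)\<in>\<X> \<times> {..length fs}. total_excess E X (set (take j fs) - {X}) \<ge> b)"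
  define e7 where "e7 = (\<lambda>E. \<exists>(X, j)\<in>\<X> \<times> {..length fs}. m - 1 \<le> card (set (take j fs) - {X}) \<and>
        total_excess E X (set (take j fs) - {X}) \<ge> - (real (m - 1) / 100))"
  have p1: "pr (pairs V) e1 \<le> 4 / (real (m choose 2) * q) + 4 * real m ^ 3 * q / real (m choose 2)"
    unfolding e1_def
    using pr_no_matching[OF fB fin(2,3) sub(3) _ _ q(2), of "r - T" "real (m choose 2)" k]
      cross_subset_pairs[OF sub(1,2,3)] q U2 cards by simp
  have p2: "pr (pairs V) e2 \<le> real (k * (k + 1)) * 2 powr (- b) + real (m * (k + 1)) * exp (- (real k / 100))"
    using pr_bad_matching[OF fin(1) sub FS, of k "r - T" b] unfolding cFS e2_def e1_def not_not .
  have p3: "pr (pairs V) e3 \<le> real n ^ 4 * (2 powr h * (255/256) ^ (m + r - 4))"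
    using pr_few_homogeneous[OF fin(1) fsV dfs(2), of h] cards cfs unfolding e3_def by simp
  have p4: "pr (pairs V) e4 \<le> real n ^ 2 * exp (- (2 * s2\<^sup>2 / n))"
    using pr_splitters_large[OF fin(1) subset_refl subset_refl, of "real n" s2] cards s n unfolding e4_def by simp
  have p5: "pr (pairs V) e5 \<le> real n ^ 2 * exp (- (2 * s3\<^sup>2 / (3 * real m + 1)))"
    using pr_splitters_large[OF fin(1) _ UV cZ(1) _ s(2)] cards unfolding e5_def Z_def by simp
  have "pr (pairs V) e6 \<le> real (card \<X> * (length fs + 1)) * 2 powr (- b)"
    unfolding e6_def by (rule pr_excess_prefix(1)[OF fin(1) XV fsV dfs(2) Xfs])
  also have "\<dots> \<le> real (n ^ 2 * (n + 1)) * 2 powr (- b)" using cX by (rule mult_right_mono) simp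
  finally have p6: "pr (pairs V) e6 \<le> real (n ^ 2 * (n + 1)) * 2 powr (- b)" .
  have "pr (pairs V) e7 \<le> real (card \<X> * (length fs + 1)) * exp (- (real (m - 1) / 100))"
    unfolding e7_def by (rule pr_excess_prefix(2)[OF fin(1) XV fsV dfs(2) Xfs])
  also have "\<dots> \<le> real (n ^ 2 * (n + 1)) * exp (- (real (m - 1) / 100))" using cX by (rule mult_right_mono) simp
  also have "real (m - 1) = real m - 1" using n(3) by simp
  finally have p7: "pr (pairs V) e7 \<le> real (n ^ 2 * (n + 1)) * exp (- ((real m - 1) / 100))" .
  have "pr (pairs V) (\<lambda>E. \<not> has_sequence d V E)
    \<le> pr (pairs V) (\<lambda>E. (((((e1 E \<or> e2 E) \<or> e3 E) \<or> e4 E) \<or> e5 E) \<or> e6 E) \<or> e7 E)"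
  proof (rule pr_mono, rule ccontr)
    fix E assume E: "E \<subseteq> pairs V" and no: "\<not> has_sequence d V E"
      and "\<not> ((((((e1 E \<or> e2 E) \<or> e3 E) \<or> e4 E) \<or> e5 E) \<or> e6 E) \<or> e7 E)"
    then have ne: "\<not> e1 E" "\<not> e2 E" "\<not> e3 E" "\<not> e4 E" "\<not> e5 E" "\<not> e6 E" "\<not> e7 E" by auto
    obtain ms where g: "useful_matching U W (set (take m fs)) k (r - T) b E ms" using ne(1,2) unfolding e2_def by auto
    then have ms: "distinct ms" "length ms = k" "set ms \<subseteq> pairs U" "disjoint (set ms)"
        "\<And>X. X \<in> set ms \<Longrightarrow> splitters E W X \<le> r - T"
        "\<And>X i. X \<in> set ms \<Longrightarrow> i \<le> k \<Longrightarrow> total_excess E X (set (take i ms) - {X}) < b"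
        "\<And>X. X \<in> set (take m fs) \<Longrightarrow> total_excess E X (set ms) < - (real k / 100)"
      unfolding useful_matching_def by blast+
    have cV2: "real (card (V - X)) = real n - 2" if "X \<in> pairs V" for X
      using that cards(1) n fin(1) by (auto simp: pairs_def card_Diff_subset finite_subset of_nat_diff)
    have sV: "splitters E V X \<le> real n / 2 + s2" if "X \<in> pairs V" for X
    proof -
      have "real (splitters E V X) < card (V - X) / 2 + s2" using ne(4) that unfolding e4_def by force
      then show ?thesis unfolding cV2[OF that] by (simp add: diff_divide_distrib)
    qed
    have e6': "total_excess E X (set (take j fs) - {X}) < b" if "X \<in> \<X>" "j \<le> m + r" for X j
      using ne(6) that lfs unfolding e6_def by force
    have msfs: "X \<notin> set fs" if "X \<in> set ms" for X using Ufs' ms(3) that by auto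
    have "reducible E d ((\<lambda>x. {x}) ` V)"
    proof (rule reducible_of_matchings[where ms = ms and fs = fs and m = m and h = h and N = N and t = t
          and b = b and a = "real n / 2 + s2"])
      show "finite V" "V \<noteq> {}" using n by (auto simp: V_def)
      show "distinct (ms @ fs)" using ms(1) dfs(1) msfs by auto
      show "set (ms @ fs) \<subseteq> pairs V" using ms(3) UV fsV by auto
      have "\<Union>(set ms) \<inter> \<Union>(set fs) = {}" using Ufs ms(3) by blast
      then show "disjoint (set (ms @ fs))" using disjoint_union[OF ms(4) dfs(2)] by simp
      show "h \<le> card (unmixed_pairs E (set fs) X)" if X: "X \<subseteq> V" "X \<noteq> {}" "card X \<le> 4" for X
      proof -
        have fX: "finite X" using X(1) fin(1) by (rule finite_subset)
        have "card (V - X) = n - card X" using fX X(1) cards by (simp add: card_Diff_subset)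
        then have "4 - card X \<le> card (V - X)" using n by linarith
        then obtain T' where T': "T' \<subseteq> V - X" "card T' = 4 - card X" by (meson obtain_subset_with_card_n)
        then have "finite T'" using fin(1) finite_subset[of T' V] by auto
        then have "card (X \<union> T') = 4" using T' fX X(3) by (subst card_Un_disjoint) auto
        then have "X \<union> T' \<in> {X. X \<subseteq> V \<and> card X = 4}" using T'(1) X(1) by auto
        then have "h < card (unmixed_pairs E (set fs) (X \<union> T'))"
          using ne(3) unfolding e3_def by force
        also have "\<dots> \<le> card (unmixed_pairs E (set fs) X)"
          using mixed_mono[of E X _ "X \<union> T'"] by (intro card_mono) auto
        finally show ?thesis by simp
      qed
      show "splitters E V X + 2 * b \<le> real d" if X: "X \<in> set ms" for X
      proof -
        have XU: "X \<in> pairs U" using X ms(3) by auto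
        have "X \<subseteq> Z" "card X = 2" using XU sub unfolding Z_def by (auto simp: pairs_def)
        moreover have "finite X" using \<open>card X = 2\<close> by (auto intro: card_ge_0_finite)
        moreover have "finite Z" using fin(1) by (simp add: Z_def)
        ultimately have "real (card (Z - X)) = real n - 2 * real r - 2"
          using cZ(2) card_mono[of Z X] by (simp add: card_Diff_subset of_nat_diff)
        moreover have "real (splitters E Z X) < card (Z - X) / 2 + s3" using ne(5) XU unfolding e5_def by force
        moreover have "real (splitters E W X) \<le> real r - T" using ms(5)[OF X] n(4) by linarith
        moreover have "splitters E V X = splitters E W X + splitters E Z X"
          unfolding Z_def by (rule splitters_split[OF fin(1) sub(2)])
        ultimately show ?thesis using d1 by (simp add: diff_divide_distrib)
      qed
      show "total_excess E X (set (take i ms) - {X}) \<le> b" if "X \<in> set ms" "i \<le> length ms" for X i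
        using ms(6)[OF that(1), of i] that ms(2) by simp
      show "total_excess E X (set (take j fs)) \<le> b" if X: "X \<in> set ms" and j: "j \<le> length fs" for X j
      proof -
        have "X \<notin> set (take j fs)" using msfs[OF X] by (auto dest: in_set_takeD)
        then show ?thesis using e6'[of X j] X j ms(3) lfs by (auto simp: \<X>_def)
      qed
      show "splitters E V X \<le> real n / 2 + s2" if "X \<in> set fs" for X using sV fsV that by auto
      show "real n / 2 + s2 + total_excess E X (set ms) + b \<le> real d" if "X \<in> set (take m fs)" for X
        using ms(7)[OF that] d2 by linarith
      show "total_excess E X (set (take j fs) - {X}) \<le> b" if "X \<in> set fs" "j \<le> length fs" for X j
        using e6'[of X j] that lfs by (simp add: \<X>_def)
      show "real n / 2 + s2 + length ms + total_excess E X (set (take j fs) - {X}) \<le> real d"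
        if X: "X \<in> set (drop m fs)" and j: "m \<le> j" "j \<le> length fs" for X j
      proof -
        have "card (set (take j fs)) = j" using dfs(1) j(2) by (simp add: distinct_card)
        then have "m - 1 \<le> card (set (take j fs) - {X})"
          using j(1) by (cases "X \<in> set (take j fs)") auto
        moreover have "X \<in> \<X>" using X by (auto simp: \<X>_def dest: in_set_dropD)
        ultimately have "total_excess E X (set (take j fs) - {X}) < - (real (m - 1) / 100)"
          using ne(7) j(2) unfolding e7_def by force
        moreover have "real (m - 1) = real m - 1" using n(3) by simp
        ultimately show ?thesis using d3 ms(2) by simp
      qed
    qed (use N lfs ms(2) cards in auto)
    then have "has_sequence d V E"
      by (rule contraction_sequence_of_reducible[OF _ represents_initial[OF fin(1) E], of _ V])
        (auto simp: partition_on_def disjoint_def)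
    then show False using no by simp
  qed
  also have "\<dots> \<le> (((((pr (pairs V) e1 + pr (pairs V) e2) + pr (pairs V) e3) + pr (pairs V) e4) + pr (pairs V) e5)
      + pr (pairs V) e6) + pr (pairs V) e7"
    by (intro order_trans[OF pr_disj] add_right_mono order_refl)
  finally show ?thesis using p1 p2 p3 p4 p5 p6 p7 unfolding V_def by linarith
qed

section \<open>Asymptotics\<close>

text \<open>For each \<open>j\<close> the value \<open>f j n\<close> is at least \<open>1 - 1 / (j + 1)\<close> from some \<open>N j\<close> on; \<open>J n\<close> is the largest
\<open>j \<le> n\<close> with \<open>N j \<le> n\<close>.\<close>

lemma diagonal_tendsto_1:
  fixes f :: "nat \<Rightarrow> nat \<Rightarrow> real"
  assumes "\<And>j. f j \<longlonglongrightarrow> 1" "\<And>j n. f j n \<le> 1"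
  shows "\<exists>J. filterlim J at_top sequentially \<and> (\<lambda>n. f (J n) n) \<longlonglongrightarrow> 1"
proof -
  have "\<exists>N. \<forall>n\<ge>N. f j n \<ge> 1 - 1 / (real j + 1)" for j
  proof -
    have "eventually (\<lambda>n. f j n > 1 - 1 / (real j + 1)) sequentially"
      using assms(1)[of j] by (rule order_tendstoD) simp
    then show ?thesis unfolding eventually_sequentially by (meson less_imp_le)
  qed
  then obtain N where N: "\<And>j n. n \<ge> N j \<Longrightarrow> f j n \<ge> 1 - 1 / (real j + 1)" by metis
  define S where "S n = {j. j \<le> n \<and> N j \<le> n}" for n
  define J where "J n = Max (insert 0 (S n))" for n
  have fin: "finite (S n)" for n unfolding S_def by simp
  have large: "J n \<ge> j" if "n \<ge> max j (N j)" for j n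
    unfolding J_def using fin that by (intro Max_ge) (auto simp: S_def)
  have J: "filterlim J at_top sequentially"
    unfolding filterlim_at_top eventually_sequentially using large by blast
  have ok: "f (J n) n \<ge> 1 - 1 / (real (J n) + 1)" if n: "n \<ge> N 0" for n
  proof -
    have "J n \<in> insert 0 (S n)" unfolding J_def using fin by (intro Max_in) auto
    then have "N (J n) \<le> n" using n unfolding S_def by auto
    then show ?thesis by (rule N)
  qed
  have "(\<lambda>n. 1 - 1 / (real (J n) + 1)) \<longlonglongrightarrow> 1"
  proof -
    have "((\<lambda>j. 1 - 1 / (real j + 1)) \<longlongrightarrow> 1) sequentially" by real_asymp
    from filterlim_compose[OF this J] show ?thesis .
  qed
  from _ _ this tendsto_const have "(\<lambda>n. f (J n) n) \<longlonglongrightarrow> 1"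
  proof (rule tendsto_sandwich)
    show "\<forall>\<^sub>F n in sequentially. 1 - 1 / (real (J n) + 1) \<le> f (J n) n"
      using ok unfolding eventually_sequentially by blast
  qed (use assms(2) in auto)
  then show ?thesis using J by blast
qed

lemma tail_prob_upper:
  assumes "T \<le> r" "r \<ge> 1"
  shows "tail_prob (2 * r) (r - T) \<le> exp (- (real T ^ 2 / r))"
proof -
  define X W :: "nat set" where "X = {0, 1}" and "W = {2..2 * r + 1}"
  have W: "card W = 2 * r" "finite W" "X \<inter> W = {}" "W - X = W" by (auto simp: X_def W_def)
  have X: "X \<in> pairs X" "card X = 2" "finite X" by (simp_all add: X_def pairs_def)
  have fB: "finite (cross X W)" using X W by (intro finite_cross)
  have "tail_prob (2 * r) (r - T) = pr (cross X W) (\<lambda>E. splitters E W X \<le> r - T)"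
    using pr_few_splitters[OF fB W(2) X(1) W(3) subset_refl] W(1) by simp
  also have "\<dots> \<le> pr (cross X W) (\<lambda>E. real T \<le> - 1 * (real (splitters E W X) - card (W - X) / 2))"
    using W assms by (intro pr_mono) (simp add: of_nat_diff flip: of_nat_le_iff)
  also have "\<dots> \<le> exp (- (2 * real T ^ 2 / real (2 * r)))"
    using X W fB assms by (intro pr_splitters_deviation) auto
  also have "2 * real T ^ 2 / real (2 * r) = real T ^ 2 / r" by simp
  finally show ?thesis .
qed

lemma one_minus_ge_exp:
  assumes "0 \<le> x" "x \<le> 1/2"
  shows "exp (- (x + x\<^sup>2 * 2)) \<le> 1 - (x::real)"
proof -
  have "- (x + x\<^sup>2 * 2) \<le> ln (1 - x)" using ln_one_minus_pos_lower_bound[OF assms] by simp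
  then have "exp (- (x + x\<^sup>2 * 2)) \<le> exp (ln (1 - x))" by (simp only: exp_le_cancel_iff)
  then show ?thesis using assms by simp
qed

text \<open>With \<open>h\<close> about \<open>sqrt r\<close> the number of summands cancels the factor \<open>sqrt r\<close>, and \<open>(1 - J / r) ^ J\<close>
is \<open>exp (- J^2 / r)\<close> up to lower order terms.\<close>

lemma tail_prob_lower_exp:
  assumes "J = T + h" "2 * J \<le> r" "r \<ge> 1" "sqrt r \<le> real h + 1"
  shows "1/2 * exp (- (real J ^ 2 / r * (1 + 2 * (real J / r)))) \<le> tail_prob (2 * r) (r - T)"
proof -
  let ?x = "real J / r"
  have x: "0 \<le> ?x" "?x \<le> 1/2" using assms(2,3) by (auto simp: field_simps)
  have "1/2 * exp (- (real J ^ 2 / r * (1 + 2 * ?x))) = 1/2 * exp (- (?x + ?x\<^sup>2 * 2)) ^ J"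
    using assms(3) by (simp add: power2_eq_square field_simps flip: exp_of_nat_mult)
  also have "\<dots> \<le> 1/2 * (1 - ?x) ^ J"
    using one_minus_ge_exp[OF x] by (intro mult_left_mono power_mono) auto
  also have "1/2 \<le> (real h + 1) / (2 * sqrt r)" using assms(3,4) by (simp add: field_simps)
  then have "1/2 * (1 - ?x) ^ J \<le> (real h + 1) / (2 * sqrt r) * (1 - ?x) ^ J"
  proof (rule mult_right_mono)
    have "0 \<le> 1 - ?x" using x by linarith
    then show "0 \<le> (1 - ?x) ^ J" by (rule zero_le_power)
  qed
  also have "\<dots> \<le> tail_prob (2 * r) (r - T)"
    using tail_prob_lower[of T h r] assms by simp
  finally show ?thesis .
qed

lemma sqrt3_half: "43/50 \<le> sqrt 3 / 2" "sqrt 3 / 2 \<le> 87/100" "(sqrt 3 / 2)\<^sup>2 = 3/4"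
proof -
  show "43/50 \<le> sqrt 3 / 2" using real_le_rsqrt[of "43/25" 3] by (simp add: power2_eq_square)
  show "sqrt 3 / 2 \<le> 87/100" using real_le_lsqrt[of "87/50" 3] by (simp add: power2_eq_square)
  show "(sqrt 3 / 2)\<^sup>2 = 3/4" by (simp add: power_divide)
qed

text \<open>The exponent \<open>3/2\<close> is \<open>2 (sqrt 3 / 2)^2\<close>. Up to constants the lower bound is \<open>x powr (- (3/2 - e/2))\<close>, so that
the expected number of suitable pairs exceeds \<open>x powr (1/2)\<close> by a power of \<open>x\<close>; the choice of \<open>\<delta>\<close>, quadratic
in \<open>e\<close>, keeps the loss from \<open>r < x / 2\<close> below the gain from \<open>e\<close>. In the upper bound, any exponent
larger than 1 would do.\<close>

lemma tail_prob_asymp: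
  fixes e x L s \<delta> :: real and r T :: nat
  assumes e: "0 < e" "e \<le> 1/100" "\<delta> = e\<^sup>2 / 1000" and s: "s = sqrt 3 / 2"
    and x: "1 < x" "L = sqrt (x * ln x)"
    and T: "(s - e / 2) * L \<le> T" "T \<le> (s - e / 2) * L + 1"
    and r: "x * (1 - 4 * \<delta>) / 2 \<le> r" "r \<le> x / 2"
    and C: "sqrt x + 2 \<le> e / 4 * L" "8 * L \<le> \<delta> * x"
  shows "1/2 * exp (- ((3/2 - e/2) * ln x)) \<le> tail_prob (2 * r) (r - T)"
    "tail_prob (2 * r) (r - T) \<le> exp (- (7/5 * ln x))" "T \<le> r"
proof -
  have L: "0 \<le> L" "L\<^sup>2 = x * ln x" using x by auto
  have sb: "43/50 \<le> s" "s \<le> 87/100" "s\<^sup>2 = 3/4" by (simp_all only: s sqrt3_half)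
  have e2: "e\<^sup>2 \<le> e / 100" using e by (simp add: power2_eq_square mult_left_mono)
  have e2': "0 < e\<^sup>2" using e by simp
  have d: "0 < \<delta>" "\<delta> \<le> e / 100000" "\<delta> \<le> 1/1000000" unfolding e(3) using e(2) e2 e2' by linarith+
  have lx: "0 < ln x" using x by simp
  define h where "h = nat \<lceil>sqrt r\<rceil>"
  define J where "J = T + h"
  have h: "sqrt r \<le> h" "h \<le> sqrt r + 1" unfolding h_def using real_sqrt_ge_zero[of "real r"] by linarith+
  have "sqrt r \<le> sqrt x" using r(2) x by simp
  moreover have "(s - e / 4) * L = (s - e / 2) * L + e / 4 * L" by (simp add: algebra_simps)
  moreover have "real J = T + h" by (simp add: J_def)
  ultimately have J: "J \<le> (s - e / 4) * L" using h(2) T(2) C(1) by linarith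
  have JL: "J \<le> L"
  proof -
    have "(s - e / 4) * L \<le> 1 * L" using sb e L by (intro mult_right_mono) auto
    then show ?thesis using J by simp
  qed
  have rx: "x / 4 \<le> r"
  proof -
    have "x * (1/2) \<le> x * (1 - 4 * \<delta>)" using x d by (intro mult_left_mono) auto
    then show ?thesis using r(1) by simp
  qed
  have dx: "\<delta> * x \<le> x / 1000000" using mult_right_mono[OF d(3), of x] x by simp
  have Jr: "2 * real J \<le> r" using JL C(2) dx rx x by linarith
  then have Jr': "2 * J \<le> r" by linarith
  have r1: "r \<ge> 1" using rx x by (cases r) auto
  show Tr: "T \<le> r" using Jr' unfolding J_def by simp
  have Jq: "2 * (real J / r) \<le> \<delta>"
  proof -
    have "2 * real J \<le> \<delta> * (x / 4)" using JL C(2) by simp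
    also have "\<dots> \<le> \<delta> * r" using rx d by (intro mult_left_mono) auto
    finally show ?thesis using r1 by (simp add: field_simps)
  qed
  have cst: "2 * (s - e / 4)\<^sup>2 * (1 + \<delta>) \<le> (3/2 - e / 2) * (1 - 4 * \<delta>)"
  proof -
    have de: "0 \<le> \<delta> * e" using d(1) e(1) by (intro mult_nonneg_nonneg less_imp_le)
    have se: "43/50 * e \<le> s * e" using sb e by (intro mult_right_mono) auto
    have "2 * (s - e / 4)\<^sup>2 = 3/2 - s * e + e\<^sup>2 / 8"
      using sb(3) by (simp add: power2_eq_square algebra_simps)
    then have "2 * (s - e / 4)\<^sup>2 \<le> 3/2 - 17/20 * e" using se e2 e(1) by linarith
    then have "2 * (s - e / 4)\<^sup>2 * (1 + \<delta>) \<le> (3/2 - 17/20 * e) * (1 + \<delta>)"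
      using d by (intro mult_right_mono) auto
    also have "\<dots> = 3/2 - 17/20 * e + 3/2 * \<delta> - 17/20 * (\<delta> * e)" by (simp add: field_simps)
    also have "\<dots> \<le> 3/2 - 17/20 * e + 3/2 * \<delta>" using de by linarith
    also have "\<dots> \<le> 3/2 - e / 2 - 6 * \<delta>" using d(2) e by linarith
    also have "\<dots> \<le> 3/2 - e / 2 - 6 * \<delta> + 2 * (\<delta> * e)" using de by linarith
    also have "\<dots> = (3/2 - e / 2) * (1 - 4 * \<delta>)" by (simp add: field_simps)
    finally show ?thesis .
  qed
  have "real J ^ 2 / r * (1 + 2 * (real J / r)) \<le> (3/2 - e/2) * ln x"
  proof -
    have p: "0 < x * (1 - 4 * \<delta>) / 2" using x d by simp
    have "real J ^ 2 \<le> ((s - e / 4) * L)\<^sup>2" using J by (intro power_mono) auto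
    also have "\<dots> = (s - e / 4)\<^sup>2 * (x * ln x)" by (simp add: power_mult_distrib L(2))
    finally have "real J ^ 2 / r \<le> (s - e / 4)\<^sup>2 * (x * ln x) / (x * (1 - 4 * \<delta>) / 2)"
      using r(1) p x lx by (intro frac_le) auto
    also have "\<dots> = 2 * (s - e / 4)\<^sup>2 / (1 - 4 * \<delta>) * ln x" using x by simp
    finally have "real J ^ 2 / r * (1 + 2 * (real J / r)) \<le> 2 * (s - e / 4)\<^sup>2 / (1 - 4 * \<delta>) * ln x * (1 + \<delta>)"
      using Jq lx d by (intro mult_mono) auto
    also have "\<dots> = (2 * (s - e / 4)\<^sup>2 * (1 + \<delta>)) / (1 - 4 * \<delta>) * ln x" by simp
    also have "\<dots> \<le> (3/2 - e/2) * ln x"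
      using cst d lx by (intro mult_right_mono) (auto simp: pos_divide_le_eq)
    finally show ?thesis .
  qed
  then have "1/2 * exp (- ((3/2 - e/2) * ln x)) \<le> 1/2 * exp (- (real J ^ 2 / r * (1 + 2 * (real J / r))))"
    by simp
  also have "\<dots> \<le> tail_prob (2 * r) (r - T)"
    by (rule tail_prob_lower_exp[OF J_def Jr' r1]) (use h in simp)
  finally show "1/2 * exp (- ((3/2 - e/2) * ln x)) \<le> tail_prob (2 * r) (r - T)" .
  have "tail_prob (2 * r) (r - T) \<le> exp (- (real T ^ 2 / r))" by (rule tail_prob_upper[OF Tr r1])
  also have "\<dots> \<le> exp (- (7/5 * ln x))"
  proof -
    have "7/10 \<le> (17/20::real)\<^sup>2" by (simp add: power2_eq_square)
    also have "\<dots> \<le> (s - e / 2)\<^sup>2" using sb e by (intro power_mono) auto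
    finally have "7/10 * L\<^sup>2 \<le> (s - e / 2)\<^sup>2 * L\<^sup>2" by (rule mult_right_mono) simp
    also have "\<dots> = ((s - e / 2) * L)\<^sup>2" by (simp add: power_mult_distrib)
    also have "\<dots> \<le> real T ^ 2" using T(1) sb e L by (intro power_mono mult_nonneg_nonneg) auto
    finally have t: "7/10 * (x * ln x) \<le> real T ^ 2" using L by simp
    have "7/5 * ln x * r \<le> 7/5 * ln x * (x / 2)" using r(2) lx by (intro mult_left_mono) auto
    also have "\<dots> \<le> real T ^ 2" using t by (simp add: mult_ac)
    finally show ?thesis using r1 by (simp add: pos_le_divide_eq)
  qed
  finally show "tail_prob (2 * r) (r - T) \<le> exp (- (7/5 * ln x))" .
qed

lemma two_powr_log: "x > 0 \<Longrightarrow> 2 powr (- (10 * log 2 x)) = exp (- (10 * ln x))"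
  by (simp add: powr_def log_def)

definition contractible :: "nat \<Rightarrow> real \<Rightarrow> nat set set \<Rightarrow> bool" where
  "contractible n w E \<longleftrightarrow> (\<exists>d. has_sequence d {1..n} E \<and> real d \<le> w)"

text \<open>In the general bound take \<open>U\<close> and \<open>S\<close> of sizes about \<open>\<delta> n\<close> and \<open>2 \<delta> n\<close>, a matching of \<open>400 L\<close> pairs, and
\<open>10 log 2 n\<close> as the allowance for fluctuations of excesses, which beats union bounds over \<open>O(n^3)\<close>
events.\<close>

lemma cheap_contraction_sequence_whp:
  fixes e :: real
  assumes e: "0 < e" "e \<le> 1/100"
  shows "(\<lambda>n. pr (pairs {1..n})
      (\<lambda>E. \<not> contractible n (real n / 2 - (sqrt 3 / 2 - e) * sqrt (real n * ln (real n))) E)) \<longlonglongrightarrow> 0"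
    (is "?p \<longlonglongrightarrow> 0")
proof -
  define \<delta> where "\<delta> = e\<^sup>2 / 1000"
  define s where "s = sqrt 3 / 2"
  have e2: "e\<^sup>2 \<le> e / 100" "0 < e\<^sup>2" using e by (simp_all add: power2_eq_square mult_left_mono)
  have \<delta>: "0 < \<delta>" "\<delta> \<le> 1/10000000" using e e2 unfolding \<delta>_def by simp_all
  have s: "43/50 \<le> s" "s \<le> 87/100" using sqrt3_half by (simp_all add: s_def)
  define L where "L x = sqrt (x * ln x)" for x :: real
  \<comment> \<open>The summands are those of the general bound, with explicit estimates of the rounded parameters.\<close>
  define g where "g x = 64 / (\<delta>\<^sup>2 * x powr (1/2 + e/2)) + 16 * x * exp (- (7/5 * ln x)) +
      (x * (x + 1) * exp (- (10 * ln x)) + x * (x + 1) * exp (- (4 * L x))) +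
      x ^ 4 * exp (- (x / 2000)) + x\<^sup>2 * exp (- (8 * ln x)) + x\<^sup>2 * exp (- (3 * ln x)) +
      x\<^sup>2 * (x + 1) * exp (- (10 * ln x)) + x\<^sup>2 * (x + 1) * exp (- ((\<delta> * x - 2) / 100))" for x
  have g: "(g \<longlongrightarrow> 0) at_top"
    unfolding g_def L_def using e \<delta>(1) by (intro tendsto_add_zero) real_asymp+
  have ev: "eventually (\<lambda>x. sqrt x + 2 \<le> e / 4 * L x \<and> 20 * log 2 x + 1 \<le> e / 4 * L x \<and>
      404000 * L x + 10000 \<le> \<delta> * x \<and> 400 * L x + 1 \<le> \<delta>\<^sup>2 / 64 * x powr (1/2 + e/2) \<and> 1 < x) at_top"
    unfolding L_def using e \<delta>(1) by (intro eventually_conj) real_asymp+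
  show ?thesis
  proof (rule tendsto_sandwich[OF _ _ tendsto_const])
    show "(\<lambda>n. g (real n)) \<longlonglongrightarrow> 0" by (rule filterlim_compose[OF g filterlim_real_sequentially])
    show "\<forall>\<^sub>F n in sequentially. 0 \<le> ?p n"
      by (intro always_eventually allI pr_nonneg)
    show "\<forall>\<^sub>F n in sequentially. ?p n \<le> g (real n)"
      using eventually_compose_filterlim[OF ev filterlim_real_sequentially]
    proof eventually_elim
      case (elim n)
      define x where "x = real n"
      define l where "l = L x"
      define b where "b = 10 * log 2 x"
      have C: "sqrt x + 2 \<le> e / 4 * l" "2 * b + 1 \<le> e / 4 * l" "404000 * l + 10000 \<le> \<delta> * x"
        "400 * l + 1 \<le> \<delta>\<^sup>2 / 64 * x powr (1/2 + e/2)" "1 < x"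
        using elim by (simp_all add: x_def l_def b_def)
      have lx: "0 < ln x" using C by simp
      have l0: "0 \<le> l" "l\<^sup>2 = x * ln x" unfolding l_def L_def using C lx by auto
      define a u where "a = s * l" and "u = e * l"
      have u: "u \<le> l / 100" "0 \<le> u" "e / 4 * l = u / 4" using e l0(1) mult_right_mono[of e "1/100" l] by (auto simp: u_def)
      have Cu: "sqrt x + 2 \<le> u / 4" "2 * b + 1 \<le> u / 4" using C(1,2) u(3) by simp_all
      have b0: "0 \<le> b" using C(5) by (simp add: b_def)
      have a: "43/50 * l \<le> a" "a \<le> 87/100 * l" unfolding a_def by (rule mult_right_mono[OF s(1) l0(1)], rule mult_right_mono[OF s(2) l0(1)])
      have dx: "\<delta> * x \<le> x / 10000000" using mult_right_mono[OF \<delta>(2), of x] C(5) by simp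
      define m where "m = nat \<lfloor>\<delta> * x\<rfloor>"
      have "0 \<le> \<delta> * x" using \<delta> C(5) by simp
      then have m: "\<delta> * x - 1 \<le> m" "m \<le> \<delta> * x" unfolding m_def by linarith+
      define r where "r = (n - 3 * m) div 2"
      have "3 * real m \<le> x" using m(2) dx C(5) by linarith
      then have m3: "3 * m \<le> n" unfolding x_def by linarith
      then have rn: "3 * m + 2 * r \<le> n" "n \<le> 3 * m + 2 * r + 1" unfolding r_def by linarith+
      then have "real (3 * m + 2 * r) \<le> x" "x \<le> real (3 * m + 2 * r + 1)" unfolding x_def by (simp_all only: of_nat_le_iff)
      then have r: "3 * real m + 2 * real r \<le> x" "x \<le> 3 * real m + 2 * real r + 1" by simp_all
      define T where "T = nat \<lceil>(s - e / 2) * l\<rceil>"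
      have "0 \<le> (s - e / 2) * l" using s e l0 by simp
      then have T: "(s - e / 2) * l \<le> T" "T \<le> (s - e / 2) * l + 1" unfolding T_def by linarith+
      define k where "k = nat \<lceil>400 * l\<rceil>"
      have k: "400 * l \<le> k" "k \<le> 400 * l + 1" unfolding k_def using l0 by linarith+
      define h where "h = nat \<lfloor>x / 2000\<rfloor>"
      have h: "x / 2000 - 1 \<le> h" "h \<le> x / 2000" unfolding h_def using C(5) by linarith+
      define d where "d = nat \<lfloor>x / 2 - (s - e) * l\<rfloor>"
      have se: "(s - e) * l = a - u" "(s - e / 2) * l = a - u / 2" by (simp_all add: a_def u_def algebra_simps)
      have "0 \<le> x / 2 - (a - u)" using u(1,2) a C(3,5) dx l0(1) by linarith
      then have d: "x / 2 - (a - u) - 1 \<le> d" "d \<le> x / 2 - (a - u)" unfolding d_def se by linarith+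
      note T' = T[unfolded se]
      \<comment> \<open>the number of blocks once both matchings have been contracted\<close>
      define N where "N = n - k - m - r"
      have "real k + m + r \<le> x" using k m r dx C(3,5) l0(1) by linarith
      then have Nn: "N + k + m + r = n" unfolding N_def x_def by linarith
      then have "real (N + k + m + r) = x" by (simp add: x_def)
      then have N: "real N + k + m + r = x" by simp
      define q where "q = tail_prob (2 * r) (r - T)"
      have q: "1/2 * exp (- ((3/2 - e/2) * ln x)) \<le> q" "q \<le> exp (- (7/5 * ln x))" "T \<le> r"
      proof -
        have "x * (1 - 4 * \<delta>) / 2 \<le> r" using r m(2) C(3) l0 by (simp add: algebra_simps)
        moreover have "r \<le> x / 2" using r by simp
        moreover have "8 * l \<le> \<delta> * x" using C(3) l0(1) by linarith
        ultimately show "1/2 * exp (- ((3/2 - e/2) * ln x)) \<le> q" "q \<le> exp (- (7/5 * ln x))" "T \<le> r"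
          unfolding q_def using tail_prob_asymp[OF e \<delta>_def s_def C(5) _ T _ _ C(1)] l_def L_def by auto
      qed
      let ?y = "exp (- ((3/2 - e/2) * ln x))"
      have q0: "0 < q" using q(1) exp_gt_zero[of "- ((3/2 - e/2) * ln x)"] by linarith
      have y: "x\<^sup>2 * ?y = x powr (1/2 + e/2)"
      proof -
        have "x\<^sup>2 = x powr 2" using C(5) by simp
        moreover have "?y = x powr (- (3/2 - e/2))" using C(5) unfolding powr_def by (simp add: left_diff_distrib)
        ultimately have "x\<^sup>2 * ?y = x powr 2 * x powr (- (3/2 - e/2))" by (simp only:)
        also have "\<dots> = x powr (1/2 + e/2)" by (simp flip: powr_add)
        finally show ?thesis .
      qed
      define c where "c = real (m choose 2)"
      have m2: "2 \<le> m" using m C(3) l0(1) by linarith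
      have c_eq: "c = real m * (real m - 1) / 2"
        unfolding c_def using m2 by (simp add: choose_two real_of_nat_div of_nat_diff)
      have c1: "\<delta>\<^sup>2 * x\<^sup>2 / 8 \<le> c"
      proof -
        have "(\<delta> * x / 2) * (\<delta> * x / 2) \<le> real m * (real m - 1)"
          using m C(3) l0 \<delta> C(5) by (intro mult_mono) auto
        then show ?thesis unfolding c_eq by (simp add: power2_eq_square mult_ac)
      qed
      have c0: "0 < c" unfolding c_eq using m2 by simp
      have cq: "\<delta>\<^sup>2 * x powr (1/2 + e/2) / 16 \<le> c * q"
        unfolding y[symmetric] using mult_mono[OF c1 q(1)] c0 by (simp add: mult_ac)
      have y0: "0 < \<delta>\<^sup>2 * x powr (1/2 + e/2) / 16" using \<delta> C(5) by simp
      have t1: "4 / (c * q) \<le> 64 / (\<delta>\<^sup>2 * x powr (1/2 + e/2))"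
      proof -
        have "4 / (c * q) \<le> 4 / (\<delta>\<^sup>2 * x powr (1/2 + e/2) / 16)" using cq y0 by (intro divide_left_mono) auto
        then show ?thesis by simp
      qed
      have t2: "4 * real m ^ 3 * q / c \<le> 16 * x * exp (- (7/5 * ln x))"
      proof -
        have "real m ^ 3 / c \<le> 4 * real m"
        proof -
          have "real m * 1 \<le> real m * (real m - 1)" using m2 by (intro mult_left_mono) auto
          then have "real m * (real m * real m) \<le> real m * (real m * (2 * (real m - 1)))"
            using m2 by (intro mult_left_mono) auto
          moreover have "real m * (real m * (2 * (real m - 1))) = 4 * real m * c" unfolding c_eq by simp
          ultimately have "real m ^ 3 \<le> 4 * real m * c" by (simp only: power3_eq_cube mult.assoc)
          then show ?thesis using c0 by (simp only: pos_divide_le_eq)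
        qed
        also have "\<dots> \<le> 4 * x" using r by simp
        finally have "4 * (real m ^ 3 / c) * q \<le> 4 * (4 * x) * exp (- (7/5 * ln x))"
          using q(2) q0 C(5) c0 by (intro mult_mono) auto
        then show ?thesis by (simp add: mult_ac)
      qed
      have pb: "2 powr (- b) = exp (- (10 * ln x))" unfolding b_def using C(5) by (intro two_powr_log) simp
      have kn: "real k \<le> x" "real m \<le> x" using N by linarith+
      have t3: "real (k * (k + 1)) * 2 powr (- b) + real (m * (k + 1)) * exp (- (real k / 100))
        \<le> x * (x + 1) * exp (- (10 * ln x)) + x * (x + 1) * exp (- (4 * l))"
        unfolding pb using kn k C(5) unfolding of_nat_mult of_nat_add of_nat_1
        by (intro add_mono mult_mono) auto
      have t4: "real n ^ 4 * (2 powr h * (255/256) ^ (m + r - 4)) \<le> x ^ 4 * exp (- (x / 2000))"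
      proof -
        have "2 powr real h = exp (real h * ln 2)" by (simp add: powr_def)
        also have "\<dots> \<le> exp (x / 2000)"
        proof -
          have "real h * ln 2 \<le> real h * 1" using ln_2_less_1 by (intro mult_left_mono) auto
          then show ?thesis using h by simp
        qed
        finally have 1: "2 powr real h \<le> exp (x / 2000)" .
        have "255/256 \<le> exp (- (1/256) :: real)" using exp_ge_add_one_self[of "- (1/256) :: real"] by simp
        then have "(255/256) ^ (m + r - 4) \<le> exp (- (1/256) :: real) ^ (m + r - 4)" by (intro power_mono) auto
        also have "\<dots> = exp (- (real (m + r - 4) / 256))" by (simp flip: exp_of_nat_mult)
        also have "\<dots> \<le> exp (- (x / 1000))"
        proof -
          have "256 * x / 1000 \<le> real m + real r - 4" using r m dx C(3,5) l0(1) by linarith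
          also have "\<dots> \<le> real (m + r - 4)" by linarith
          finally show ?thesis by simp
        qed
        finally have 2: "(255/256) ^ (m + r - 4) \<le> exp (- (x / 1000))" .
        have "2 powr h * (255/256) ^ (m + r - 4) \<le> exp (x / 2000) * exp (- (x / 1000))"
          using 1 2 by (intro mult_mono) auto
        also have "\<dots> = exp (- (x / 2000))" by (simp flip: exp_add)
        finally show ?thesis unfolding x_def by (intro mult_left_mono) auto
      qed
      have t5: "real n ^ 2 * exp (- (2 * (2 * l)\<^sup>2 / n)) = x\<^sup>2 * exp (- (8 * ln x))"
        using l0 C(5) by (simp add: x_def[symmetric] power_mult_distrib)
      have t6: "real n ^ 2 * exp (- (2 * (e / 4 * l)\<^sup>2 / (3 * real m + 1))) \<le> x\<^sup>2 * exp (- (3 * ln x))"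
      proof -
        have "3 * ln x * (3 * real m + 1) \<le> 3 * ln x * (4 * \<delta> * x)"
          using m(2) C(3) l0 lx by (intro mult_left_mono) auto
        also have "\<dots> \<le> e\<^sup>2 / 8 * (x * ln x)" unfolding \<delta>_def using lx C(5) by simp
        also have "\<dots> = 2 * (e / 4 * l)\<^sup>2" unfolding power_mult_distrib l0(2) by (simp add: power2_eq_square)
        finally have "3 * ln x \<le> 2 * (e / 4 * l)\<^sup>2 / (3 * real m + 1)" by (simp add: pos_le_divide_eq)
        then show ?thesis unfolding x_def by (intro mult_left_mono) auto
      qed
      have t7: "real (n ^ 2 * (n + 1)) * 2 powr (- b) = x\<^sup>2 * (x + 1) * exp (- (10 * ln x))"
        unfolding pb x_def by (simp only: of_nat_mult of_nat_power of_nat_add of_nat_1)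
      have t8: "real (n ^ 2 * (n + 1)) * exp (- ((real m - 1) / 100)) \<le> x\<^sup>2 * (x + 1) * exp (- ((\<delta> * x - 2) / 100))"
      proof -
        have "exp (- ((real m - 1) / 100)) \<le> exp (- ((\<delta> * x - 2) / 100))" using m(1) by simp
        then have "x\<^sup>2 * (x + 1) * exp (- ((real m - 1) / 100)) \<le> x\<^sup>2 * (x + 1) * exp (- ((\<delta> * x - 2) / 100))"
          using C(5) by (intro mult_left_mono) auto
        then show ?thesis unfolding x_def by (simp only: of_nat_mult of_nat_power of_nat_add of_nat_1)
      qed
      \<comment> \<open>In the final phase \<open>m\<close> merges reduce the number of blocks, about \<open>(x + m) / 2\<close>, to less than \<open>d\<close>, since \<open>m / 2\<close> exceeds \<open>l\<close>.\<close>
      have bound: "pr (pairs {1..n}) (\<lambda>E. \<not> has_sequence d {1..n} E)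
        \<le> (4 / (c * q) + 4 * real m ^ 3 * q / c) +
          (real (k * (k + 1)) * 2 powr (- b) + real (m * (k + 1)) * exp (- (real k / 100))) +
          real n ^ 4 * (2 powr h * (255/256) ^ (m + r - 4)) +
          real n ^ 2 * exp (- (2 * (2 * l)\<^sup>2 / n)) + real n ^ 2 * exp (- (2 * (e / 4 * l)\<^sup>2 / (3 * real m + 1))) +
          real (n ^ 2 * (n + 1)) * 2 powr (- b) + real (n ^ 2 * (n + 1)) * exp (- ((real m - 1) / 100))"
        unfolding c_def
      proof (rule pr_no_contraction_sequence[OF rn m2 q(3) q_def q0, where N = N and t = m])
        have "real k \<le> \<delta>\<^sup>2 * x powr (1/2 + e/2) / 16 / 4" using k C(4) by simp
        then show "real k \<le> real (m choose 2) * q / 4" using cq unfolding c_def by linarith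
        show "0 \<le> 2 * l" "0 \<le> e / 4 * l" using l0(1) u by auto
        show "real n / 2 - T + e / 4 * l + 2 * b \<le> d" using T' d Cu(2) unfolding u(3) x_def by linarith
        show "real n / 2 + 2 * l - real k / 100 + b \<le> d" using k d Cu(2) a u(1,2) l0(1) b0 unfolding x_def by linarith
        show "real n / 2 + 2 * l + real k - (real m - 1) / 100 \<le> d"
          using k d C(3) a u(1,2) l0(1) m unfolding x_def diff_divide_distrib by linarith
        show "N + k + m + r = n" by (rule Nn)
        have "real N \<le> real d + 1 + real m" using N r d k a u(1,2) l0(1) m C(3) by linarith
        then show "N \<le> d + 1 + m" by linarith
        have "real N + real m \<le> real d + real h" using N r d k a u(1,2) l0(1) m C(3) h dx by linarith
        then show "N + m \<le> d + h" by linarith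
        have "2 * real m + 2 \<le> real N" using N r k l0(1) m C(3) dx by linarith
        then show "2 * m + 2 \<le> N" by linarith
        have "real m + real r + real k \<le> real d + real h" using r d k a u(1,2) l0(1) m C(3) h dx by linarith
        then show "m + r + k \<le> d + h" by linarith
      qed
      have "?p n \<le> pr (pairs {1..n}) (\<lambda>E. \<not> has_sequence d {1..n} E)"
        using d(2) unfolding contractible_def se(1)[symmetric] x_def l_def L_def s_def
        by (intro pr_mono) blast
      also note bound
      finally show ?case
        using t1 t2 t3 t4 t5 t6 t7 t8 unfolding g_def x_def[symmetric] l_def[symmetric] by linarith
    qed
  qed
qed

text \<open>Take \<open>k\<close> as \<open>e L / 8\<close> in the general bound. A pair that a contraction sequence of this width needs has
at most \<open>n/2 - (sqrt 3 / 2 + e / 2) L\<close> splitters, so there are \<open>O(sqrt n)\<close> such pairs in expectation, and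
\<open>sqrt n / L\<close> tends to 0.\<close>

lemma no_cheap_contraction_sequence_whp:
  fixes e :: real
  assumes e: "0 < e" "e \<le> 1"
  shows "(\<lambda>n. pr (pairs {1..n})
      (contractible n (real n / 2 - (sqrt 3 / 2 + e) * sqrt (real n * ln (real n))))) \<longlonglongrightarrow> 0"
    (is "?p \<longlonglongrightarrow> 0")
proof -
  define s where "s = sqrt 3 / 2"
  have s: "43/50 \<le> s" "s \<le> 87/100" "s\<^sup>2 = 3/4" using sqrt3_half by (simp_all only: s_def)
  define L where "L x = sqrt (x * ln x)" for x :: real
  define g where "g x = x\<^sup>2 * exp (- (3/2 * ln x)) / (e / 8 * L x - 1) + x\<^sup>2 * exp (- (8 * ln x))" for x
  have g: "(g \<longlongrightarrow> 0) at_top" unfolding g_def L_def using e by real_asymp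
  have ev: "eventually (\<lambda>x. 2 \<le> e / 8 * L x \<and> 10 * L x + 10 \<le> x / 2 \<and> 10 \<le> x) at_top"
    unfolding L_def using e by (intro eventually_conj) real_asymp+
  show ?thesis
  proof (rule tendsto_sandwich[OF _ _ tendsto_const])
    show "(\<lambda>n. g (real n)) \<longlonglongrightarrow> 0" by (rule filterlim_compose[OF g filterlim_real_sequentially])
    show "\<forall>\<^sub>F n in sequentially. 0 \<le> ?p n"
      by (intro always_eventually allI pr_nonneg)
    show "\<forall>\<^sub>F n in sequentially. ?p n \<le> g (real n)"
      using eventually_compose_filterlim[OF ev filterlim_real_sequentially]
    proof eventually_elim
      case (elim n)
      define x where "x = real n"
      define l where "l = L x"
      have C: "2 \<le> e / 8 * l" "10 * l + 10 \<le> x / 2" "10 \<le> x" using elim by (simp_all add: x_def l_def)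
      have lx: "0 < ln x" using C by simp
      have l0: "0 \<le> l" "l\<^sup>2 = x * ln x" unfolding l_def L_def using C lx by auto
      define a u where "a = s * l" and "u = e * l"
      have u: "u \<le> l" "0 \<le> u" "e / 8 * l = u / 8" using e l0(1) mult_right_mono[of e 1 l] by (auto simp: u_def)
      have a: "43/50 * l \<le> a" "a \<le> 87/100 * l" unfolding a_def by (rule mult_right_mono[OF s(1) l0(1)], rule mult_right_mono[OF s(2) l0(1)])
      have se: "(s + e) * l = a + u" "(s + e / 2) * l = a + u / 2" by (simp_all add: a_def u_def algebra_simps)
      define k where "k = nat \<lfloor>e / 8 * l\<rfloor>"
      have k: "u / 8 - 1 \<le> k" "k \<le> u / 8" unfolding k_def u(3) using u(2) by linarith+
      define d where "d = nat \<lfloor>x / 2 - (s + e) * l\<rfloor>"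
      have "0 \<le> x / 2 - (a + u)" using u(1,2) a C(2,3) l0(1) by linarith
      then have d: "d \<le> x / 2 - (a + u)" "x / 2 - (a + u) < real d + 1" unfolding d_def se by linarith+
      have t1: "real n ^ 2 * exp (- (2 * ((s + e / 2) * l)\<^sup>2 / n)) / k \<le> x\<^sup>2 * exp (- (3/2 * ln x)) / (e / 8 * l - 1)"
      proof -
        have "s\<^sup>2 \<le> (s + e / 2)\<^sup>2" using s(1) e by (intro power_mono) auto
        then have "3/4 * (x * ln x) \<le> (s + e / 2)\<^sup>2 * (x * ln x)"
          unfolding s(3) using C lx by (intro mult_right_mono) auto
        then have "3/2 * ln x * x \<le> 2 * ((s + e / 2) * l)\<^sup>2" by (simp add: power_mult_distrib l0(2) mult_ac)
        then have "3/2 * ln x \<le> 2 * ((s + e / 2) * l)\<^sup>2 / x" using C by (simp add: pos_le_divide_eq)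
        then show ?thesis using k C unfolding x_def[symmetric] u(3) by (intro frac_le mult_left_mono) auto
      qed
      have t2: "real n ^ 2 * exp (- (2 * (2 * l)\<^sup>2 / n)) = x\<^sup>2 * exp (- (8 * ln x))"
        using l0 C(3) by (simp add: x_def[symmetric] power_mult_distrib)
      have "?p n \<le> pr (pairs {1..n}) (\<lambda>E. has_sequence d {1..n} E)"
      proof (rule pr_mono)
        fix E assume "contractible n (real n / 2 - (sqrt 3 / 2 + e) * sqrt (real n * ln (real n))) E"
        then obtain d' Ts where Ts: "contraction_sequence d' (trigraph_of_graph {1..n} E) Ts"
          "real d' \<le> x / 2 - (s + e) * l"
          unfolding contractible_def x_def l_def L_def s_def by auto
        then have "real d' < real d + 1" using d(2) se(1) by linarith
        then have "d' \<le> d" by linarith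
        then have "contraction_sequence d (trigraph_of_graph {1..n} E) Ts"
          using Ts(1) unfolding contraction_sequence_def by (meson le_trans)
        then show "has_sequence d {1..n} E" by blast
      qed
      also have "\<dots> \<le> real n ^ 2 * exp (- (2 * ((s + e / 2) * l)\<^sup>2 / n)) / k + real n ^ 2 * exp (- (2 * (2 * l)\<^sup>2 / n))"
      proof (rule pr_contraction_sequence_small)
        show "2 \<le> n" using C(3) unfolding x_def by linarith
        show "1 \<le> k" using k C(1) u(3) by linarith
        have "real k < x" using k u(1,2) C(2,3) l0(1) by linarith
        then show "k < n" unfolding x_def by linarith
        show "0 \<le> (s + e / 2) * l" "0 \<le> 2 * l" using s e l0(1) by auto
        show "real d + 2 * real k \<le> (real n - 2) / 2 - (s + e / 2) * l"
          using d k C(1) unfolding se u(3) x_def[symmetric] diff_divide_distrib by linarith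
        show "2 * real d + 4 * real k + 3 < 3 * ((real n - 2) / 2 - 2 * l)"
          using d k u(1,2) a C(2,3) l0(1) unfolding x_def[symmetric] diff_divide_distrib right_diff_distrib by linarith
      qed
      also have "\<dots> \<le> g x" using t1 t2 unfolding g_def l_def[symmetric] by linarith
      finally show ?case unfolding x_def .
    qed
  qed
qed

lemma twin_width_whp:
  fixes e :: real
  assumes e: "0 < e" "e \<le> 1/100"
  shows "(\<lambda>n. measure_pmf.prob (random_graph n (1/2))
        {E. \<bar>real (twin_width (trigraph_of_graph {1..n} E))
              - (real n / 2 - sqrt (3 * real n * ln (real n)) / 2)\<bar> \<le> e * sqrt (real n * ln (real n))})
       \<longlonglongrightarrow> 1"
proof -
  define A where "A n E \<longleftrightarrow> \<not> contractible n (real n / 2 - (sqrt 3 / 2 - e) * sqrt (real n * ln (real n))) E" for n E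
  define B where "B n = contractible n (real n / 2 - (sqrt 3 / 2 + e) * sqrt (real n * ln (real n)))" for n
  define Near where "Near n E \<longleftrightarrow> \<bar>real (twin_width (trigraph_of_graph {1..n} E))
    - (real n / 2 - sqrt (3 * real n * ln (real n)) / 2)\<bar> \<le> e * sqrt (real n * ln (real n))" for n E
  have A: "(\<lambda>n. pr (pairs {1..n}) (A n)) \<longlonglongrightarrow> 0"
    unfolding A_def by (rule cheap_contraction_sequence_whp[OF e])
  have B: "(\<lambda>n. pr (pairs {1..n}) (B n)) \<longlonglongrightarrow> 0"
    unfolding B_def by (rule no_cheap_contraction_sequence_whp) (use e in auto)
  have lower: "1 - (pr (pairs {1..n}) (A n) + pr (pairs {1..n}) (B n)) \<le> pr (pairs {1..n}) (Near n)" for n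
  proof -
    let ?T = "\<lambda>E. trigraph_of_graph {1..n} E" and ?l = "sqrt (real n * ln (real n))"
    have fB: "finite (pairs {1..n})" by (intro finite_pairs) simp
    have "1 - (pr (pairs {1..n}) (A n) + pr (pairs {1..n}) (B n)) \<le> 1 - pr (pairs {1..n}) (\<lambda>E. A n E \<or> B n E)"
      using pr_disj[of "pairs {1..n}" "A n" "B n"] by simp
    also have "\<dots> = pr (pairs {1..n}) (\<lambda>E. \<not> (A n E \<or> B n E))" by (rule pr_not[OF fB, symmetric])
    also have "\<dots> \<le> pr (pairs {1..n}) (Near n)"
    proof (rule pr_mono)
      fix E assume "\<not> (A n E \<or> B n E)"
      then have nA: "\<not> A n E" and nB: "\<not> B n E" by auto
      obtain d Ts where d: "contraction_sequence d (?T E) Ts" "real d \<le> real n / 2 - (sqrt 3 / 2 - e) * ?l"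
        using nA unfolding A_def contractible_def by auto
      have "twin_width (?T E) \<le> d" unfolding twin_width_def by (rule Least_le) (use d(1) in blast)
      then have up: "real (twin_width (?T E)) \<le> real n / 2 - (sqrt 3 / 2 - e) * ?l" using d(2) by linarith
      have "\<exists>Ts. contraction_sequence (twin_width (?T E)) (?T E) Ts"
        unfolding twin_width_def by (rule LeastI_ex) (use d(1) in blast)
      then have lo: "real n / 2 - (sqrt 3 / 2 + e) * ?l \<le> real (twin_width (?T E))"
        using nB unfolding B_def contractible_def by (meson linear)
      have alg: "(a / 2 - e) * b = a * b / 2 - e * b" "(a / 2 + e) * b = a * b / 2 + e * b" for a b :: real
        by (simp_all add: left_diff_distrib distrib_right)
      have "sqrt (3 * real n * ln (real n)) = sqrt 3 * ?l" by (simp add: real_sqrt_mult)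
      then show "Near n E"
        unfolding Near_def using up[unfolded alg] lo[unfolded alg] by linarith
    qed
    finally show ?thesis .
  qed
  have lim: "(\<lambda>n. 1 - (pr (pairs {1..n}) (A n) + pr (pairs {1..n}) (B n))) \<longlonglongrightarrow> 1"
    using tendsto_diff[OF tendsto_const[of 1] tendsto_add[OF A B]] by simp
  have "(\<lambda>n. pr (pairs {1..n}) (Near n)) \<longlonglongrightarrow> 1"
    by (rule tendsto_sandwich[OF _ _ lim tendsto_const])
      (use lower in \<open>auto intro!: always_eventually pr_le_1 finite_pairs\<close>)
  then show ?thesis unfolding prob_random_graph Near_def .
qed

theorem corollary1p4:
  "\<exists>h :: nat \<Rightarrow> real.
     (\<lambda>n. h n / sqrt (real n * ln (real n))) \<longlonglongrightarrow> 0 \<and>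
     (\<lambda>n. measure_pmf.prob (random_graph n (1/2))
        {E. \<bar>real (twin_width (trigraph_of_graph {1..n} E))
              - (real n / 2 - sqrt (3 * real n * ln (real n)) / 2)\<bar> \<le> h n})
       \<longlonglongrightarrow> 1"
proof -
  \<comment> \<open>the shift by 100 keeps the relative errors in the range of the preceding lemma\<close>
  define f where "f j n = measure_pmf.prob (random_graph n (1/2))
        {E. \<bar>real (twin_width (trigraph_of_graph {1..n} E))
              - (real n / 2 - sqrt (3 * real n * ln (real n)) / 2)\<bar>
            \<le> 1 / (real j + 100) * sqrt (real n * ln (real n))}" for j n
  have "f j \<longlonglongrightarrow> 1" for j
    unfolding f_def by (rule twin_width_whp) (simp_all add: field_simps)
  moreover have "f j n \<le> 1" for j n unfolding f_def by simp
  ultimately obtain J where J: "filterlim J at_top sequentially" "(\<lambda>n. f (J n) n) \<longlonglongrightarrow> 1"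
    using diagonal_tendsto_1[of f] by auto
  define h where "h n = 1 / (real (J n) + 100) * sqrt (real n * ln (real n))" for n
  have "(\<lambda>n. 1 / (real (J n) + 100)) \<longlonglongrightarrow> 0"
  proof -
    have "(\<lambda>j. 1 / (real j + 100)) \<longlonglongrightarrow> 0" by real_asymp
    from filterlim_compose[OF this J(1)] show ?thesis .
  qed
  moreover have "\<forall>\<^sub>F n in sequentially. h n / sqrt (real n * ln (real n)) = 1 / (real (J n) + 100)"
    using eventually_gt_at_top[of 1] by eventually_elim (simp add: h_def)
  ultimately have "(\<lambda>n. h n / sqrt (real n * ln (real n))) \<longlonglongrightarrow> 0"
    by (simp cong: tendsto_cong)
  moreover have "(\<lambda>n. measure_pmf.prob (random_graph n (1/2))
        {E. \<bar>real (twin_width (trigraph_of_graph {1..n} E))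
              - (real n / 2 - sqrt (3 * real n * ln (real n)) / 2)\<bar> \<le> h n}) \<longlonglongrightarrow> 1"
    using J(2) unfolding f_def h_def .
  ultimately show ?thesis by blast
qed

end
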